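(* Let $W$ be of type $A_n$ and let $c$ be any Coxeter element. For every positive root $\beta\in\Phi^+$, let $k$ be the unique index $k\in\{n+1,\dots,n+N\}$ with $r(I_g,k)=\beta$. Then the following two statements hold: (1) $\mathrm{Newton}(F_\beta)=\mathrm{conv}\{w(I,k)-w(I_{ag},k): I \text{ facet of } \mathcal{S}(Q)\}$; (2) the set of exponent vectors $\{\lambda_1\alpha_1+\dots+\lambda_n\alpha_n : y_1^{\lambda_1}\cdots y_n^{\lambda_n}\text{ is a monomial of } F_\beta\}$ equals $\mathrm{Newton}(F_\beta)\cap\mathbb{Z}_{\ge0}\Delta$.
   Context: Let $(W,\mathcal{S})$ be a finite crystallographic Coxeter system of rank $n$ with simple roots $\Delta$ and fundamental weights $\omega_s$. Let $\Phi^+$ be the positive roots, $N=|\Phi^+|$, and $w_\circ$ the longest element. Fix a Coxeter element $c$ with reduced word $s_1\cdots s_n$, and write $\alpha_i=\alpha_{s_i}$. Let $\mathbf{w}_\circ(c)=q_1\cdots q_N$ be the lexicographically first subword of $s_1\cdots s_n s_1\cdots s_n\cdots$ that is a reduced word for $w_\circ$. Let $Q=Q_1\cdots Q_{n+N}=s_1\cdots s_nq_1\cdots q_N$. Facets of $\mathcal{S}(Q)$ are the $n$-subsets $I\subseteq[n+N]$ whose deletion from $Q$ leaves a reduced word for $w_\circ$. The greedy facet $I_g$ and antigreedy facet $I_{ag}$ are the lexicographically first and last facets. For a facet $I$ and position $k$, let $\Pi_{I,k}$ be the ordered product of the $Q_x$ for $x\in[k-1]\setminus I$. The root function is $r(I,k)=\Pi_{I,k}(\alpha_{Q_k})$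 and the weight function is $w(I,k)=\Pi_{I,k}(\omega_{Q_k})$. $\mathcal{A}(W,c)$ is the cluster algebra with principal coefficients with initial extended exchange matrix $\begin{bmatrix}B_c\\ \mathrm{Id}_n\end{bmatrix}$, where $B_c=(b_{ij})$ has $b_{ij}=-a_{s_is_j}$ if $i<j$, $b_{ij}=a_{s_is_j}$ if $i>j$, $b_{ii}=0$, and $a$ is the Cartan matrix. Its initial variables are $x_1,\dots,x_n$ and coefficients $y_1,\dots,y_n$. Every cluster variable has the form $u=p(\mathbf{x},\mathbf{y})/x^{d}$, with $d$-vector $\sum d_i\alpha_i$. The $d$-vectors of non-initial cluster variables are exactly the positive roots. For $\beta\in\Phi^+$, the $F$-polynomial is $F_\beta(\mathbf{y})=u(1,\dots,1,\mathbf{y})$ for the cluster variable $u$ with $d$-vector $\beta$. Its Newton polytope is $\mathrm{Newton}(F_\beta)=\mathrm{conv}\{\sum\lambda_i\alpha_i : \mathbf{y}^\lambda\text{ a monomial of }F_\beta\}$. *)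

theory Defs
  imports
    "HOL-Analysis.Analysis"
    "HOL-Analysis.Finite_Function_Topology"
    "HOL-Computational_Algebra.Computational_Algebra"
begin

section \<open>Root systems and Weyl groups\<close>

text \<open>
  The simple reflections are labelled by the nodes \<open>1, \<dots>, n\<close> of the Dynkin diagram.  A vector
  \<open>v\<close> stands for the sum of all \<open>v\<^sub>s \<alpha>\<^sub>s\<close>, that is, its entries are its coordinates in the basis
  of simple roots.  A Cartan matrix is a function \<open>a :: nat \<Rightarrow> nat \<Rightarrow> int\<close> of which
  only the entries with indices in \<open>{1..n}\<close> are used; the convention is
  \<open>a s t = \<langle>\<alpha>\<^sub>s\<^sup>\<or>, \<alpha>\<^sub>t\<rangle>\<close>, hence \<open>s(\<alpha>\<^sub>t) = \<alpha>\<^sub>t - a s t \<alpha>\<^sub>s\<close>.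
\<close>

type_synonym rvec = "nat \<Rightarrow>\<^sub>0 real"

definition cartan_A :: "nat \<Rightarrow> nat \<Rightarrow> int" where
  "cartan_A s t = (if s = t then 2 else if s = t + 1 \<or> t = s + 1 then - 1 else 0)"

definition simple_root :: "nat \<Rightarrow> rvec" where
  "simple_root s = Poly_Mapping.single s 1"

definition coroot_pairing :: "nat \<Rightarrow> (nat \<Rightarrow> nat \<Rightarrow> int) \<Rightarrow> nat \<Rightarrow> rvec \<Rightarrow> real" where
  "coroot_pairing n a s v = (\<Sum>t\<in>{1..n}. of_int (a s t) * Poly_Mapping.lookup v t)"

definition simple_reflection :: "nat \<Rightarrow> (nat \<Rightarrow> nat \<Rightarrow> int) \<Rightarrow> nat \<Rightarrow> rvec \<Rightarrow> rvec" where
  "simple_reflection n a s v = v - coroot_pairing n a s v *\<^sub>R simple_root s"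

definition fundamental_weight :: "nat \<Rightarrow> (nat \<Rightarrow> nat \<Rightarrow> int) \<Rightarrow> nat \<Rightarrow> rvec" where
  "fundamental_weight n a s =
     (THE v. Poly_Mapping.keys v \<subseteq> {1..n} \<and>
             (\<forall>t\<in>{1..n}. coroot_pairing n a t v = (if t = s then 1 else 0)))"

text \<open>The group element represented by a word, as a linear map; the last letter acts first.\<close>

definition word_prod :: "nat \<Rightarrow> (nat \<Rightarrow> nat \<Rightarrow> int) \<Rightarrow> nat list \<Rightarrow> rvec \<Rightarrow> rvec" where
  "word_prod n a ws = foldr (\<lambda>s g. simple_reflection n a s \<circ> g) ws id"

definition weyl_group :: "nat \<Rightarrow> (nat \<Rightarrow> nat \<Rightarrow> int) \<Rightarrow> (rvec \<Rightarrow> rvec) set" where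
  "weyl_group n a = word_prod n a ` lists {1..n}"

definition weyl_length :: "nat \<Rightarrow> (nat \<Rightarrow> nat \<Rightarrow> int) \<Rightarrow> (rvec \<Rightarrow> rvec) \<Rightarrow> nat" where
  "weyl_length n a w = (LEAST l. \<exists>ws\<in>lists {1..n}. word_prod n a ws = w \<and> length ws = l)"

definition reduced_word :: "nat \<Rightarrow> (nat \<Rightarrow> nat \<Rightarrow> int) \<Rightarrow> nat list \<Rightarrow> (rvec \<Rightarrow> rvec) \<Rightarrow> bool" where
  "reduced_word n a ws w \<longleftrightarrow>
     ws \<in> lists {1..n} \<and> word_prod n a ws = w \<and> length ws = weyl_length n a w"

definition longest_element :: "nat \<Rightarrow> (nat \<Rightarrow> nat \<Rightarrow> int) \<Rightarrow> rvec \<Rightarrow> rvec" where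
  "longest_element n a =
     (THE w. w \<in> weyl_group n a \<and> (\<forall>u\<in>weyl_group n a. weyl_length n a u \<le> weyl_length n a w))"

definition roots :: "nat \<Rightarrow> (nat \<Rightarrow> nat \<Rightarrow> int) \<Rightarrow> rvec set" where
  "roots n a = {w (simple_root s) | w s. w \<in> weyl_group n a \<and> s \<in> {1..n}}"

definition positive_roots :: "nat \<Rightarrow> (nat \<Rightarrow> nat \<Rightarrow> int) \<Rightarrow> rvec set" where
  "positive_roots n a = {\<beta> \<in> roots n a. \<forall>s. 0 \<le> Poly_Mapping.lookup \<beta> s}"

definition coxeter_element :: "nat \<Rightarrow> (nat \<Rightarrow> nat \<Rightarrow> int) \<Rightarrow> (rvec \<Rightarrow> rvec) \<Rightarrow> bool" where
  "coxeter_element n a c \<longleftrightarrow> (\<exists>ws. distinct ws \<and> set ws = {1..n} \<and> c = word_prod n a ws)"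


section \<open>Sorting words and subword complexes\<close>

definition lex_le :: "nat set \<Rightarrow> nat set \<Rightarrow> bool" where
  "lex_le I J \<longleftrightarrow>
     I = J \<or> (sorted_list_of_set I, sorted_list_of_set J) \<in> lexord less_than"

definition lex_first :: "nat set set \<Rightarrow> nat set" where
  "lex_first \<I> = (THE I. I \<in> \<I> \<and> (\<forall>J\<in>\<I>. lex_le I J))"

definition lex_last :: "nat set set \<Rightarrow> nat set" where
  "lex_last \<I> = (THE I. I \<in> \<I> \<and> (\<forall>J\<in>\<I>. lex_le J I))"

text \<open>
  From here on \<open>cs\<close> is the reduced word \<open>s\<^sub>1 \<dots> s\<^sub>n\<close> of the Coxeter element, so \<open>s\<^sub>i\<close> is
  \<open>cs ! (i - 1)\<close>.  In the infinite word \<open>s\<^sub>1 \<dots> s\<^sub>n s\<^sub>1 \<dots> s\<^sub>n \<dots>\<close> positions are counted from \<open>0\<close>;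
  in \<open>Q\<close> they are counted from \<open>1\<close>.
\<close>

definition periodic_subword :: "nat list \<Rightarrow> nat set \<Rightarrow> nat list" where
  "periodic_subword cs J = map (\<lambda>p. cs ! (p mod length cs)) (sorted_list_of_set J)"

definition sorting_word :: "nat \<Rightarrow> (nat \<Rightarrow> nat \<Rightarrow> int) \<Rightarrow> nat list \<Rightarrow> nat list" where
  "sorting_word n a cs =
     periodic_subword cs
       (lex_first {J. finite J \<and> reduced_word n a (periodic_subword cs J) (longest_element n a)})"

definition Q_word :: "nat \<Rightarrow> (nat \<Rightarrow> nat \<Rightarrow> int) \<Rightarrow> nat list \<Rightarrow> nat list" where
  "Q_word n a cs = cs @ sorting_word n a cs"

definition letter :: "nat list \<Rightarrow> nat \<Rightarrow> nat" where
  "letter Q k = Q ! (k - 1)"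

definition subword_before :: "nat list \<Rightarrow> nat set \<Rightarrow> nat \<Rightarrow> nat list" where
  "subword_before Q I k = map (letter Q) (filter (\<lambda>x. x \<notin> I) [1..<k])"

definition facets :: "nat \<Rightarrow> (nat \<Rightarrow> nat \<Rightarrow> int) \<Rightarrow> nat list \<Rightarrow> nat set set" where
  "facets n a Q =
     {I. I \<subseteq> {1..length Q} \<and> card I = n \<and>
         reduced_word n a (subword_before Q I (length Q + 1)) (longest_element n a)}"

definition greedy_facet :: "nat \<Rightarrow> (nat \<Rightarrow> nat \<Rightarrow> int) \<Rightarrow> nat list \<Rightarrow> nat set" where
  "greedy_facet n a Q = lex_first (facets n a Q)"

definition antigreedy_facet :: "nat \<Rightarrow> (nat \<Rightarrow> nat \<Rightarrow> int) \<Rightarrow> nat list \<Rightarrow> nat set" where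
  "antigreedy_facet n a Q = lex_last (facets n a Q)"

definition root_function ::
    "nat \<Rightarrow> (nat \<Rightarrow> nat \<Rightarrow> int) \<Rightarrow> nat list \<Rightarrow> nat set \<Rightarrow> nat \<Rightarrow> rvec" where
  "root_function n a Q I k = word_prod n a (subword_before Q I k) (simple_root (letter Q k))"

definition weight_function ::
    "nat \<Rightarrow> (nat \<Rightarrow> nat \<Rightarrow> int) \<Rightarrow> nat list \<Rightarrow> nat set \<Rightarrow> nat \<Rightarrow> rvec" where
  "weight_function n a Q I k =
     word_prod n a (subword_before Q I k) (fundamental_weight n a (letter Q k))"


section \<open>The cluster algebra with principal coefficients\<close>

text \<open>
  Polynomials with integer coefficients in the variables \<open>Z\<^sub>1, Z\<^sub>2, \<dots>\<close>, where \<open>x\<^sub>i = Z\<^sub>i\<close> and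
  \<open>y\<^sub>i = Z\<^sub>n\<^sub>+\<^sub>i\<close> for \<open>1 \<le> i \<le> n\<close>, and their field of fractions.
\<close>

type_synonym mpol = "(nat \<Rightarrow>\<^sub>0 nat) \<Rightarrow>\<^sub>0 int"

definition Var :: "nat \<Rightarrow> mpol" where
  "Var i = Poly_Mapping.single (Poly_Mapping.single i 1) 1"

definition mpol_subst :: "(nat \<Rightarrow> mpol) \<Rightarrow> mpol \<Rightarrow> mpol" where
  "mpol_subst f p =
     (\<Sum>m\<in>Poly_Mapping.keys p. of_int (Poly_Mapping.lookup p m) *
        (\<Prod>i\<in>Poly_Mapping.keys m. f i ^ Poly_Mapping.lookup m i))"

text \<open>
  A seed consists of the extended cluster \<open>z\<^sub>1, \<dots>, z\<^sub>2\<^sub>n\<close> (with \<open>z\<^sub>n\<^sub>+\<^sub>i\<close> the frozen \<open>y\<^sub>i\<close>) and the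
  extended exchange matrix with rows \<open>1, \<dots>, 2n\<close> and columns \<open>1, \<dots>, n\<close>.
\<close>

type_synonym seed = "(nat \<Rightarrow> mpol fract) \<times> (nat \<Rightarrow> nat \<Rightarrow> int)"

definition initial_matrix :: "nat \<Rightarrow> (nat \<Rightarrow> nat \<Rightarrow> int) \<Rightarrow> nat list \<Rightarrow> nat \<Rightarrow> nat \<Rightarrow> int" where
  "initial_matrix n a cs i j =
     (if i \<le> n then
        (if i < j then - a (letter cs i) (letter cs j)
         else if i > j then a (letter cs i) (letter cs j)
         else 0)
      else if i = n + j then 1 else 0)"

definition initial_seed :: "nat \<Rightarrow> (nat \<Rightarrow> nat \<Rightarrow> int) \<Rightarrow> nat list \<Rightarrow> seed" where
  "initial_seed n a cs = (\<lambda>i. to_fract (Var i), initial_matrix n a cs)"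

definition mutate_matrix :: "nat \<Rightarrow> (nat \<Rightarrow> nat \<Rightarrow> int) \<Rightarrow> nat \<Rightarrow> nat \<Rightarrow> int" where
  "mutate_matrix k b i j =
     (if i = k \<or> j = k then - b i j
      else b i j + max 0 (b i k) * max 0 (b k j) - max 0 (- b i k) * max 0 (- b k j))"

text \<open>In the exponents, \<^const>\<open>nat\<close> takes the positive part \<open>[b]\<^sub>+\<close>.\<close>

definition mutate_cluster ::
    "nat \<Rightarrow> nat \<Rightarrow> (nat \<Rightarrow> nat \<Rightarrow> int) \<Rightarrow> (nat \<Rightarrow> mpol fract) \<Rightarrow> nat \<Rightarrow> mpol fract" where
  "mutate_cluster n k b z =
     z(k := ((\<Prod>i\<in>{1..2 * n}. z i ^ nat (b i k)) + (\<Prod>i\<in>{1..2 * n}. z i ^ nat (- b i k))) / z k)"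

inductive_set seeds :: "nat \<Rightarrow> (nat \<Rightarrow> nat \<Rightarrow> int) \<Rightarrow> nat list \<Rightarrow> seed set"
  for n :: nat and a :: "nat \<Rightarrow> nat \<Rightarrow> int" and cs :: "nat list" where
  initial: "initial_seed n a cs \<in> seeds n a cs"
| mutation: "(z, b) \<in> seeds n a cs \<Longrightarrow> k \<in> {1..n} \<Longrightarrow>
     (mutate_cluster n k b z, mutate_matrix k b) \<in> seeds n a cs"

definition cluster_variables :: "nat \<Rightarrow> (nat \<Rightarrow> nat \<Rightarrow> int) \<Rightarrow> nat list \<Rightarrow> mpol fract set" where
  "cluster_variables n a cs = {z i | z b i. (z, b) \<in> seeds n a cs \<and> i \<in> {1..n}}"

text \<open>
  \<open>u = p(x, y) / x\<^sup>d\<close> where no \<open>x\<^sub>i\<close> divides the polynomial \<open>p\<close>; this makes \<open>d\<close> and \<open>p\<close> unique.  The exponents \<open>d\<^sub>i\<close> may be negative.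
\<close>

definition laurent_form :: "nat \<Rightarrow> mpol fract \<Rightarrow> mpol \<Rightarrow> (nat \<Rightarrow> int) \<Rightarrow> bool" where
  "laurent_form n u p d \<longleftrightarrow>
     u = to_fract p / (\<Prod>i\<in>{1..n}. to_fract (Var i) powi d i) \<and>
     (\<forall>i\<in>{1..n}. \<not> Var i dvd p)"

definition has_d_vector :: "nat \<Rightarrow> nat list \<Rightarrow> mpol fract \<Rightarrow> rvec \<Rightarrow> bool" where
  "has_d_vector n cs u \<beta> \<longleftrightarrow>
     (\<exists>p d. laurent_form n u p d \<and>
            \<beta> = (\<Sum>i\<in>{1..n}. of_int (d i) *\<^sub>R simple_root (letter cs i)))"

definition cluster_variable_of ::
    "nat \<Rightarrow> (nat \<Rightarrow> nat \<Rightarrow> int) \<Rightarrow> nat list \<Rightarrow> rvec \<Rightarrow> mpol fract" where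
  "cluster_variable_of n a cs \<beta> = (THE u. u \<in> cluster_variables n a cs \<and> has_d_vector n cs u \<beta>)"

text \<open>
  Since \<open>x\<^sup>d\<close> becomes \<open>1\<close> at \<open>x = (1, \<dots>, 1)\<close>, the specialisation \<open>u(1, \<dots>, 1, y)\<close> of
  \<open>u = p(x, y) / x\<^sup>d\<close> is \<open>p(1, \<dots>, 1, y)\<close>.
\<close>

definition F_polynomial :: "nat \<Rightarrow> (nat \<Rightarrow> nat \<Rightarrow> int) \<Rightarrow> nat list \<Rightarrow> rvec \<Rightarrow> mpol" where
  "F_polynomial n a cs \<beta> =
     (THE f. \<exists>p d. laurent_form n (cluster_variable_of n a cs \<beta>) p d \<and>
                   f = mpol_subst (\<lambda>i. if i \<in> {1..n} then 1 else Var i) p)"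

text \<open>The exponent \<open>\<lambda>\<^sub>i\<close> of \<open>y\<^sub>i\<close> in a monomial is the entry at \<open>n + i\<close>.\<close>

definition exponent_vectors :: "nat \<Rightarrow> nat list \<Rightarrow> mpol \<Rightarrow> rvec set" where
  "exponent_vectors n cs f =
     {\<Sum>i\<in>{1..n}. real (Poly_Mapping.lookup m (n + i)) *\<^sub>R simple_root (letter cs i) | m.
        m \<in> Poly_Mapping.keys f}"

definition Newton :: "nat \<Rightarrow> nat list \<Rightarrow> mpol \<Rightarrow> rvec set" where
  "Newton n cs f = convex hull exponent_vectors n cs f"

definition nonneg_root_lattice :: "nat \<Rightarrow> rvec set" where
  "nonneg_root_lattice n = {\<Sum>s\<in>{1..n}. real (m s) *\<^sub>R simple_root s | m :: nat \<Rightarrow> nat. True}"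

definition root_index :: "nat \<Rightarrow> (nat \<Rightarrow> nat \<Rightarrow> int) \<Rightarrow> nat list \<Rightarrow> rvec \<Rightarrow> nat \<Rightarrow> bool" where
  "root_index n a Q \<beta> k \<longleftrightarrow>
     k \<in> {n + 1..n + card (positive_roots n a)} \<and>
     root_function n a Q (greedy_facet n a Q) k = \<beta>"

end

theory Submission
  imports Defs
begin

text \<open>
  For \<open>\<beta> = \<alpha>\<^sub>i + \<dots> + \<alpha>\<^sub>j\<close>, both sides are governed by the same closed subsets of the interval
  \<open>[i, j]\<close>: subsets \<open>S\<close> such that, for \<open>i < p \<le> j\<close>, \<open>p \<in> S\<close> implies \<open>p - 1 \<in> S\<close> if \<open>p - 1\<close> comes before
  \<open>p\<close> in the Coxeter word, and \<open>p - 1 \<in> S\<close> implies \<open>p \<in> S\<close> otherwise.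

  On the side of the subword complex, the Weyl group is the symmetric group and \<open>w(I, k)\<close> is the
  weight of a subset of \<open>{1, \<dots>, n + 1}\<close>. The subset obtained from the antigreedy facet is described
  by the 0-Hecke action, under which the Coxeter word exchanges one pair \<open>i, k\<close> in the set
  attached to a polygon diagonal. Facets that skip the letters of \<open>S\<close> in the initial
  copy of the Coxeter word realise the closed sets, and comparing partial products in the Bruhat
  order shows that nothing else occurs.

  On the side of the cluster algebra, seeds are triangulations of the \<open>(n + 3)\<close>-gon: the cluster
  variable of a diagonal is a determinant of plane vectors attached to the vertices, normalised by
  coefficients that satisfy the tropical Ptolemy relation, so that every mutation is a Ptolemy
  relation. Expanding the determinant along the interval gives a recursion for its numerator
  whose value at \<open>x = 1\<close> is the sum of \<open>\<Prod>\<^sub>t\<^sub>\<in>\<^sub>S y\<^sub>t\<close> over the closed sets \<open>S\<close>.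

  The exponent vectors are therefore 0/1 vectors, and 0/1 vectors are the only lattice points in
  their convex hull.
\<close>

section \<open>The symmetric group model of the Weyl group\<close>

text \<open>Sorting words and the two special facets are defined as lexicographic extremes, which
  are awkward to compute with. The way around is the Demazure product: the lexicographically first
  reduced subword is the greedy one, and each of its prefixes multiplies to the Demazure product of
  the whole prefix of the ambient word, skipped letters included. Partial products can thus be read
  off from nonreduced words such as powers of c, and only through their effect on the sets {1..s},
  which is all that fundamental weights see. The sorting word is never written out.

  In the cluster algebra the obstacle is that \<open>cluster_variable_of\<close> is a definite
  description. All cluster variables have to be known, the wanted one has to occur (an explicit
  chain of flips), and d-vectors have to separate them, which needs numerators in lowest terms.
  Setting one x_s to 0 and all other variables to 1 turns a numerator into a positive integer; this
  gives its nonvanishing and that x_s does not divide it. Coefficients are tropical functions on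
  pairs of vertices, so that frozen and mutable rows of the matrix mutate by the same
  computation.\<close>

lemma lookup_scaleR: "Poly_Mapping.lookup (c *\<^sub>R v) i = c *\<^sub>R Poly_Mapping.lookup (v :: rvec) i"
proof -
  have "finite {i. c *\<^sub>R Poly_Mapping.lookup v i \<noteq> 0}"
    by (rule finite_subset[of _ "Poly_Mapping.keys v"]) (auto simp: in_keys_iff)
  then show ?thesis
    by (simp add: scaleR_poly_mapping_def)
qed

lemma lookup_simple_root: "Poly_Mapping.lookup (simple_root s) t = (if s = t then 1 else 0)"
  by (simp add: simple_root_def lookup_single when_def)

lemma lookup_sum_simple_root:
  "finite A \<Longrightarrow> Poly_Mapping.lookup (\<Sum>s\<in>A. c s *\<^sub>R simple_root s) t = (if t \<in> A then c t else 0)"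
  by (simp add: lookup_sum lookup_scaleR lookup_simple_root if_distrib cong: if_cong)

lemma coroot_pairing_add:
  "coroot_pairing n a s (u + v) = coroot_pairing n a s u + coroot_pairing n a s v"
  by (simp add: coroot_pairing_def lookup_add algebra_simps sum.distrib)

lemma coroot_pairing_scaleR:
  "coroot_pairing n a s (c *\<^sub>R v) = c * coroot_pairing n a s v"
  by (simp add: coroot_pairing_def lookup_scaleR sum_distrib_left algebra_simps)

lemma linear_simple_reflection: "linear (simple_reflection n a s)"
  by (rule linearI)
     (simp_all add: simple_reflection_def coroot_pairing_add coroot_pairing_scaleR
        scaleR_add_left scaleR_diff_right)

lemma word_prod_simps [simp]:
  "word_prod n a [] = id"
  "word_prod n a (s # ws) = simple_reflection n a s \<circ> word_prod n a ws"
  by (simp_all add: word_prod_def)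

lemma linear_word_prod: "linear (word_prod n a ws)"
proof (induction ws)
  case Nil
  show ?case using linear_id by (simp add: id_def)
next
  case (Cons s ws)
  show ?case unfolding word_prod_simps
    by (rule linear_compose[OF Cons linear_simple_reflection])
qed

section \<open>Words as products of adjacent transpositions\<close>

abbreviation swp :: "nat \<Rightarrow> nat \<Rightarrow> nat" where
  "swp s \<equiv> Transposition.transpose s (Suc s)"

definition perm :: "nat list \<Rightarrow> nat \<Rightarrow> nat" where
  "perm ws = foldr (\<lambda>s g. swp s \<circ> g) ws id"

lemma perm_simps [simp]:
  "perm [] = id"
  "perm (s # ws) = swp s \<circ> perm ws"
  by (simp_all add: perm_def)

lemma perm_append: "perm (us @ vs) = perm us \<circ> perm vs"
  by (induction us) (simp_all add: comp_assoc)

lemma perm_permutes: "ws \<in> lists {1..n} \<Longrightarrow> perm ws permutes {1..Suc n}"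
proof (induction ws)
  case Nil
  show ?case using permutes_id by (simp add: id_def)
next
  case (Cons s ws)
  then have "perm ws permutes {1..Suc n}" and s: "s \<in> {1..Suc n}" "Suc s \<in> {1..Suc n}" by auto
  then show ?case unfolding perm_simps
    by (intro permutes_compose permutes_swap_id)
qed

lemma perm_rev: "perm (rev ws) \<circ> perm ws = id"
proof (induction ws)
  case (Cons s ws)
  have "perm (rev (s # ws)) \<circ> perm (s # ws) =
     perm (rev ws) \<circ> (swp s \<circ> swp s) \<circ> perm ws"
    unfolding rev.simps perm_append perm_simps by (simp only: comp_assoc id_o o_id)
  also have "\<dots> = id" unfolding transpose_comp_involutory o_id by (rule Cons)
  finally show ?case .
qed simp

lemma perm_rev': "perm ws \<circ> perm (rev ws) = id"
  using perm_rev[of "rev ws"] by simp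

lemma perm_in_range:
  "ws \<in> lists {1..n} \<Longrightarrow> x \<in> {1..Suc n} \<Longrightarrow> perm ws x \<in> {1..Suc n}"
  using perm_permutes permutes_in_image by metis

locale type_A =
  fixes n :: nat
begin

abbreviation "srefl \<equiv> simple_reflection n cartan_A"
abbreviation "wprod \<equiv> word_prod n cartan_A"
abbreviation "W \<equiv> lists {1..n}"

text \<open>The image of the standard basis vector \<open>e\<^sub>x\<close> of \<open>\<real>\<^sup>n\<^sup>+\<^sup>1\<close> modulo the all-one vector.\<close>

definition eps :: "nat \<Rightarrow> rvec" where
  "eps x = (\<Sum>t\<in>{1..n}. (of_bool (x \<le> t) - real t / real (n + 1)) *\<^sub>R simple_root t)"

text \<open>The orbit of the s-th fundamental weight corresponds to the s-element subsets of
  {1..n+1}; these are the weights of the s-th exterior power of the vector representation.\<close>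

definition wt :: "nat set \<Rightarrow> rvec" where
  "wt U = (\<Sum>x\<in>U. eps x)"

lemma lookup_eps:
  "Poly_Mapping.lookup (eps x) t =
     (if t \<in> {1..n} then of_bool (x \<le> t) - real t / real (n + 1) else 0)"
  unfolding eps_def by (simp add: lookup_sum_simple_root)

text \<open>\<open>h\<close> prolongs the coordinates of \<open>v\<close> by 0 to the indices 0 and
  n + 1. The Cartan matrix of a path then acts as a second difference, and the end nodes need no
  formula of their own.\<close>

lemma coroot_pairing_cartan_A:
  assumes "s \<in> {1..n}" "h 0 = 0" "h (Suc n) = 0"
    and "\<And>t. t \<in> {1..n} \<Longrightarrow> Poly_Mapping.lookup v t = h t"
  shows "coroot_pairing n cartan_A s v = 2 * h s - h (s - 1) - h (Suc s)"
proof -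
  have "coroot_pairing n cartan_A s v = (\<Sum>t\<in>{1..n}. of_int (cartan_A s t) * h t)"
    unfolding coroot_pairing_def using assms(4) by (intro sum.cong) auto
  also have "\<dots> = (\<Sum>t\<in>{0..Suc n}. of_int (cartan_A s t) * h t)"
    using assms(2,3) by (intro sum.mono_neutral_left) (auto simp: not_le le_Suc_eq)
  also have "\<dots> = (\<Sum>t\<in>{s - 1, s, Suc s}. of_int (cartan_A s t) * h t)"
    using assms(1) by (intro sum.mono_neutral_right) (auto simp: cartan_A_def)
  also have "\<dots> = 2 * h s - h (s - 1) - h (Suc s)"
    using assms(1) by (cases s) (auto simp: cartan_A_def)
  finally show ?thesis .
qed

lemma coroot_pairing_eps:
  assumes "s \<in> {1..n}" "x \<in> {1..Suc n}"
  shows "coroot_pairing n cartan_A s (eps x) = of_bool (x = s) - of_bool (x = Suc s)"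
proof -
  have "coroot_pairing n cartan_A s (eps x) =
     2 * (of_bool (x \<le> s) - real s / real (n + 1)) - (of_bool (x \<le> s - 1) - real (s - 1) / real (n + 1))
      - (of_bool (x \<le> Suc s) - real (Suc s) / real (n + 1))"
    using assms by (intro coroot_pairing_cartan_A) (auto simp: lookup_eps)
  also have "\<dots> = of_bool (x = s) - of_bool (x = Suc s)"
  proof -
    have q: "real s / real (n + 1) + real s / real (n + 1) =
       real (s - 1) / real (n + 1) + real (Suc s) / real (n + 1)"
      using assms(1) by (simp add: add_divide_distrib[symmetric] of_nat_diff)
    have b: "2 * of_bool (x \<le> s) - of_bool (x \<le> s - 1) - of_bool (x \<le> Suc s) =
       (of_bool (x = s) - of_bool (x = Suc s) :: real)"
      using assms(1) by auto
    show ?thesis using q b by argo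
  qed
  finally show ?thesis .
qed

lemma simple_root_eps: "s \<in> {1..n} \<Longrightarrow> simple_root s = eps s - eps (Suc s)"
  by (rule poly_mapping_eqI) (auto simp: lookup_simple_root lookup_minus lookup_eps)

lemma root_eps: "i \<le> k \<Longrightarrow> 1 \<le> i \<Longrightarrow> k \<le> Suc n \<Longrightarrow> eps i - eps k = (\<Sum>t\<in>{i..<k}. simple_root t)"
  by (rule poly_mapping_eqI) (auto simp: lookup_sum lookup_simple_root lookup_minus lookup_eps)

lemma srefl_eps:
  assumes "s \<in> {1..n}" "x \<in> {1..Suc n}"
  shows "srefl s (eps x) = eps (swp s x)"
  using assms
  by (auto simp: simple_reflection_def coroot_pairing_eps simple_root_eps Transposition.transpose_def)

lemma inj_on_eps: "inj_on eps {1..Suc n}"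
proof (rule inj_onI)
  fix x y assume xy: "x \<in> {1..Suc n}" "y \<in> {1..Suc n}" "eps x = eps y"
  have eq: "x \<le> t \<longleftrightarrow> y \<le> t" if "t \<in> {1..n}" for t
  proof -
    have "Poly_Mapping.lookup (eps x) t = Poly_Mapping.lookup (eps y) t" using xy by simp
    then show ?thesis using that by (auto simp: lookup_eps split: if_splits)
  qed
  have "x \<le> y" using eq[of y] xy(1,2) by (cases "y = Suc n") auto
  moreover have "y \<le> x" using eq[of x] xy(1,2) by (cases "x = Suc n") auto
  ultimately show "x = y" by simp
qed

lemma wprod_eps:
  assumes "ws \<in> W" "x \<in> {1..Suc n}"
  shows "wprod ws (eps x) = eps (perm ws x)"
  using assms
proof (induction ws)
  case (Cons s ws)
  have "perm ws x \<in> {1..Suc n}"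
    using perm_in_range[of ws n x] Cons by simp
  then show ?case using Cons by (simp add: srefl_eps)
qed simp

lemma wprod_wt:
  assumes "ws \<in> W" "U \<subseteq> {1..Suc n}"
  shows "wprod ws (wt U) = wt (perm ws ` U)"
proof -
  have inj: "inj_on (perm ws) U"
    using perm_permutes[OF assms(1)] by (meson permutes_inj_on)
  have "wprod ws (wt U) = (\<Sum>x\<in>U. wprod ws (eps x))"
    unfolding wt_def using linear_word_prod by (rule linear_sum)
  also have "\<dots> = (\<Sum>x\<in>U. eps (perm ws x))"
    using assms by (intro sum.cong) (auto intro!: wprod_eps)
  also have "\<dots> = wt (perm ws ` U)"
    unfolding wt_def by (simp add: sum.reindex[OF inj])
  finally show ?thesis .
qed

lemma lookup_wt:
  assumes "finite U"
  shows "Poly_Mapping.lookup (wt U) t =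
    (if t \<in> {1..n} then real (card (U \<inter> {..t})) - real (card U) * real t / real (n + 1) else 0)"
proof (cases "t \<in> {1..n}")
  case True
  have "Poly_Mapping.lookup (wt U) t = (\<Sum>x\<in>U. of_bool (x \<le> t) - real t / real (n + 1))"
    using True by (simp add: wt_def lookup_sum lookup_eps)
  also have "\<dots> = (\<Sum>x\<in>U. of_bool (x \<le> t)) - real (card U) * real t / real (n + 1)"
    by (simp add: sum_subtractf)
  also have "(\<Sum>x\<in>U. of_bool (x \<le> t) :: real) = real (card (U \<inter> {..t}))"
    using assms by (simp add: sum.If_cases of_bool_def Int_def atMost_def)
  finally show ?thesis using True by simp
qed (auto simp: wt_def lookup_sum lookup_eps intro!: sum.neutral)

text \<open>A kernel vector has vanishing second differences, so its coordinates are linear in the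
  index; the boundary value 0 at n + 1 forces slope 0.\<close>

lemma cartan_A_nonsingular:
  assumes "Poly_Mapping.keys v \<subseteq> {1..n}" "\<forall>t\<in>{1..n}. coroot_pairing n cartan_A t v = 0"
  shows "v = 0"
proof -
  define h where "h = Poly_Mapping.lookup v"
  have h0: "h 0 = 0" "h (Suc n) = 0"
    using assms(1) unfolding h_def by (auto simp: in_keys_iff subset_iff)
  have rec: "h (Suc t) = 2 * h t - h (t - 1)" if "t \<in> {1..n}" for t
    using coroot_pairing_cartan_A[OF that h0, of v] assms(2) that by (simp add: h_def)
  have lin: "t \<le> n \<Longrightarrow> h t = real t * h 1 \<and> h (Suc t) = real (Suc t) * h 1" for t
  proof (induction t)
    case 0
    then show ?case using h0 by simp
  next
    case (Suc t)
    then show ?case using rec[of "Suc t"] by (simp add: algebra_simps)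
  qed
  have "h 1 = 0" using lin[of n] h0 by auto
  then have "h t = 0" if "t \<in> {1..n}" for t using lin[of t] that by auto
  then show ?thesis
    using assms(1) unfolding h_def
    by (intro poly_mapping_eqI) (metis in_keys_iff lookup_zero subset_iff)
qed

lemma coroot_pairing_minus:
  "coroot_pairing m a s (u - v) = coroot_pairing m a s u - coroot_pairing m a s v"
  by (simp add: coroot_pairing_def lookup_minus algebra_simps sum_subtractf)

lemma coroot_pairing_sum:
  "coroot_pairing m a s (sum f A) = (\<Sum>x\<in>A. coroot_pairing m a s (f x))"
  by (induction A rule: infinite_finite_induct)
     (simp_all add: coroot_pairing_add, simp_all add: coroot_pairing_def)

lemma keys_wt: "finite U \<Longrightarrow> Poly_Mapping.keys (wt U) \<subseteq> {1..n}"
  by (auto simp: in_keys_iff lookup_wt split: if_splits)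

text \<open>The pairing with a simple coroot collapses over {1..s} to a difference of two membership
  tests. Uniqueness, which the definite description needs, is nonsingularity of the Cartan
  matrix.\<close>

lemma fundamental_weight_wt:
  assumes "s \<in> {1..n}"
  shows "fundamental_weight n cartan_A s = wt {1..s}"
proof -
  have keys: "Poly_Mapping.keys (wt {1..s}) \<subseteq> {1..n}"
    by (rule keys_wt) simp
  have pair: "coroot_pairing n cartan_A t (wt {1..s}) = (if t = s then 1 else 0)" if "t \<in> {1..n}" for t
  proof -
    have "coroot_pairing n cartan_A t (wt {1..s}) =
        (\<Sum>x\<in>{1..s}. of_bool (x = t) - of_bool (x = Suc t))"
      unfolding wt_def coroot_pairing_sum using assms that
      by (intro sum.cong) (auto simp: coroot_pairing_eps simp del: One_nat_def)
    also have "\<dots> = of_bool (t \<in> {1..s}) - of_bool (Suc t \<in> {1..s})"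
      by (simp add: sum_subtractf of_bool_def)
    finally show ?thesis using that by auto
  qed
  show ?thesis
    unfolding fundamental_weight_def
  proof (rule the_equality)
    fix v assume v: "Poly_Mapping.keys v \<subseteq> {1..n} \<and>
       (\<forall>t\<in>{1..n}. coroot_pairing n cartan_A t v = (if t = s then 1 else 0))"
    have "v - wt {1..s} = 0"
    proof (rule cartan_A_nonsingular)
      show "Poly_Mapping.keys (v - wt {1..s}) \<subseteq> {1..n}"
        using v keys keys_diff[of v "wt {1..s}"] by blast
      show "\<forall>t\<in>{1..n}. coroot_pairing n cartan_A t (v - wt {1..s}) = 0"
        using v pair by (simp add: coroot_pairing_minus)
    qed
    then show "v = wt {1..s}" by simp
  qed (use keys pair in auto)
qed

lemma wprod_fix_outside:
  assumes "\<And>t. t \<in> {1..n} \<Longrightarrow> Poly_Mapping.lookup v t = 0"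
  shows "wprod ws v = v"
proof (induction ws)
  case (Cons s ws)
  have "coroot_pairing n cartan_A s v = 0"
    using assms by (simp add: coroot_pairing_def)
  then show ?case using Cons by (simp add: simple_reflection_def)
qed simp

text \<open>Word products act on all finitely supported vectors, not only on the span of the simple
  roots. A vector is split into its part \<open>w\<close> in the span, where the action permutes the
  \<open>eps x\<close>, and a remainder without coordinates in {1..n}, which every word
  fixes.\<close>

lemma wprod_eq_iff:
  assumes "us \<in> W" "vs \<in> W"
  shows "wprod us = wprod vs \<longleftrightarrow> perm us = perm vs"
proof
  assume eq: "wprod us = wprod vs"
  show "perm us = perm vs"
  proof
    fix x
    show "perm us x = perm vs x"
    proof (cases "x \<in> {1..Suc n}")
      case True
      have "eps (perm us x) = eps (perm vs x)"
        using wprod_eps[OF assms(1) True] wprod_eps[OF assms(2) True] eq by simp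
      moreover have "perm us x \<in> {1..Suc n}" "perm vs x \<in> {1..Suc n}"
        using True perm_permutes[OF assms(1)] perm_permutes[OF assms(2)]
        by (metis permutes_in_image)+
      ultimately show ?thesis using inj_on_eps by (metis inj_onD)
    next
      case False
      then show ?thesis
        using perm_permutes[OF assms(1)] perm_permutes[OF assms(2)]
        by (metis permutes_not_in)
    qed
  qed
next
  assume eq: "perm us = perm vs"
  show "wprod us = wprod vs"
  proof
    fix v :: rvec
    define w where "w = (\<Sum>t\<in>{1..n}. Poly_Mapping.lookup v t *\<^sub>R simple_root t)"
    have out: "Poly_Mapping.lookup (v - w) t = 0" if "t \<in> {1..n}" for t
      using that unfolding w_def lookup_minus by (simp add: lookup_sum_simple_root)
    have "wprod us w = wprod vs w"
    proof -
      have "wprod ws w = (\<Sum>t\<in>{1..n}. Poly_Mapping.lookup v t *\<^sub>R (eps (perm ws t) - eps (perm ws (Suc t))))"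
        if "ws \<in> W" for ws
      proof -
        have "wprod ws w = (\<Sum>t\<in>{1..n}. Poly_Mapping.lookup v t *\<^sub>R wprod ws (simple_root t))"
          unfolding w_def by (simp add: linear_sum[OF linear_word_prod] linear_scale[OF linear_word_prod])
        then show ?thesis
          using that
          by (auto simp: simple_root_eps linear_diff[OF linear_word_prod] wprod_eps intro!: sum.cong)
      qed
      then show ?thesis using assms eq by simp
    qed
    moreover have "wprod ws v = wprod ws w + (v - w)" for ws
      using linear_add[OF linear_word_prod, of n cartan_A ws w "v - w"]
        wprod_fix_outside[OF out, of ws] by simp
    ultimately show "wprod us v = wprod vs v" by simp
  qed
qed

end

section \<open>Inversions and length\<close>

lemma perm_snoc: "perm (ws @ [s]) = perm ws \<circ> swp s"
  by (simp add: perm_append)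

context type_A
begin

text \<open>Inversions as pairs of values, so that right multiplication by a letter changes the set by
  exactly one pair.\<close>

definition Inv :: "(nat \<Rightarrow> nat) \<Rightarrow> (nat \<times> nat) set" where
  "Inv \<pi> = {(\<pi> y, \<pi> x) | x y. 1 \<le> x \<and> x < y \<and> y \<le> Suc n \<and> \<pi> y < \<pi> x}"

definition pairs :: "(nat \<times> nat) set" where
  "pairs = {(i, k). 1 \<le> i \<and> i < k \<and> k \<le> Suc n}"

lemma finite_pairs: "finite pairs"
  by (rule finite_subset[of _ "{1..Suc n} \<times> {1..Suc n}"]) (auto simp: pairs_def)

lemma Inv_subset_pairs:
  assumes "\<pi> permutes {1..Suc n}"
  shows "Inv \<pi> \<subseteq> pairs"
proof -
  have "\<pi> x \<in> {1..Suc n}" if "x \<in> {1..Suc n}" for x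
    using permutes_in_image[OF assms] that by blast
  then show ?thesis unfolding Inv_def pairs_def by fastforce
qed

lemma finite_Inv: "\<pi> permutes {1..Suc n} \<Longrightarrow> finite (Inv \<pi>)"
  using Inv_subset_pairs finite_pairs finite_subset by blast

lemma Inv_id: "Inv id = {}"
  by (auto simp: Inv_def)

lemma permutes_range: "\<pi> permutes {1..Suc n} \<Longrightarrow> 1 \<le> x \<Longrightarrow> x \<le> Suc n \<Longrightarrow> 1 \<le> \<pi> x \<and> \<pi> x \<le> Suc n"
  using permutes_in_image[of \<pi> "{1..Suc n}" x] by simp

lemma mem_Inv_iff:
  assumes "\<pi> permutes {1..Suc n}" "x \<in> {1..Suc n}" "y \<in> {1..Suc n}"
  shows "(\<pi> y, \<pi> x) \<in> Inv \<pi> \<longleftrightarrow> x < y \<and> \<pi> y < \<pi> x"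
proof -
  have "x' = x" if "\<pi> x' = \<pi> x" for x x'
    using that permutes_inj[OF assms(1)] by (simp add: inj_eq)
  then have inj: "\<pi> x' = \<pi> x \<longleftrightarrow> x' = x" for x x' by blast
  show ?thesis using assms(2,3) by (auto simp: Inv_def inj)
qed

lemma swp_less_iff:
  assumes "{x, y} \<noteq> {s, Suc s}"
  shows "swp s x < swp s y \<longleftrightarrow> x < y"
proof -
  have "\<not> (x = s \<and> y = Suc s)" "\<not> (x = Suc s \<and> y = s)" using assms by auto
  then show ?thesis
    unfolding Transposition.transpose_def by (cases "x = s"; cases "y = s"; cases "x = Suc s"; cases "y = Suc s") auto
qed

text \<open>Inversions are recorded by values, so composing with \<open>swp s\<close> on the right
  leaves the pairs alone and only moves their positions. The only positions whose relative order
  changes are s and s + 1.\<close>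

lemma Inv_swp_ascent:
  assumes "\<pi> permutes {1..Suc n}" "s \<in> {1..n}" "\<pi> s < \<pi> (Suc s)"
  shows "Inv (\<pi> \<circ> swp s) = insert (\<pi> s, \<pi> (Suc s)) (Inv \<pi>)" "(\<pi> s, \<pi> (Suc s)) \<notin> Inv \<pi>"
proof -
  have p': "\<pi> \<circ> swp s permutes {1..Suc n}"
    using assms by (intro permutes_compose permutes_swap_id) auto
  show "(\<pi> s, \<pi> (Suc s)) \<notin> Inv \<pi>"
    using assms by (subst mem_Inv_iff) auto
  show "Inv (\<pi> \<circ> swp s) = insert (\<pi> s, \<pi> (Suc s)) (Inv \<pi>)" (is "?L = ?R")
  proof (rule set_eqI)
    fix q :: "nat \<times> nat"
    obtain a b where q: "q = (a, b)" by force
    show "q \<in> ?L \<longleftrightarrow> q \<in> ?R"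
    proof (cases "a \<in> {1..Suc n} \<and> b \<in> {1..Suc n}")
      case False
      then have "(a, b) \<notin> ?L" using Inv_subset_pairs[OF p'] by (auto simp: pairs_def)
      moreover have "(a, b) \<notin> Inv \<pi>" using False Inv_subset_pairs[OF assms(1)] by (auto simp: pairs_def)
      moreover have "(a, b) \<noteq> (\<pi> s, \<pi> (Suc s))"
        using False permutes_range[OF assms(1), of s] permutes_range[OF assms(1), of "Suc s"] assms(2) by auto
      ultimately show ?thesis using q by auto
    next
      case True
      obtain x y where xy: "x \<in> {1..Suc n}" "y \<in> {1..Suc n}" "a = \<pi> y" "b = \<pi> x"
        using True permutes_image[OF assms(1)] by (metis imageE)
      have sw: "swp s z \<in> {1..Suc n}" if "z \<in> {1..Suc n}" for z
        using that assms(2) by (auto simp: Transposition.transpose_def)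
      have "(a, b) \<in> ?L \<longleftrightarrow> ((\<pi> \<circ> swp s) (swp s y), (\<pi> \<circ> swp s) (swp s x)) \<in> ?L"
        using xy by simp
      also have "\<dots> \<longleftrightarrow> swp s x < swp s y \<and> \<pi> y < \<pi> x"
        using mem_Inv_iff[OF p' sw[OF xy(1)] sw[OF xy(2)]] by simp
      finally have L: "(a, b) \<in> ?L \<longleftrightarrow> swp s x < swp s y \<and> \<pi> y < \<pi> x" .
      have R: "(a, b) \<in> Inv \<pi> \<longleftrightarrow> x < y \<and> \<pi> y < \<pi> x"
        using mem_Inv_iff[OF assms(1) xy(1,2)] xy by simp
      show ?thesis
      proof (cases "{x, y} = {s, Suc s}")
        case True
        then consider "x = s" "y = Suc s" | "x = Suc s" "y = s" by (auto simp: doubleton_eq_iff)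
        then show ?thesis
        proof cases
          case 1
          then show ?thesis using L R q xy assms(3) by simp
        next
          case 2
          then show ?thesis using L R q xy assms(3) by simp
        qed
      next
        case False
        have "(a, b) \<noteq> (\<pi> s, \<pi> (Suc s)) \<or> {x, y} = {s, Suc s}"
          using xy permutes_inj[OF assms(1)] by (auto simp: inj_eq)
        then show ?thesis using False L R q swp_less_iff[OF False] by auto
      qed
    qed
  qed
qed

lemma card_Inv_ascent:
  assumes "\<pi> permutes {1..Suc n}" "s \<in> {1..n}" "\<pi> s < \<pi> (Suc s)"
  shows "card (Inv (\<pi> \<circ> swp s)) = Suc (card (Inv \<pi>))"
  using Inv_swp_ascent[OF assms] finite_Inv[OF assms(1)] by simp

lemma permutes_swp: "\<pi> permutes {1..Suc n} \<Longrightarrow> s \<in> {1..n} \<Longrightarrow> \<pi> \<circ> swp s permutes {1..Suc n}"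
  by (intro permutes_compose permutes_swap_id) auto

lemma permutes_neq: "\<pi> permutes {1..Suc n} \<Longrightarrow> \<pi> s \<noteq> \<pi> (Suc s)"
  by (metis n_not_Suc_n permutes_inj inj_eq)

lemma card_Inv_descent:
  assumes "\<pi> permutes {1..Suc n}" "s \<in> {1..n}" "\<pi> (Suc s) < \<pi> s"
  shows "Suc (card (Inv (\<pi> \<circ> swp s))) = card (Inv \<pi>)"
proof -
  have "card (Inv ((\<pi> \<circ> swp s) \<circ> swp s)) = Suc (card (Inv (\<pi> \<circ> swp s)))"
    using assms by (intro card_Inv_ascent permutes_swp) auto
  then show ?thesis by (simp add: comp_assoc)
qed

lemma card_Inv_perm_le: "ws \<in> W \<Longrightarrow> card (Inv (perm ws)) \<le> length ws"
proof (induction ws rule: rev_induct)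
  case Nil
  then show ?case by (simp add: Inv_id[unfolded id_def] id_def)
next
  case (snoc s ws)
  then have s: "s \<in> {1..n}" "ws \<in> W" by auto
  have "card (Inv (perm ws \<circ> swp s)) \<le> Suc (card (Inv (perm ws)))"
    using card_Inv_ascent[OF perm_permutes[OF s(2)] s(1)]
      card_Inv_descent[OF perm_permutes[OF s(2)] s(1)] permutes_neq[OF perm_permutes[OF s(2)], of s]
    by (cases "perm ws s < perm ws (Suc s)") auto
  also have "\<dots> \<le> length (ws @ [s])" using snoc.IH s by simp
  finally show ?case unfolding perm_snoc .
qed

text \<open>Such a permutation is strictly increasing. Counting from the left end gives x \<le>
  \<pi> x, counting from the right end gives \<pi> x \<le> x.\<close>

lemma no_descent_id:
  assumes "\<pi> permutes {1..Suc n}" "\<And>s. s \<in> {1..n} \<Longrightarrow> \<pi> s < \<pi> (Suc s)"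
  shows "\<pi> = id"
proof -
  have mono: "y \<le> Suc n \<Longrightarrow> 1 \<le> x \<Longrightarrow> x < y \<Longrightarrow> \<pi> x < \<pi> y" for x y
  proof (induction y)
    case (Suc y)
    show ?case
    proof (cases "x = y")
      case False
      then have "\<pi> x < \<pi> y" using Suc by auto
      also have "\<pi> y < \<pi> (Suc y)" using Suc assms(2)[of y] by auto
      finally show ?thesis .
    qed (use Suc assms(2)[of y] in auto)
  qed simp
  have up: "x \<in> {1..Suc n} \<Longrightarrow> x \<le> \<pi> x" for x
  proof (induction x)
    case (Suc x)
    show ?case
    proof (cases "x = 0")
      case True
      then show ?thesis using permutes_range[OF assms(1), of "Suc x"] Suc.prems by auto
    next
      case False
      then show ?thesis using Suc mono[of "Suc x" x] by auto
    qed
  qed simp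
  have down: "d \<le> n \<Longrightarrow> \<pi> (Suc n - d) \<le> Suc n - d" for d
  proof (induction d)
    case 0
    then show ?case using permutes_range[OF assms(1), of "Suc n"] by auto
  next
    case (Suc d)
    then have "\<pi> (Suc n - Suc d) < \<pi> (Suc n - d)" by (intro mono) auto
    then show ?case using Suc by auto
  qed
  have "\<pi> x = x" for x
  proof (cases "x \<in> {1..Suc n}")
    case True
    then show ?thesis using up[of x] down[of "Suc n - x"] by auto
  next
    case False
    then show ?thesis using assms(1) by (simp add: permutes_not_in)
  qed
  then show ?thesis by auto
qed

text \<open>Bubble sort: a descent can be removed by one letter at the cost of one inversion, until
  the identity is reached.\<close>

lemma minimal_word_exists:
  assumes "ws \<in> W"
  shows "\<exists>us\<in>W. perm us = perm ws \<and> length us = card (Inv (perm ws))"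
  using assms
proof (induction "card (Inv (perm ws))" arbitrary: ws rule: less_induct)
  case less
  note p = perm_permutes[OF less.prems]
  show ?case
  proof (cases "\<exists>s\<in>{1..n}. perm ws (Suc s) < perm ws s")
    case True
    then obtain s where s: "s \<in> {1..n}" "perm ws (Suc s) < perm ws s" by blast
    have W': "ws @ [s] \<in> W" using less.prems s by auto
    have c: "Suc (card (Inv (perm (ws @ [s])))) = card (Inv (perm ws))"
      using card_Inv_descent[OF p s] by (simp add: perm_snoc)
    obtain us where us: "us \<in> W" "perm us = perm (ws @ [s])" "length us = card (Inv (perm (ws @ [s])))"
      using less.hyps[of "ws @ [s]"] c W' by auto
    have "perm (us @ [s]) = perm ws"
      using us(2) by (simp add: perm_snoc comp_assoc)
    then show ?thesis using us c s by (intro bexI[of _ "us @ [s]"]) auto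
  next
    case False
    then have "perm ws = id"
      using p permutes_neq[OF p] by (intro no_descent_id) (auto simp: not_less le_less)
    then show ?thesis by (intro bexI[of _ "[]"]) (auto simp: Inv_id)
  qed
qed

lemma weyl_length_perm:
  assumes "ws \<in> W"
  shows "weyl_length n cartan_A (wprod ws) = card (Inv (perm ws))"
  unfolding weyl_length_def
proof (rule Least_equality)
  show "\<exists>us\<in>W. wprod us = wprod ws \<and> length us = card (Inv (perm ws))"
    using minimal_word_exists[OF assms] wprod_eq_iff[OF _ assms] by blast
  show "card (Inv (perm ws)) \<le> l" if "\<exists>us\<in>W. wprod us = wprod ws \<and> length us = l" for l
    using that card_Inv_perm_le wprod_eq_iff[OF _ assms] by metis
qed

section \<open>The longest element\<close>

definition rev0 :: "nat \<Rightarrow> nat" where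
  "rev0 x = (if x \<in> {1..Suc n} then n + 2 - x else x)"

lemma rev0_permutes: "rev0 permutes {1..Suc n}"
proof (rule bij_imp_permutes)
  show "bij_betw rev0 {1..Suc n} {1..Suc n}"
    by (rule bij_betw_byWitness[of _ rev0]) (auto simp: rev0_def)
qed (auto simp: rev0_def)

lemma rev0_rev0: "rev0 \<circ> rev0 = id"
  by (auto simp: rev0_def fun_eq_iff)

lemma descending_rev0:
  assumes "\<pi> permutes {1..Suc n}" "\<And>s. s \<in> {1..n} \<Longrightarrow> \<pi> (Suc s) < \<pi> s"
  shows "\<pi> = rev0"
proof -
  have "rev0 \<circ> \<pi> = id"
  proof (rule no_descent_id[OF permutes_compose[OF assms(1) rev0_permutes]])
    fix s assume s: "s \<in> {1..n}"
    then show "(rev0 \<circ> \<pi>) s < (rev0 \<circ> \<pi>) (Suc s)"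
      using assms(2)[OF s] permutes_range[OF assms(1), of s] permutes_range[OF assms(1), of "Suc s"]
      by (simp add: rev0_def)
  qed
  then have "rev0 (rev0 (\<pi> x)) = rev0 x" for x by (metis comp_apply id_apply)
  then show ?thesis using rev0_rev0 by (metis comp_apply id_apply ext)
qed

lemma Inv_rev0: "Inv rev0 = pairs"
proof
  show "pairs \<subseteq> Inv rev0"
  proof
    fix q assume "q \<in> pairs"
    then obtain i k where q: "q = (i, k)" "1 \<le> i" "i < k" "k \<le> Suc n" by (auto simp: pairs_def)
    then have "rev0 (n + 2 - i) = i" "rev0 (n + 2 - k) = k" "1 \<le> n + 2 - k" "n + 2 - k < n + 2 - i"
      "n + 2 - i \<le> Suc n"
      by (auto simp: rev0_def)
    then show "q \<in> Inv rev0" using q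
      mem_Inv_iff[OF rev0_permutes, of "n + 2 - k" "n + 2 - i"] by simp
  qed
qed (rule Inv_subset_pairs[OF rev0_permutes])

lemma Inv_all_rev0:
  assumes "\<pi> permutes {1..Suc n}" "Inv \<pi> = pairs"
  shows "\<pi> = rev0"
proof -
  have "\<pi> (Suc s) < \<pi> s" if s: "s \<in> {1..n}" for s
  proof (rule ccontr)
    assume "\<not> \<pi> (Suc s) < \<pi> s"
    then have lt: "\<pi> s < \<pi> (Suc s)" using permutes_neq[OF assms(1), of s] by auto
    have "(\<pi> s, \<pi> (Suc s)) \<in> pairs"
      using lt s permutes_range[OF assms(1), of s] permutes_range[OF assms(1), of "Suc s"]
      by (auto simp: pairs_def)
    then show False using assms mem_Inv_iff[OF assms(1), of "Suc s" s] s by auto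
  qed
  then show ?thesis by (rule descending_rev0[OF assms(1)])
qed

text \<open>A word whose permutation has the largest possible number of inversions cannot have an
  ascent, since appending that letter would add an inversion.\<close>

lemma rev0_word: "\<exists>ws\<in>W. perm ws = rev0"
proof -
  define M where "M = (\<lambda>ws. card (Inv (perm ws)))"
  have bd: "M ws \<le> card pairs" if "ws \<in> W" for ws
    unfolding M_def using Inv_subset_pairs[OF perm_permutes[OF that]] finite_pairs by (rule card_mono[rotated])
  have "\<exists>ws. ws \<in> W \<and> (\<forall>us. us \<in> W \<longrightarrow> M us \<le> M ws)"
    by (rule ex_has_greatest_nat[of _ "[]" _ "Suc (card pairs)"]) (use bd in \<open>auto simp: less_Suc_eq_le\<close>)
  then obtain ws where ws: "ws \<in> W" "\<And>us. us \<in> W \<Longrightarrow> M us \<le> M ws" by blast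
  note p = perm_permutes[OF ws(1)]
  have desc: "perm ws (Suc s) < perm ws s" if s: "s \<in> {1..n}" for s
  proof (rule ccontr)
    assume "\<not> perm ws (Suc s) < perm ws s"
    then have "perm ws s < perm ws (Suc s)" using permutes_neq[OF p, of s] by auto
    then have "M (ws @ [s]) = Suc (M ws)"
      unfolding M_def perm_snoc using card_Inv_ascent[OF p s] by simp
    then show False using ws(2)[of "ws @ [s]"] ws(1) s by auto
  qed
  then have "perm ws = rev0" by (rule descending_rev0[OF p])
  then show ?thesis using ws(1) by blast
qed

definition w0word :: "nat list" where
  "w0word = (SOME ws. ws \<in> W \<and> perm ws = rev0)"

lemma w0word: "w0word \<in> W" "perm w0word = rev0"
  using someI_ex[of "\<lambda>ws. ws \<in> W \<and> perm ws = rev0"] rev0_word unfolding w0word_def by auto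

text \<open>Uniqueness in the definite description: an element of maximal length has every pair as
  an inversion, and this determines the permutation.\<close>

lemma longest_element_w0word: "longest_element n cartan_A = wprod w0word"
  unfolding longest_element_def
proof (rule the_equality)
  have len: "weyl_length n cartan_A (wprod w0word) = card pairs"
    using weyl_length_perm[OF w0word(1)] Inv_rev0 w0word(2) by simp
  have bd: "weyl_length n cartan_A (wprod ws) \<le> card pairs" if "ws \<in> W" for ws
    using weyl_length_perm[OF that] Inv_subset_pairs[OF perm_permutes[OF that]] finite_pairs
    by (simp add: card_mono)
  show "wprod w0word \<in> weyl_group n cartan_A \<and>
    (\<forall>u\<in>weyl_group n cartan_A. weyl_length n cartan_A u \<le> weyl_length n cartan_A (wprod w0word))"
    using len bd w0word(1) by (auto simp: weyl_group_def)
  fix w assume w: "w \<in> weyl_group n cartan_A \<and>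
     (\<forall>u\<in>weyl_group n cartan_A. weyl_length n cartan_A u \<le> weyl_length n cartan_A w)"
  then obtain ws where ws: "ws \<in> W" "w = wprod ws" by (auto simp: weyl_group_def)
  have "card pairs \<le> weyl_length n cartan_A w"
    using w len w0word(1) by (metis weyl_group_def image_eqI)
  then have "card pairs \<le> card (Inv (perm ws))" using weyl_length_perm ws by simp
  then have "Inv (perm ws) = pairs"
    using Inv_subset_pairs[OF perm_permutes[OF ws(1)]] finite_pairs by (meson card_seteq)
  then have "perm ws = rev0" by (rule Inv_all_rev0[OF perm_permutes[OF ws(1)]])
  then show "w = wprod w0word" using ws w0word wprod_eq_iff by metis
qed

lemma reduced_word_w0_iff:
  "reduced_word n cartan_A ws (longest_element n cartan_A) \<longleftrightarrow>
     ws \<in> W \<and> perm ws = rev0 \<and> length ws = card pairs"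
  unfolding reduced_word_def longest_element_w0word
  using weyl_length_perm[OF w0word(1)] w0word Inv_rev0 wprod_eq_iff[OF _ w0word(1)] by auto

section \<open>Roots as differences of the vectors \<open>eps x\<close>\<close>

lemma roots_eps: "roots n cartan_A = {eps i - eps k | i k. i \<in> {1..Suc n} \<and> k \<in> {1..Suc n} \<and> i \<noteq> k}"
proof (intro equalityI subsetI)
  fix v assume "v \<in> roots n cartan_A"
  then obtain ws s where ws: "ws \<in> W" "s \<in> {1..n}" "v = wprod ws (simple_root s)"
    by (auto simp: roots_def weyl_group_def)
  have "v = eps (perm ws s) - eps (perm ws (Suc s))"
    using ws by (simp add: simple_root_eps linear_diff[OF linear_word_prod] wprod_eps)
  then show "v \<in> {eps i - eps k | i k. i \<in> {1..Suc n} \<and> k \<in> {1..Suc n} \<and> i \<noteq> k}"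
    using ws permutes_neq[OF perm_permutes[OF ws(1)], of s]
      perm_in_range[OF ws(1), of s] perm_in_range[OF ws(1), of "Suc s"] by auto
next
  fix v assume "v \<in> {eps i - eps k | i k. i \<in> {1..Suc n} \<and> k \<in> {1..Suc n} \<and> i \<noteq> k}"
  then obtain i k where ik: "v = eps i - eps k" "i \<in> {1..Suc n}" "k \<in> {1..Suc n}" "i \<noteq> k" by blast
  have "\<exists>ws\<in>W. \<exists>s\<in>{1..n}. perm ws s = i \<and> perm ws (Suc s) = k"
    if "i \<in> {1..Suc n}" "k \<in> {1..Suc n}" "i \<noteq> k" for i k
    using that
  \<comment> \<open>Subtraction is truncated, so the sum of both differences is the distance between
    i and k.\<close>
  proof (induction "(k - i) + (i - k)" arbitrary: i k rule: less_induct)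
    case less
    consider "k = Suc i" | "i = Suc k" | "Suc i < k" | "Suc k < i" using less.prems by linarith
    then show ?case
    proof cases
      case 1
      then show ?thesis using less.prems by (intro bexI[of _ "[]"] bexI[of _ i]) auto
    next
      case 2
      then show ?thesis using less.prems by (intro bexI[of _ "[k]"] bexI[of _ k]) auto
    next
      case 3
      then obtain ws s where ws: "ws \<in> W" "s \<in> {1..n}" "perm ws s = i" "perm ws (Suc s) = k - 1"
        using less.hyps[of "k - 1" i] less.prems by fastforce
      then show ?thesis using 3 less.prems
        by (intro bexI[of _ "(k - 1) # ws"] bexI[of _ s]) (auto simp: Transposition.transpose_def)
    next
      case 4
      then obtain ws s where ws: "ws \<in> W" "s \<in> {1..n}" "perm ws s = i - 1" "perm ws (Suc s) = k"
        using less.hyps[of k "i - 1"] less.prems by fastforce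
      then show ?thesis using 4 less.prems
        by (intro bexI[of _ "(i - 1) # ws"] bexI[of _ s]) (auto simp: Transposition.transpose_def)
    qed
  qed
  then obtain ws s where ws: "ws \<in> W" "s \<in> {1..n}" "perm ws s = i" "perm ws (Suc s) = k"
    using ik by blast
  then have "v = wprod ws (simple_root s)"
    using ik by (simp add: simple_root_eps linear_diff[OF linear_word_prod] wprod_eps)
  then show "v \<in> roots n cartan_A" using ws by (auto simp: roots_def weyl_group_def)
qed

lemma positive_roots_eps: "positive_roots n cartan_A = (\<lambda>(i, k). eps i - eps k) ` pairs"
proof (intro equalityI subsetI)
  fix v assume v: "v \<in> positive_roots n cartan_A"
  then obtain i k where ik: "v = eps i - eps k" "i \<in> {1..Suc n}" "k \<in> {1..Suc n}" "i \<noteq> k"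
    unfolding positive_roots_def roots_eps by blast
  have "i < k"
  proof (rule ccontr)
    assume "\<not> i < k"
    then have ki: "k < i" using ik by simp
    then have "Poly_Mapping.lookup v k = -1" using ik by (simp add: lookup_minus lookup_eps)
    then show False using v by (auto simp: positive_roots_def dest!: spec[of _ k])
  qed
  then show "v \<in> (\<lambda>(i, k). eps i - eps k) ` pairs" using ik by (force simp: pairs_def)
next
  fix v assume "v \<in> (\<lambda>(i, k). eps i - eps k) ` pairs"
  then obtain i k where ik: "v = eps i - eps k" "1 \<le> i" "i < k" "k \<le> Suc n"
    by (auto simp: pairs_def)
  have "v \<in> roots n cartan_A"
    unfolding roots_eps using ik by (intro CollectI exI[of _ i] exI[of _ k]) auto
  moreover have "0 \<le> Poly_Mapping.lookup v t" for t
    using ik by (auto simp: lookup_minus lookup_eps)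
  ultimately show "v \<in> positive_roots n cartan_A" by (auto simp: positive_roots_def)
qed

lemma inj_on_pairs: "inj_on (\<lambda>(i, k). eps i - eps k) pairs"
proof (rule inj_onI, clarify)
  fix i k i' k' assume ik: "(i, k) \<in> pairs" "(i', k') \<in> pairs" "eps i - eps k = eps i' - eps k'"
  have eq: "i \<le> t \<and> t < k \<longleftrightarrow> i' \<le> t \<and> t < k'" if "t \<in> {1..n}" for t
  proof -
    have "Poly_Mapping.lookup (eps i - eps k) t = Poly_Mapping.lookup (eps i' - eps k') t"
      using ik by simp
    then have "of_bool (i \<le> t) - of_bool (k \<le> t) = (of_bool (i' \<le> t) - of_bool (k' \<le> t) :: real)"
      using that by (simp add: lookup_minus lookup_eps)
    then show ?thesis using ik(1,2)
      by (cases "i \<le> t"; cases "k \<le> t"; cases "i' \<le> t"; cases "k' \<le> t") (auto simp: pairs_def)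
  qed
  have r: "1 \<le> i" "i < k" "k \<le> Suc n" "1 \<le> i'" "i' < k'" "k' \<le> Suc n"
    using ik by (auto simp: pairs_def)
  have "i' \<le> i \<and> i < k'" using eq[of i] r by auto
  moreover have "i \<le> i' \<and> i' < k" using eq[of i'] r by auto
  moreover have "i \<le> k - 1" "k - 1 < k" "k - 1 \<in> {1..n}" "i' \<le> k' - 1" "k' - 1 < k'" "k' - 1 \<in> {1..n}"
    using r by auto
  then have "k - 1 < k'" "k' - 1 < k" using eq[of "k - 1"] eq[of "k' - 1"] by blast+
  ultimately show "i = i' \<and> k = k'" using r by linarith
qed

lemma card_positive_roots: "card (positive_roots n cartan_A) = card pairs"
  unfolding positive_roots_eps by (rule card_image[OF inj_on_pairs])

end

section \<open>The 0-Hecke action and greedy subwords\<close>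

text \<open>The action of a 0-Hecke generator on subsets: the transposition is applied only when it
  moves an element up.\<close>

definition push :: "nat \<Rightarrow> nat set \<Rightarrow> nat set" where
  "push s X = (if s \<in> X \<and> Suc s \<notin> X then insert (Suc s) (X - {s}) else X)"

text \<open>Multiplication by a generator in the Demazure product, from the right here and from the
  left in \<open>lmult\<close>: it takes place only when the length grows. A left ascent is an
  ascent of the inverse permutation.\<close>

definition rmult :: "nat \<Rightarrow> (nat \<Rightarrow> nat) \<Rightarrow> nat \<Rightarrow> nat" where
  "rmult s \<pi> = (if \<pi> s < \<pi> (Suc s) then \<pi> \<circ> swp s else \<pi>)"

definition lmult :: "nat \<Rightarrow> (nat \<Rightarrow> nat) \<Rightarrow> nat \<Rightarrow> nat" where
  "lmult s \<pi> = (if inv \<pi> s < inv \<pi> (Suc s) then swp s \<circ> \<pi> else \<pi>)"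

definition demazure :: "nat list \<Rightarrow> nat \<Rightarrow> nat" where
  "demazure ws = fold rmult ws id"

lemma demazure_Nil [simp]: "demazure [] = id"
  by (simp add: demazure_def)

lemma demazure_snoc [simp]: "demazure (ws @ [s]) = rmult s (demazure ws)"
  by (simp add: demazure_def)

lemma lmult_at:
  assumes "inj \<pi>" "\<pi> x = s" "\<pi> y = Suc s"
  shows "lmult s \<pi> = (if x < y then swp s \<circ> \<pi> else \<pi>)"
proof -
  have "inv \<pi> s = x" "inv \<pi> (Suc s) = y" using assms by (auto simp: inv_f_eq)
  then show ?thesis by (simp add: lmult_def)
qed

text \<open>This is associativity of the Demazure product. The two sides interfere only if both
  generators exchange the same pair of values; then either both multiplications give the same
  permutation and the second one has no effect, or neither acts.\<close>

lemma lmult_rmult: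
  assumes "bij \<pi>"
  shows "lmult s (rmult t \<pi>) = rmult t (lmult s \<pi>)"
proof -
  obtain x y where xy: "\<pi> x = s" "\<pi> y = Suc s"
    using assms by (metis bij_pointE)
  have inj: "inj \<pi>" using assms by (rule bij_is_inj)
  then have ne: "x \<noteq> y" using xy by auto
  have inj': "inj (\<pi> \<circ> swp t)" using inj by (simp add: inj_compose)
  have l0: "lmult s \<pi> = (if x < y then swp s \<circ> \<pi> else \<pi>)"
    using lmult_at[OF inj xy] .
  have l1: "lmult s (\<pi> \<circ> swp t) = (if swp t x < swp t y then swp s \<circ> (\<pi> \<circ> swp t) else \<pi> \<circ> swp t)"
    using xy by (intro lmult_at[OF inj']) auto
  show ?thesis
  proof (cases "{x, y} = {t, Suc t}")
    case False
    then have e1: "swp t x < swp t y \<longleftrightarrow> x < y" by (rule type_A.swp_less_iff)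
    have "{\<pi> t, \<pi> (Suc t)} \<noteq> {s, Suc s}"
    proof
      assume "{\<pi> t, \<pi> (Suc t)} = {s, Suc s}"
      then have "\<pi> ` {t, Suc t} = \<pi> ` {x, y}" using xy by simp
      then show False using False inj by (metis inj_image_eq_iff)
    qed
    then have e2: "swp s (\<pi> t) < swp s (\<pi> (Suc t)) \<longleftrightarrow> \<pi> t < \<pi> (Suc t)"
      by (rule type_A.swp_less_iff)
    show ?thesis
      by (cases "x < y"; cases "\<pi> t < \<pi> (Suc t)") (auto simp: rmult_def l0 l1 e1 e2 comp_assoc)
  next
    case True
    then consider "x = t" "y = Suc t" | "x = Suc t" "y = t" by (auto simp: doubleton_eq_iff)
    then show ?thesis
    proof cases
      case 1
      have "swp s \<circ> \<pi> = \<pi> \<circ> swp t"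
      proof
        fix z
        have "\<pi> z = s \<longleftrightarrow> z = t" "\<pi> z = Suc s \<longleftrightarrow> z = Suc t"
          using inj xy 1 by (metis inj_eq)+
        then show "(swp s \<circ> \<pi>) z = (\<pi> \<circ> swp t) z"
          using xy 1 by (auto simp: Transposition.transpose_def)
      qed
      then show ?thesis using 1 xy by (auto simp: rmult_def l0 l1)
    next
      case 2
      then show ?thesis using xy by (auto simp: rmult_def l0 l1)
    qed
  qed
qed

lemma bij_rmult: "bij \<pi> \<Longrightarrow> bij (rmult s \<pi>)"
  by (simp add: rmult_def bij_comp)

lemma bij_dem: "bij (demazure ws)"
proof (induction ws rule: rev_induct)
  case Nil
  show ?case unfolding demazure_Nil by (rule bij_id)
qed (simp add: bij_rmult)

lemma lmult_id: "lmult s id = rmult s id"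
  by (simp add: lmult_def rmult_def)

text \<open>The definition multiplies from the right, while images of sets are followed from the
  left. A new first letter is carried through all right multiplications by
  \<open>lmult_rmult\<close>.\<close>

lemma demazure_foldr: "demazure ws = foldr lmult ws id"
proof -
  have L: "lmult s (demazure us) = demazure (s # us)" for s us
  proof (induction us rule: rev_induct)
    case Nil
    have "demazure [s] = rmult s id" by (simp add: demazure_def)
    then show ?case using lmult_id by (simp only: demazure_Nil)
  next
    case (snoc t us)
    have "lmult s (demazure (us @ [t])) = rmult t (lmult s (demazure us))"
      unfolding demazure_snoc by (rule lmult_rmult[OF bij_dem])
    also have "\<dots> = demazure ((s # us) @ [t])" unfolding snoc demazure_snoc ..
    finally show ?case by simp
  qed
  show ?thesis
  proof (induction ws)
    case (Cons s ws)
    have "demazure (s # ws) = lmult s (demazure ws)" by (rule L[symmetric])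
    then show ?case unfolding Cons by (simp only: foldr.simps comp_apply)
  qed simp
qed

text \<open>\<open>U\<close> is a down-set apart from the point \<open>z0\<close>, which the letter
  does not move; the case in use is U = {1..t} with z0 = 0. If the position of s comes first, then s
  + 1 in the image forces s in it, so the transposition can only move the image up, as
  \<open>push\<close> does; in the other order neither side changes.\<close>

lemma push_lmult:
  assumes "bij \<pi>" "\<And>x y. x \<in> U \<Longrightarrow> y < x \<Longrightarrow> y \<noteq> z0 \<Longrightarrow> y \<in> U" "\<pi> z0 = z0" "z0 \<noteq> s" "z0 \<noteq> Suc s"
  shows "lmult s \<pi> ` U = push s (\<pi> ` U)"
proof -
  obtain x y where xy: "\<pi> x = s" "\<pi> y = Suc s" using assms by (metis bij_pointE)
  have inj: "inj \<pi>" using assms(1) by (rule bij_is_inj)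
  then have ne: "x \<noteq> y" "x \<noteq> z0" "y \<noteq> z0" using xy assms by auto
  have m: "s \<in> \<pi> ` U \<longleftrightarrow> x \<in> U" "Suc s \<in> \<pi> ` U \<longleftrightarrow> y \<in> U"
    using xy inj by (metis inj_image_mem_iff)+
  have sw: "swp s ` X = X" if "s \<in> X \<longleftrightarrow> Suc s \<in> X" for X
    using that by (rule transpose_image_eq)
  show ?thesis
  proof (cases "x < y")
    case True
    then have l: "lmult s \<pi> ` U = swp s ` (\<pi> ` U)"
      using lmult_at[OF inj xy] by (simp add: image_comp)
    show ?thesis
    proof (cases "x \<in> U \<and> y \<notin> U")
      case True
      then show ?thesis unfolding l push_def
        using m transpose_image_eq by (auto simp: Transposition.transpose_def split: if_splits)
    next
      case False
      then have "x \<in> U \<longleftrightarrow> y \<in> U" using assms(2)[of y x] \<open>x < y\<close> ne by blast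
      then show ?thesis unfolding l push_def using m sw[of "\<pi> ` U"] by auto
    qed
  next
    case False
    then have "y < x" using ne by simp
    then have "x \<in> U \<Longrightarrow> y \<in> U" using assms(2)[of x y] ne by blast
    then show ?thesis using lmult_at[OF inj xy] False m by (auto simp: push_def)
  qed
qed

text \<open>Images of initial segments can be followed letter by letter even if the word is not
  reduced. That 0 stays fixed is carried along as the exceptional point of
  \<open>push_lmult\<close>.\<close>

lemma demazure_image_push:
  assumes "0 \<notin> set ws"
  shows "demazure ws ` {1..t} = foldr push ws {1..t} \<and> demazure ws 0 = 0"
  using assms
proof (induction ws)
  case Nil
  then show ?case by simp
next
  case (Cons s ws)
  have d: "demazure (s # ws) = lmult s (demazure ws)" by (simp add: demazure_foldr)
  have s: "s \<noteq> 0" using Cons.prems by auto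
  have z: "demazure ws 0 = 0" using Cons by auto
  have "demazure (s # ws) ` {1..t} = push s (demazure ws ` {1..t})"
    unfolding d using z s by (intro push_lmult[OF bij_dem, of _ 0]) auto
  moreover have "demazure (s # ws) 0 = 0"
    unfolding d lmult_def using s z by (simp add: Transposition.transpose_def)
  ultimately show ?case using Cons by simp
qed

section \<open>Lexicographic comparison of sets of positions\<close>

lemma lex_le_first_diff:
  assumes fin: "finite I" "finite J" and card: "card I = card J"
    and p: "p \<in> I" "p \<notin> J" "\<And>x. x < p \<Longrightarrow> x \<in> I \<longleftrightarrow> x \<in> J"
  shows "lex_le I J"
proof -
  have split: "sorted_list_of_set K = sorted_list_of_set {x\<in>K. x < p} @ sorted_list_of_set {x\<in>K. p \<le> x}"
    if "finite K" for K
  proof (rule sorted_distinct_set_unique)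
    show "sorted (sorted_list_of_set {x \<in> K. x < p} @ sorted_list_of_set {x \<in> K. p \<le> x})"
      using that by (auto simp: sorted_append)
    show "set (sorted_list_of_set K) =
      set (sorted_list_of_set {x \<in> K. x < p} @ sorted_list_of_set {x \<in> K. p \<le> x})"
      using that by auto
  qed (use that in auto)
  have low: "{x\<in>I. x < p} = {x\<in>J. x < p}" using p(3) by auto
  have "sorted_list_of_set {x\<in>I. p \<le> x} = p # sorted_list_of_set ({x\<in>I. p \<le> x} - {p})"
  proof -
    have "Min {x\<in>I. p \<le> x} = p" using fin p(1) by (intro Min_eqI) auto
    moreover have "finite {x\<in>I. p \<le> x}" "{x\<in>I. p \<le> x} \<noteq> {}" using fin p(1) by auto
    ultimately show ?thesis using sorted_list_of_set_nonempty[of "{x\<in>I. p \<le> x}"] by simp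
  qed
  \<comment> \<open>In \<open>lexord\<close> a proper prefix precedes its extensions, so J must
    still have an element from p on; the equal cardinalities provide one.\<close>
  moreover have "card {x\<in>J. p \<le> x} \<noteq> 0"
  proof -
    have cK: "card K = card {x\<in>K. x < p} + card {x\<in>K. p \<le> x}" if "finite K" for K
      using arg_cong[OF split[OF that], of length] by simp
    then have "card {x\<in>J. p \<le> x} = card {x\<in>I. p \<le> x}"
      using cK[OF fin(1)] cK[OF fin(2)] card unfolding low by linarith
    moreover have "card {x\<in>I. p \<le> x} \<noteq> 0" using fin p(1) by auto
    ultimately show ?thesis by simp
  qed
  then obtain q ys where q: "sorted_list_of_set {x\<in>J. p \<le> x} = q # ys"
    by (cases "sorted_list_of_set {x\<in>J. p \<le> x}") (auto simp: fin)
  then have "q \<in> set (sorted_list_of_set {x\<in>J. p \<le> x})" by simp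
  then have "q \<in> J" "p \<le> q" using fin by auto
  then have "p < q" using p(2) by (cases "p = q") auto
  moreover have "sorted_list_of_set {x\<in>J. p \<le> x} = q # ys" by (rule q)
  ultimately have "(sorted_list_of_set I, sorted_list_of_set J) \<in> lexord less_than"
    unfolding split[OF fin(1)] split[OF fin(2)] low by (intro lexord_append_leftI) simp
  then show ?thesis by (simp add: lex_le_def)
qed

lemma lex_le_antisym: "lex_le I J \<Longrightarrow> lex_le J I \<Longrightarrow> I = J"
  unfolding lex_le_def
  using lexord_asymmetric[of less_than "sorted_list_of_set I" "sorted_list_of_set J"]
    wf_imp_asym[OF wf_less_than] by auto

lemma lex_first_eqI: "I \<in> \<I> \<Longrightarrow> (\<And>J. J \<in> \<I> \<Longrightarrow> lex_le I J) \<Longrightarrow> lex_first \<I> = I"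
  unfolding lex_first_def by (rule the_equality) (simp, metis lex_le_antisym)

lemma lex_last_eqI: "I \<in> \<I> \<Longrightarrow> (\<And>J. J \<in> \<I> \<Longrightarrow> lex_le J I) \<Longrightarrow> lex_last \<I> = I"
  unfolding lex_last_def by (rule the_equality) (simp, metis lex_le_antisym)

lemma sorted_list_of_set_filter:
  assumes "J \<subseteq> {..<b}"
  shows "sorted_list_of_set J = filter (\<lambda>x. x \<in> J) [0..<b]"
proof (rule sorted_distinct_set_unique)
  show "sorted (filter (\<lambda>x. x \<in> J) [0..<b])" by (simp add: sorted_wrt_filter)
  show "set (sorted_list_of_set J) = set (filter (\<lambda>x. x \<in> J) [0..<b])"
    using assms finite_subset[OF assms] by auto
qed auto

section \<open>Greedy reduced subwords\<close>

definition sub :: "(nat \<Rightarrow> nat) \<Rightarrow> nat set \<Rightarrow> nat \<Rightarrow> nat list" where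
  "sub f J b = map f (filter (\<lambda>x. x \<in> J) [0..<b])"

lemma sub_0 [simp]: "sub f J 0 = []"
  by (simp add: sub_def)

lemma sub_Suc: "sub f J (Suc b) = sub f J b @ (if b \<in> J then [f b] else [])"
  by (simp add: sub_def)

lemma sub_cong: "(\<And>x. x < b \<Longrightarrow> x \<in> I \<longleftrightarrow> x \<in> J) \<Longrightarrow> sub f I b = sub f J b"
  unfolding sub_def by (intro arg_cong[of _ _ "map f"] filter_cong) auto

lemma sub_prefix: "b \<le> b' \<Longrightarrow> \<exists>us. sub f J b' = sub f J b @ us"
proof (induction b' rule: dec_induct)
  case (step m)
  then show ?case by (auto simp: sub_Suc)
qed simp

lemma length_sub: "J \<subseteq> {..<b} \<Longrightarrow> length (sub f J b) = card J"
  unfolding sub_def by (metis length_map length_sorted_list_of_set sorted_list_of_set_filter)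

text \<open>A position is taken when the Demazure product of the full prefix before it still grows;
  the prefix includes the letters that were skipped.\<close>

definition greedy :: "(nat \<Rightarrow> nat) \<Rightarrow> nat set \<Rightarrow> nat set" where
  "greedy f P = {p\<in>P. demazure (sub f P p) (f p) < demazure (sub f P p) (Suc (f p))}"

context type_A
begin

definition red :: "nat list \<Rightarrow> bool" where
  "red ws \<longleftrightarrow> ws \<in> W \<and> length ws = card (Inv (perm ws))"

text \<open>Minimality among all words of the same permutation passes at once to prefixes, suffixes
  and reversals: a shorter replacement of a factor would shorten the whole word.\<close>

lemma red_minimal: "red ws \<longleftrightarrow> ws \<in> W \<and> (\<forall>us\<in>W. perm us = perm ws \<longrightarrow> length ws \<le> length us)"
proof -
  have "length ws = card (Inv (perm ws))" if "ws \<in> W" "\<forall>us\<in>W. perm us = perm ws \<longrightarrow> length ws \<le> length us"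
    using minimal_word_exists[OF that(1)] card_Inv_perm_le[OF that(1)] that(2) by force
  moreover have "length ws \<le> length us" if "length ws = card (Inv (perm ws))" "us \<in> W" "perm us = perm ws" for us
    using card_Inv_perm_le[OF that(2)] that by simp
  ultimately show ?thesis unfolding red_def by blast
qed

lemma red_appendD1: "red (us @ vs) \<Longrightarrow> red us"
  unfolding red_minimal
proof (intro conjI ballI impI)
  assume r: "us @ vs \<in> W \<and> (\<forall>xs\<in>W. perm xs = perm (us @ vs) \<longrightarrow> length (us @ vs) \<le> length xs)"
  then show "us \<in> W" by simp
  fix xs assume "xs \<in> W" "perm xs = perm us"
  then have "xs @ vs \<in> W" "perm (xs @ vs) = perm (us @ vs)" using r by (auto simp: perm_append)
  then have "length (us @ vs) \<le> length (xs @ vs)" using r by blast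
  then show "length us \<le> length xs" by simp
qed

lemma red_appendD2: "red (us @ vs) \<Longrightarrow> red vs"
  unfolding red_minimal
proof (intro conjI ballI impI)
  assume r: "us @ vs \<in> W \<and> (\<forall>xs\<in>W. perm xs = perm (us @ vs) \<longrightarrow> length (us @ vs) \<le> length xs)"
  then show "vs \<in> W" by simp
  fix xs assume "xs \<in> W" "perm xs = perm vs"
  then have "us @ xs \<in> W" "perm (us @ xs) = perm (us @ vs)" using r by (auto simp: perm_append)
  then have "length (us @ vs) \<le> length (us @ xs)" using r by blast
  then show "length vs \<le> length xs" by simp
qed

lemma perm_rev_cong: 
  assumes "perm us = perm vs" shows "perm (rev us) = perm (rev vs)"
proof -
  have "perm (rev us) = perm (rev us) \<circ> (perm vs \<circ> perm (rev vs))" by (simp only: perm_rev' o_id)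
  also have "\<dots> = (perm (rev us) \<circ> perm us) \<circ> perm (rev vs)" by (simp only: assms comp_assoc)
  also have "\<dots> = perm (rev vs)" by (simp only: perm_rev id_o)
  finally show ?thesis .
qed

lemma red_rev: "red ws \<Longrightarrow> red (rev ws)"
  unfolding red_minimal
proof (intro conjI ballI impI)
  assume r: "ws \<in> W \<and> (\<forall>xs\<in>W. perm xs = perm ws \<longrightarrow> length ws \<le> length xs)"
  then show "rev ws \<in> W" by auto
  fix xs assume "xs \<in> W" "perm xs = perm (rev ws)"
  then have "perm (rev xs) = perm ws" "rev xs \<in> W" using perm_rev_cong[of xs "rev ws"] by auto
  then have "length ws \<le> length (rev xs)" using r by blast
  then show "length (rev ws) \<le> length xs" by simp
qed

lemma red_snoc_ascent:
  assumes "red (ws @ [s])"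
  shows "perm ws s < perm ws (Suc s)"
proof (rule ccontr)
  have ws: "ws \<in> W" "s \<in> {1..n}" using assms by (auto simp: red_def)
  assume "\<not> perm ws s < perm ws (Suc s)"
  then have "perm ws (Suc s) < perm ws s"
    using permutes_neq[OF perm_permutes[OF ws(1)], of s] by auto
  then have "Suc (card (Inv (perm (ws @ [s])))) = card (Inv (perm ws))"
    unfolding perm_snoc by (rule card_Inv_descent[OF perm_permutes[OF ws(1)] ws(2)])
  then show False using assms card_Inv_perm_le[OF ws(1)] by (simp add: red_def)
qed

lemma demazure_red: "red ws \<Longrightarrow> demazure ws = perm ws"
proof (induction ws rule: rev_induct)
  case (snoc s ws)
  then show ?case
    using red_snoc_ascent[OF snoc.prems] red_appendD1[OF snoc.prems]
    by (simp add: rmult_def perm_snoc del: perm_simps)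
qed simp

lemma red_perm_push: "red ws \<Longrightarrow> perm ws ` {1..t} = foldr push ws {1..t}"
proof -
  assume r: "red ws"
  have "0 \<notin> set ws" using r by (auto simp: red_def)
  then show ?thesis using demazure_red[OF r] demazure_image_push[of ws t] by simp
qed

lemma demazure_permutes: "ws \<in> W \<Longrightarrow> demazure ws permutes {1..Suc n}"
proof (induction ws rule: rev_induct)
  case Nil
  then show ?case using permutes_id by (simp add: id_def)
next
  case (snoc s ws)
  then have "demazure ws permutes {1..Suc n}" "s \<in> {1..n}" by auto
  then show ?case using permutes_swp by (simp add: rmult_def)
qed

lemma sub_in_W: "(\<And>p. p \<in> P \<Longrightarrow> f p \<in> {1..n}) \<Longrightarrow> sub f P b \<in> W"
  by (auto simp: sub_def)

lemma greedy_subset: "greedy f P \<subseteq> P"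
  by (auto simp: greedy_def)

text \<open>A skipped letter changes neither side, and a letter that is taken raises the length by
  one. The statement holds for every prefix, so all partial products of the greedy subword are known
  Demazure products.\<close>

lemma greedy_red:
  assumes "\<And>p. p \<in> P \<Longrightarrow> f p \<in> {1..n}"
  shows "perm (sub f (greedy f P) p) = demazure (sub f P p) \<and> red (sub f (greedy f P) p)"
proof (induction p)
  case 0
  then show ?case by (simp add: red_def Inv_id)
next
  case (Suc p)
  have W': "sub f (greedy f P) p \<in> W" using assms greedy_subset[of f P] by (intro sub_in_W) auto
  show ?case
  proof (cases "p \<in> greedy f P")
    case True
    then have p: "p \<in> P" "demazure (sub f P p) (f p) < demazure (sub f P p) (Suc (f p))" by (auto simp: greedy_def)
    have "card (Inv (perm (sub f (greedy f P) p) \<circ> swp (f p))) = Suc (card (Inv (perm (sub f (greedy f P) p))))"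
      using Suc p assms[OF p(1)] by (intro card_Inv_ascent perm_permutes[OF W']) auto
    then have "red (sub f (greedy f P) (Suc p))"
      using Suc True W' assms[OF p(1)] by (simp add: red_def sub_Suc perm_snoc)
    moreover have "perm (sub f (greedy f P) (Suc p)) = demazure (sub f P (Suc p))"
      using Suc True p by (simp add: sub_Suc perm_snoc rmult_def)
    ultimately show ?thesis by blast
  next
    case False
    then show ?thesis using Suc by (auto simp: sub_Suc rmult_def greedy_def)
  qed
qed

text \<open>At the first position where \<open>J\<close> and the greedy set differ, \<open>J\<close>
  cannot be the one that contains it: both have the same product so far, reducedness of
  \<open>J\<close> makes the letter an ascent, and the greedy set would have taken it as
  well.\<close>

lemma greedy_lex_first:
  assumes f: "\<And>p. p \<in> P \<Longrightarrow> f p \<in> {1..n}"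
    and J: "J \<subseteq> P" "J \<subseteq> {..<b}" "red (sub f J b)"
    and greedy: "finite (greedy f P)" "card (greedy f P) = card J"
    and ne: "J \<noteq> greedy f P"
  obtains p where "p \<in> greedy f P" "p \<notin> J" "\<And>x. x < p \<Longrightarrow> x \<in> greedy f P \<longleftrightarrow> x \<in> J"
proof -
  define p where "p = (LEAST p. (p \<in> J) \<noteq> (p \<in> greedy f P))"
  have ex: "\<exists>p. (p \<in> J) \<noteq> (p \<in> greedy f P)" using ne by blast
  have p: "(p \<in> J) \<noteq> (p \<in> greedy f P)" unfolding p_def by (rule LeastI_ex[OF ex])
  have low: "x \<in> J \<longleftrightarrow> x \<in> greedy f P" if "x < p" for x
    using not_less_Least that unfolding p_def by blast
  have "p \<notin> J"
  proof
    assume pJ: "p \<in> J"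
    then have "Suc p \<le> b" using J(2) by auto
    then have "red (sub f J p @ [f p])"
      using sub_prefix[of "Suc p" b f J] J(3) red_appendD1 pJ by (auto simp: sub_Suc)
    then have "perm (sub f J p) (f p) < perm (sub f J p) (Suc (f p))" by (rule red_snoc_ascent)
    moreover have "perm (sub f J p) = demazure (sub f P p)"
      using greedy_red[of P f p] f low sub_cong[of p J "greedy f P" f] by auto
    ultimately show False using p pJ J(1) by (auto simp: greedy_def)
  qed
  then show ?thesis using that p low by blast
qed

end

section \<open>Coxeter words\<close>

locale coxeter_word = type_A +
  fixes cs :: "nat list"
  assumes n_pos: "1 \<le> n" and distinct_cs: "distinct cs" and set_cs: "set cs = {1..n}"
begin

lemma length_cs: "length cs = n"
  using distinct_card[OF distinct_cs] set_cs by simp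

lemma cs_W: "cs \<in> W"
  using set_cs by auto

definition before :: "nat \<Rightarrow> nat \<Rightarrow> bool" where
  "before s t \<longleftrightarrow> (\<exists>i j. i < j \<and> j < length cs \<and> cs ! i = s \<and> cs ! j = t)"

text \<open>Neither 0 nor n + 1 is a letter, so \<open>lower 1\<close> and
  \<open>lower (Suc n)\<close> are false.\<close>

definition lower :: "nat \<Rightarrow> bool" where
  "lower p \<longleftrightarrow> before (p - 1) p"

lemma before_suffix:
  assumes "cs = us @ s # ws" "t \<in> {1..n}" "t \<noteq> s"
  shows "before s t \<longleftrightarrow> t \<in> set ws"
proof
  assume "t \<in> set ws"
  then obtain j where j: "j < length ws" "ws ! j = t" by (auto simp: in_set_conv_nth)
  show "before s t" unfolding before_def
    by (rule exI[of _ "length us"], rule exI[of _ "Suc (length us + j)"]) (use assms(1) j in \<open>auto simp: nth_append\<close>)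
next
  assume "before s t"
  then obtain i j where ij: "i < j" "j < length cs" "cs ! i = s" "cs ! j = t" by (auto simp: before_def)
  have "cs ! length us = s" using assms(1) by simp
  then have "i = length us"
    using ij assms(1) distinct_cs nth_eq_iff_index_eq[OF distinct_cs, of i "length us"] by simp
  then have "cs ! j = ws ! (j - Suc (length us))" "j - Suc (length us) < length ws"
    using assms(1) ij by (auto simp: nth_append nth_Cons')
  then show "t \<in> set ws" using ij by (metis nth_mem)
qed

lemma before_total:
  assumes "s \<in> {1..n}" "t \<in> {1..n}" "s \<noteq> t"
  shows "before s t \<longleftrightarrow> \<not> before t s"
proof -
  obtain i j where ij: "i < length cs" "cs ! i = s" "j < length cs" "cs ! j = t"
    using assms set_cs by (metis in_set_conv_nth)
  have u: "i' = i" if "i' < length cs" "cs ! i' = s" for i'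
    using that ij distinct_cs nth_eq_iff_index_eq by metis
  have v: "j' = j" if "j' < length cs" "cs ! j' = t" for j'
    using that ij distinct_cs nth_eq_iff_index_eq by metis
  have "i \<noteq> j" using ij assms by auto
  have 1: "before s t \<longleftrightarrow> i < j"
    unfolding before_def using ij u v by (metis order.strict_trans)
  have 2: "before t s \<longleftrightarrow> j < i"
    unfolding before_def using ij u v by (metis order.strict_trans)
  show ?thesis using 1 2 \<open>i \<noteq> j\<close> by auto
qed

lemma before_down: "2 \<le> p \<Longrightarrow> p \<le> n \<Longrightarrow> before p (p - 1) \<longleftrightarrow> \<not> lower p"
proof -
  assume "2 \<le> p" "p \<le> n"
  then have "p \<in> {1..n}" "p - 1 \<in> {1..n}" "p \<noteq> p - 1" by auto
  then show ?thesis using before_total[of p "p - 1"] unfolding lower_def by blast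
qed

lemma before_up: "1 \<le> p \<Longrightarrow> p < n \<Longrightarrow> before p (Suc p) \<longleftrightarrow> lower (Suc p)"
  by (simp add: lower_def)

text \<open>When the letters of \<open>K\<close> act in the order prescribed by the Coxeter word, the two conditions
  say that exactly those in \<open>D\<close> have an effect: a letter acting after a neighbour sees the
  change made by it.\<close>

lemma foldr_push_effective:
  assumes D: "D \<subseteq> K" "D \<subseteq> {1..n}"
    and eff: "\<And>t. t \<in> D \<Longrightarrow> (t \<in> U \<longleftrightarrow> \<not> (t - 1 \<in> D \<and> before t (t - 1))) \<and>
                (Suc t \<in> U \<longleftrightarrow> Suc t \<in> D \<and> before t (Suc t))"
    and ineff: "\<And>t. t \<in> K \<Longrightarrow> t \<in> {1..n} \<Longrightarrow> t \<notin> D \<Longrightarrow>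
                \<not> ((t \<in> U \<or> t - 1 \<in> D \<and> before t (t - 1)) \<and>
                   (Suc t \<notin> U \<or> Suc t \<in> D \<and> before t (Suc t)))"
  shows "of_bool (x \<in> foldr push (filter (\<lambda>s. s \<in> K) cs) U) =
     (of_bool (x \<in> U) - of_bool (x \<in> D) + of_bool (x - 1 \<in> D) :: int)"
proof -
  \<comment> \<open>\<open>foldr\<close> lets the last letter act first, so a suffix
    \<open>ws\<close> consists of letters that have already acted. The formula records the effect of
    those among them that lie in \<open>D\<close>.\<close>
  have "\<forall>x. of_bool (x \<in> foldr push (filter (\<lambda>s. s \<in> K) ws) U) =
     (of_bool (x \<in> U) - of_bool (x \<in> D \<and> x \<in> set ws) + of_bool (x - 1 \<in> D \<and> x - 1 \<in> set ws) :: int)"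
    if "cs = us @ ws" for us ws
    using that
  proof (induction ws arbitrary: us)
    case Nil
    then show ?case by simp
  next
    case (Cons s ws)
    define V where "V = foldr push (filter (\<lambda>s. s \<in> K) ws) U"
    have V: "of_bool (x \<in> V) =
     (of_bool (x \<in> U) - of_bool (x \<in> D \<and> x \<in> set ws) + of_bool (x - 1 \<in> D \<and> x - 1 \<in> set ws) :: int)" for x
      using Cons.IH[of "us @ [s]"] Cons.prems by (simp add: V_def)
    have s: "s \<in> {1..n}" "s \<notin> set ws" using Cons.prems set_cs distinct_cs by auto
    have D0: "0 \<notin> D" using D by auto
    \<comment> \<open>The neighbours of s lying in the suffix are those that come after s in the
      Coxeter word and have acted already.\<close>
    have b1: "s - 1 \<in> D \<and> s - 1 \<in> set ws \<longleftrightarrow> s - 1 \<in> D \<and> before s (s - 1)"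
      using before_suffix[OF Cons.prems, of "s - 1"] D s by auto
    have b2: "Suc s \<in> D \<and> Suc s \<in> set ws \<longleftrightarrow> Suc s \<in> D \<and> before s (Suc s)"
      using before_suffix[OF Cons.prems, of "Suc s"] D by auto
    have Vs: "of_bool (s \<in> V) = (of_bool (s \<in> U) + of_bool (s - 1 \<in> D \<and> before s (s - 1)) :: int)"
      using V[of s] s b1 by simp
    have VS: "of_bool (Suc s \<in> V) = (of_bool (Suc s \<in> U) - of_bool (Suc s \<in> D \<and> before s (Suc s)) :: int)"
      using V[of "Suc s"] s b2 by simp
    show ?case
    proof (cases "s \<in> K")
      case False
      then have "s \<notin> D" using D by auto
      then have "(x \<in> D \<and> x \<in> set (s # ws)) = (x \<in> D \<and> x \<in> set ws)" for x by auto
      then show ?thesis using False V unfolding V_def by simp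
    next
      case True
      have new: "foldr push (filter (\<lambda>s. s \<in> K) (s # ws)) U = push s V"
        using True by (simp add: V_def)
      show ?thesis
      proof (cases "s \<in> D")
        case False
        have "\<not> (s \<in> V \<and> Suc s \<notin> V)"
        proof
          assume a: "s \<in> V \<and> Suc s \<notin> V"
          then have "s \<in> U \<or> s - 1 \<in> D \<and> before s (s - 1)" using Vs by (auto split: if_splits)
          moreover have "Suc s \<notin> U \<or> Suc s \<in> D \<and> before s (Suc s)" using VS a by (auto split: if_splits)
          ultimately show False using ineff[OF True s(1) False] by blast
        qed
        then have "push s V = V" by (auto simp: push_def)
        moreover have "(x \<in> D \<and> x \<in> set (s # ws)) = (x \<in> D \<and> x \<in> set ws)" for x using False by auto
        ultimately show ?thesis unfolding new using V by simp
      next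
        case sD: True
        have sV: "s \<in> V" using Vs eff[OF sD] by (auto split: if_splits)
        have SV: "Suc s \<notin> V" using VS eff[OF sD] by (auto split: if_splits)
        have TV: "push s V = insert (Suc s) (V - {s})" using sV SV by (simp add: push_def)
        show ?thesis
        proof
          fix x
          consider "x = s" | "x = Suc s" | "x \<noteq> s" "x \<noteq> Suc s" by blast
          then show "of_bool (x \<in> foldr push (filter (\<lambda>s. s \<in> K) (s # ws)) U) =
            (of_bool (x \<in> U) - of_bool (x \<in> D \<and> x \<in> set (s # ws)) +
             of_bool (x - 1 \<in> D \<and> x - 1 \<in> set (s # ws)) :: int)"
          proof cases
            case 1
            have "s - 1 \<noteq> s" using s(1) by auto
            then show ?thesis unfolding new TV using 1 sV V[of s] sD s by simp
          next
            case 2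
            then show ?thesis unfolding new TV using SV V[of "Suc s"] sD s by simp
          next
            case 3
            then have "x - 1 \<noteq> s \<or> x = 0" by auto
            then have "x - 1 = s \<Longrightarrow> x - 1 \<notin> D" using D0 s by auto
            then show ?thesis unfolding new TV using 3 V[of x] by auto
          qed
        qed
      qed
    qed
  qed
  from this[of "[]" cs] have "of_bool (x \<in> foldr push (filter (\<lambda>s. s \<in> K) cs) U) =
     (of_bool (x \<in> U) - of_bool (x \<in> D \<and> x \<in> set cs) + of_bool (x - 1 \<in> D \<and> x - 1 \<in> set cs) :: int)"
    by simp
  moreover have "x \<in> D \<and> x \<in> set cs \<longleftrightarrow> x \<in> D" for x using D set_cs by auto
  ultimately show ?thesis by simp
qed

section \<open>The orbit of an initial segment under the Coxeter word\<close>

text \<open>The sets attached to diagonals of a polygon with vertices \<open>0, \<dots>, n + 2\<close> placed on a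
  lower and an upper arc: \<open>U\<close> collects the vertices on one side of the diagonal from \<open>i\<close> to \<open>k\<close>.\<close>

definition diag_set :: "nat set \<Rightarrow> nat \<Rightarrow> nat \<Rightarrow> bool" where
  "diag_set U i k \<longleftrightarrow> 1 \<le> i \<and> i < k \<and> k \<le> Suc n \<and> U \<subseteq> {1..Suc n} \<and> i \<in> U \<and> k \<notin> U \<and>
     (\<forall>p. i < p \<longrightarrow> p < k \<longrightarrow> (p \<in> U \<longleftrightarrow> lower p)) \<and>
     (\<forall>p. 1 \<le> p \<longrightarrow> p < i \<longrightarrow> (p \<in> U \<longleftrightarrow> \<not> lower i)) \<and>
     (\<forall>p. k < p \<longrightarrow> p \<le> Suc n \<longrightarrow> (p \<in> U \<longleftrightarrow> \<not> lower k))"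

text \<open>Final segments are the subsets of {1..n+1} that no letter can push any further.\<close>

definition top_set :: "nat set \<Rightarrow> bool" where
  "top_set U \<longleftrightarrow> (\<exists>m\<ge>1. U = {m..Suc n})"

text \<open>Apply \<open>foldr_push_effective\<close> with D = {i..<k}: these are exactly the
  letters that act, and the unit moves from t to t + 1 telescope to the single exchange of i for
  k.\<close>

lemma diag_set_step:
  assumes "diag_set U i k"
  shows "foldr push cs U = insert k (U - {i})"
proof -
  note g = assms[unfolded diag_set_def]
  have r: "1 \<le> i" "i < k" "k \<le> Suc n" "U \<subseteq> {1..Suc n}" "i \<in> U" "k \<notin> U" using g by auto
  have mid: "p \<in> U \<longleftrightarrow> lower p" if "i < p" "p < k" for p using g that by blast
  have lft: "p \<in> U \<longleftrightarrow> \<not> lower i" if "1 \<le> p" "p < i" for p using g that by blast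
  have rgt: "p \<in> U \<longleftrightarrow> \<not> lower k" if "k < p" "p \<le> Suc n" for p using g that by blast
  have *: "of_bool (x \<in> foldr push (filter (\<lambda>s. s \<in> {1..n}) cs) U) =
     (of_bool (x \<in> U) - of_bool (x \<in> {i..<k}) + of_bool (x - 1 \<in> {i..<k}) :: int)" for x
  proof (rule foldr_push_effective)
    fix t assume t: "t \<in> {i..<k}"
    have "t \<in> U \<longleftrightarrow> \<not> (t - 1 \<in> {i..<k} \<and> before t (t - 1))"
    proof (cases "t = i")
      case True
      then show ?thesis using r by auto
    next
      case False
      then show ?thesis using t mid[of t] before_down[of t] r by auto
    qed
    moreover have "Suc t \<in> U \<longleftrightarrow> Suc t \<in> {i..<k} \<and> before t (Suc t)"
    proof (cases "Suc t = k")
      case False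
      then show ?thesis using t mid[of "Suc t"] before_up[of t] r by auto
    qed (use r in auto)
    ultimately show "(t \<in> U \<longleftrightarrow> \<not> (t - 1 \<in> {i..<k} \<and> before t (t - 1))) \<and>
       (Suc t \<in> U \<longleftrightarrow> Suc t \<in> {i..<k} \<and> before t (Suc t))" by blast
  next
    fix t assume t: "t \<in> {1..n}" "t \<notin> {i..<k}"
    consider "Suc t < i" | "Suc t = i" | "t = k" | "k < t" using t by force
    then show "\<not> ((t \<in> U \<or> t - 1 \<in> {i..<k} \<and> before t (t - 1)) \<and>
       (Suc t \<notin> U \<or> Suc t \<in> {i..<k} \<and> before t (Suc t)))"
    proof cases
      case 1
      then show ?thesis using lft[of t] lft[of "Suc t"] t r by auto
    next
      case 2
      then show ?thesis using lft[of t] before_up[of t] t r by auto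
    next
      case 3
      then show ?thesis using rgt[of "Suc t"] before_down[of t] t r by auto
    next
      case 4
      then show ?thesis using rgt[of t] rgt[of "Suc t"] t r by auto
    qed
  qed (use r in auto)
  have "filter (\<lambda>s. s \<in> {1..n}) cs = cs" using set_cs by (simp add: filter_id_conv)
  then have "of_bool (x \<in> foldr push cs U) = (of_bool (x \<in> insert k (U - {i})) :: int)" for x
    using *[of x] r by (cases "x = i"; cases "x = k") (auto split: if_splits)
  then have "x \<in> foldr push cs U \<longleftrightarrow> x \<in> insert k (U - {i})" for x
    by (metis of_bool_eq_iff)
  then show ?thesis by blast
qed

lemma prev_upper: "1 \<le> s \<Longrightarrow> \<exists>i. 1 \<le> i \<and> i \<le> s \<and> (i = 1 \<or> \<not> lower i) \<and> (\<forall>p. i < p \<longrightarrow> p \<le> s \<longrightarrow> lower p)"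
proof (induction s rule: dec_induct)
  case (step s)
  then obtain i where i: "1 \<le> i" "i \<le> s" "i = 1 \<or> \<not> lower i" "\<And>p. i < p \<Longrightarrow> p \<le> s \<Longrightarrow> lower p" by blast
  show ?case
  proof (cases "lower (Suc s)")
    case True
    then show ?thesis using i by (intro exI[of _ i]) (auto simp: le_Suc_eq)
  next
    case False
    then show ?thesis by (intro exI[of _ "Suc s"]) auto
  qed
qed auto

lemma next_lower: "s \<le> n \<Longrightarrow> \<exists>k. s < k \<and> k \<le> Suc n \<and> (k = Suc n \<or> lower k) \<and> (\<forall>p. s < p \<longrightarrow> p < k \<longrightarrow> \<not> lower p)"
proof (induction s rule: inc_induct)
  case base
  then show ?case by (intro exI[of _ "Suc n"]) auto
next
  case (step s)
  then obtain k where k: "Suc s < k" "k \<le> Suc n" "k = Suc n \<or> lower k" "\<And>p. Suc s < p \<Longrightarrow> p < k \<Longrightarrow> \<not> lower p" by blast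
  show ?case
  proof (cases "lower (Suc s)")
    case False
    then have "\<not> lower p" if "s < p" "p < k" for p using that k(4)[of p] by (cases "p = Suc s") auto
    then show ?thesis using k by (intro exI[of _ k]) auto
  next
    case True
    then show ?thesis using step by (intro exI[of _ "Suc s"]) auto
  qed
qed

text \<open>The ends are the nearest vertex at or below s that is not lower (or 1) and the nearest
  lower vertex above s (or n + 1).\<close>

lemma diag_set_initial:
  assumes "s \<in> {1..n}"
  shows "\<exists>i k. diag_set {1..s} i k"
proof -
  obtain i where i: "1 \<le> i" "i \<le> s" "i = 1 \<or> \<not> lower i" "\<And>p. i < p \<Longrightarrow> p \<le> s \<Longrightarrow> lower p"
    using prev_upper[of s] assms by auto
  obtain k where k: "s < k" "k \<le> Suc n" "k = Suc n \<or> lower k" "\<And>p. s < p \<Longrightarrow> p < k \<Longrightarrow> \<not> lower p"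
    using next_lower[of s] assms by auto
  have "p \<in> {1..s} \<longleftrightarrow> lower p" if "i < p" "p < k" for p
    using i(1,4) k(4) that by (cases "p \<le> s") auto
  then have "diag_set {1..s} i k"
    unfolding diag_set_def using i k by auto
  then show ?thesis by blast
qed

text \<open>Both ends advance around the polygon. The left end goes down to the previous vertex that
  is not lower, or to 1, while this is possible, and afterwards turns over to the least element of
  V; the right end goes up to the next lower vertex, or to n + 1, and afterwards turns over to the
  greatest nonelement of V. Once the advanced ends have passed each other, V is a final
  segment.\<close>

lemma diag_set_next:
  assumes "diag_set U i k" and V: "V = insert k (U - {i})"
  shows "(\<exists>i k. diag_set V i k) \<or> top_set V"
proof -
  note g = assms(1)[unfolded diag_set_def]
  have r: "1 \<le> i" "i < k" "k \<le> Suc n" "U \<subseteq> {1..Suc n}" "i \<in> U" "k \<notin> U" using g by auto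
  have mid: "p \<in> V \<longleftrightarrow> lower p" if "i < p" "p < k" for p using g that V by auto
  have lft: "p \<in> V \<longleftrightarrow> \<not> lower i" if "1 \<le> p" "p < i" for p using g that V by auto
  have rgt: "p \<in> V \<longleftrightarrow> \<not> lower k" if "k < p" "p \<le> Suc n" for p using g that V by auto
  have iV: "i \<notin> V" and kV: "k \<in> V" and Vs: "V \<subseteq> {1..Suc n}" using V r by auto
  have 0: "0 \<notin> V" using Vs by auto
  have left: "(\<exists>i'. 1 \<le> i' \<and> i' < i \<and> i' \<in> V \<and> \<not> lower i \<and> (\<forall>p. i' < p \<longrightarrow> p < k \<longrightarrow> (p \<in> V \<longleftrightarrow> lower p)) \<and>
        (\<forall>p. 1 \<le> p \<longrightarrow> p < i' \<longrightarrow> (p \<in> V \<longleftrightarrow> \<not> lower i'))) \<or>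
      (\<exists>i'. i < i' \<and> i' \<le> k \<and> i' \<in> V \<and> (\<forall>p < i'. p \<notin> V))"
  proof (cases "i = 1 \<or> lower i")
    case False
    then obtain i' where i': "1 \<le> i'" "i' \<le> i - 1" "i' = 1 \<or> \<not> lower i'" "\<And>p. i' < p \<Longrightarrow> p \<le> i - 1 \<Longrightarrow> lower p"
    proof -
      have "1 \<le> i - 1" using False r by linarith
      then show ?thesis using prev_upper[of "i - 1"] that by blast
    qed
    have a: "p \<in> V \<longleftrightarrow> lower p" if "i' < p" "p < k" for p
    proof (cases p i rule: linorder_cases)
      case less
      then show ?thesis using lft[of p] i'(4)[of p] False that by auto
    next
      case equal
      then show ?thesis using iV False by auto
    next
      case greater
      then show ?thesis using mid that by auto
    qed
    have b: "p \<in> V \<longleftrightarrow> \<not> lower i'" if "1 \<le> p" "p < i'" for p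
      using lft[of p] i' False that by auto
    have "i' \<in> V" using lft[of i'] i' False r by auto
    then show ?thesis using a b i' False r by (intro disjI1 exI[of _ i']) auto
  next
    case True
    then have z: "p \<notin> V" if "p \<le> i" for p
      using lft[of p] that iV 0 by (cases "p = 0"; cases "p = i") auto
    \<comment> \<open>Nothing up to i lies in V, so the left end has to turn over to the other
      arc.\<close>
    define i' where "i' = (LEAST p. p \<in> V)"
    have "i' \<in> V" "i' \<le> k" "\<forall>p<i'. p \<notin> V"
      unfolding i'_def using kV by (auto intro: LeastI Least_le dest: not_less_Least)
    moreover have "i < i'" using z \<open>i' \<in> V\<close> by (meson not_le)
    ultimately show ?thesis by blast
  qed
  have right: "(\<exists>k'. k < k' \<and> k' \<le> Suc n \<and> k' \<notin> V \<and> lower k \<and> (\<forall>p. i < p \<longrightarrow> p < k' \<longrightarrow> (p \<in> V \<longleftrightarrow> lower p)) \<and>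
        (\<forall>p. k' < p \<longrightarrow> p \<le> Suc n \<longrightarrow> (p \<in> V \<longleftrightarrow> \<not> lower k'))) \<or>
      (\<exists>k'. i \<le> k' \<and> k' < k \<and> k' \<notin> V \<and> (\<forall>p. k' < p \<longrightarrow> p \<le> Suc n \<longrightarrow> p \<in> V))"
  proof (cases "k = Suc n \<or> \<not> lower k")
    case False
    then obtain k' where k': "k < k'" "k' \<le> Suc n" "k' = Suc n \<or> lower k'" "\<And>p. k < p \<Longrightarrow> p < k' \<Longrightarrow> \<not> lower p"
      using next_lower[of k] r by auto
    have a: "p \<in> V \<longleftrightarrow> lower p" if "i < p" "p < k'" for p
    proof (cases p k rule: linorder_cases)
      case greater
      then show ?thesis using rgt[of p] k'(4)[of p] False that k' by auto
    next
      case equal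
      then show ?thesis using kV False by auto
    next
      case less
      then show ?thesis using mid that by auto
    qed
    have b: "p \<in> V \<longleftrightarrow> \<not> lower k'" if "k' < p" "p \<le> Suc n" for p
      using rgt[of p] k' False that by auto
    have "k' \<notin> V" using rgt[of k'] k' False r by auto
    then show ?thesis using a b k' False r by (intro disjI1 exI[of _ k']) auto
  next
    case True
    then have z: "p \<in> V" if "k \<le> p" "p \<le> Suc n" for p
      using rgt[of p] that kV by (cases "p = k") auto
    define k' where "k' = Max {p. p \<le> Suc n \<and> p \<notin> V}"
    have fin: "finite {p. p \<le> Suc n \<and> p \<notin> V}" and ne: "i \<in> {p. p \<le> Suc n \<and> p \<notin> V}"
      using iV r by auto
    have "k' \<in> {p. p \<le> Suc n \<and> p \<notin> V}" using Max_in[OF fin] ne unfolding k'_def by blast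
    then have k': "k' \<notin> V" "k' \<le> Suc n" by auto
    have "i \<le> k'" unfolding k'_def using fin iV r by (intro Max_ge) auto
    moreover have "p \<in> V" if "k' < p" "p \<le> Suc n" for p
      using Max_ge[OF fin, of p] that unfolding k'_def by fastforce
    moreover have "k' < k" using z[of k'] k' by (meson not_le)
    ultimately show ?thesis using k' by blast
  qed
  show ?thesis
    using left
  proof (elim disjE exE conjE)
    fix i'
    assume i': "1 \<le> i'" "i' < i" "i' \<in> V" "\<not> lower i" "\<forall>p. i' < p \<longrightarrow> p < k \<longrightarrow> (p \<in> V) = lower p"
      "\<forall>p. 1 \<le> p \<longrightarrow> p < i' \<longrightarrow> (p \<in> V) = (\<not> lower i')"
    show ?thesis using right
    proof (elim disjE exE conjE)
      fix k' assume k': "k < k'" "k' \<le> Suc n" "k' \<notin> V" "lower k"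
        "\<forall>p. i < p \<longrightarrow> p < k' \<longrightarrow> (p \<in> V) = lower p" "\<forall>p. k' < p \<longrightarrow> p \<le> Suc n \<longrightarrow> (p \<in> V) = (\<not> lower k')"
      have "(p \<in> V) = lower p" if "i' < p" "p < k'" for p
        using i'(5) k'(5) that r by (cases "p < k") auto
      then have "diag_set V i' k'"
        unfolding diag_set_def using i' k' r Vs by simp
      then show ?thesis by blast
    next
      fix k' assume k': "i \<le> k'" "k' < k" "k' \<notin> V" "\<forall>p. k' < p \<longrightarrow> p \<le> Suc n \<longrightarrow> p \<in> V"
      have "\<not> lower k'" using i'(2,4,5) k' by (cases "k' = i") auto
      then have "diag_set V i' k'"
        unfolding diag_set_def using i' k' r Vs by auto
      then show ?thesis by blast
    qed
  next
    fix i' assume i': "i < i'" "i' \<le> k" "i' \<in> V" "\<forall>p<i'. p \<notin> V"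
    show ?thesis using right
    proof (elim disjE exE conjE)
      fix k' assume k': "k < k'" "k' \<le> Suc n" "k' \<notin> V" "lower k"
        "\<forall>p. i < p \<longrightarrow> p < k' \<longrightarrow> (p \<in> V) = lower p" "\<forall>p. k' < p \<longrightarrow> p \<le> Suc n \<longrightarrow> (p \<in> V) = (\<not> lower k')"
      have "lower i'" using i' k' by auto
      then have "diag_set V i' k'"
        unfolding diag_set_def using i' k' r Vs by auto
      then show ?thesis by blast
    next
      fix k' assume k': "i \<le> k'" "k' < k" "k' \<notin> V" "\<forall>p. k' < p \<longrightarrow> p \<le> Suc n \<longrightarrow> p \<in> V"
      show ?thesis
      proof (cases "i' < k'")
        case True
        have "lower i'" using mid[of i'] i' k' True by auto
        moreover have "\<not> lower k'" using mid[of k'] i' k' True by auto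
        ultimately have "diag_set V i' k'"
          unfolding diag_set_def using i' k' r Vs True mid by auto
        then show ?thesis by blast
      next
        case False
        have "V = {i'..Suc n}"
        proof (intro equalityI subsetI)
          fix x assume x: "x \<in> V"
          then have "i' \<le> x" using i'(4) by (meson not_le)
          then show "x \<in> {i'..Suc n}" using x Vs by auto
        next
          fix x assume x: "x \<in> {i'..Suc n}"
          show "x \<in> V"
          proof (cases "x = i'")
            case False
            then have "k' < x" using x \<open>\<not> i' < k'\<close> by auto
            then show ?thesis using k'(4) x by auto
          qed (use i' in simp)
        qed
        then show ?thesis using i' r unfolding top_set_def by (intro disjI2 exI[of _ i']) auto
      qed
    qed
  qed
qed

abbreviation "push_c \<equiv> foldr push cs"

lemma push_top: "top_set U \<Longrightarrow> s \<in> {1..n} \<Longrightarrow> push s U = U"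
  by (auto simp: push_def top_set_def)

lemma foldr_push_top: "top_set U \<Longrightarrow> ws \<in> W \<Longrightarrow> foldr push ws U = U"
  by (induction ws) (auto simp: push_top)

lemma push_initial: "t \<noteq> s \<Longrightarrow> t \<noteq> 0 \<Longrightarrow> push t {1..s} = {1..s}"
  by (auto simp: push_def)

lemma foldr_push_initial: "s \<notin> set ws \<Longrightarrow> 0 \<notin> set ws \<Longrightarrow> foldr push ws {1..s} = {1..s}"
  by (induction ws) (auto simp: push_initial simp del: One_nat_def)

lemma push_c_funpow:
  assumes "s \<in> {1..n}"
  shows "(\<exists>i k. diag_set ((push_c ^^ m) {1..s}) i k) \<or> top_set ((push_c ^^ m) {1..s})"
proof (induction m)
  case 0
  then show ?case using diag_set_initial[OF assms] by simp
next
  case (Suc m)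
  then show ?case
  proof (elim disjE exE)
    fix i k assume "diag_set ((push_c ^^ m) {1..s}) i k"
    then show ?thesis using diag_set_next diag_set_step by auto
  next
    assume "top_set ((push_c ^^ m) {1..s})"
    then show ?thesis using foldr_push_top cs_W by auto
  qed
qed

text \<open>Each step that exchanges i for a larger k raises the sum of the elements, and this sum
  is bounded.\<close>

lemma push_c_funpow_top:
  assumes "s \<in> {1..n}"
  shows "\<exists>m. top_set ((push_c ^^ m) {1..s})"
proof (rule ccontr)
  assume no: "\<nexists>m. top_set ((push_c ^^ m) {1..s})"
  have d: "\<exists>i k. diag_set ((push_c ^^ m) {1..s}) i k" for m
    using push_c_funpow[OF assms, of m] no by blast
  have ge: "m \<le> \<Sum> ((push_c ^^ m) {1..s})" for m
  proof (induction m)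
    case (Suc m)
    obtain i k where ik: "diag_set ((push_c ^^ m) {1..s}) i k" using d by blast
    then have r: "i < k" "i \<in> (push_c ^^ m) {1..s}" "k \<notin> (push_c ^^ m) {1..s}" "finite ((push_c ^^ m) {1..s})"
      by (auto simp: diag_set_def intro: finite_subset)
    have "\<Sum> ((push_c ^^ Suc m) {1..s}) = k + (\<Sum> ((push_c ^^ m) {1..s} - {i}))"
      using diag_set_step[OF ik] r by simp
    also have "\<dots> > i + (\<Sum> ((push_c ^^ m) {1..s} - {i}))" using r by simp
    also have "i + (\<Sum> ((push_c ^^ m) {1..s} - {i})) = \<Sum> ((push_c ^^ m) {1..s})"
      using r by (simp add: sum.remove)
    finally show ?case using Suc by simp
  qed simp
  have "\<Sum> ((push_c ^^ m) {1..s}) \<le> \<Sum> {1..Suc n}" for m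
    using d[of m] by (intro sum_mono2) (auto simp: diag_set_def)
  then show False using ge by (metis Suc_n_not_le_n order_trans)
qed

definition per :: "nat \<Rightarrow> nat" where
  "per p = cs ! (p mod length cs)"

lemma per_range: "per p \<in> {1..n}"
  using set_cs length_cs n_pos unfolding per_def by (metis less_eq_Suc_le mod_less_divisor nth_mem One_nat_def)

lemma sub_per:
  assumes "r \<le> n"
  shows "sub per UNIV (m * n + r) = concat (replicate m cs) @ take r cs"
proof (induction m)
  case 0
  show ?case
    using assms by (intro nth_equalityI) (auto simp: sub_def length_cs per_def)
next
  case (Suc m)
  have "[0..<Suc m * n + r] = [0..<n] @ map (\<lambda>x. x + n) [0..<m * n + r]"
  proof -
    have "Suc m * n + r = n + (m * n + r)" by simp
    moreover have "[0..<n + (m * n + r)] = [0..<n] @ [n..<n + (m * n + r)]"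
      using upt_add_eq_append[of 0 n "m * n + r"] by simp
    moreover have "[n..<n + (m * n + r)] = map (\<lambda>x. x + n) [0..<m * n + r]"
      using map_add_upt[of n "m * n + r"] by (simp only: add.commute[of n])
    ultimately show ?thesis by (simp only:)
  qed
  then have "sub per UNIV (Suc m * n + r) = map per [0..<n] @ map (\<lambda>x. per (x + n)) [0..<m * n + r]"
    by (simp add: sub_def)
  also have "map per [0..<n] = cs"
    by (intro nth_equalityI) (auto simp: length_cs per_def)
  also have "map (\<lambda>x. per (x + n)) [0..<m * n + r] = sub per UNIV (m * n + r)"
    by (simp add: sub_def per_def length_cs)
  finally show ?case using Suc by simp
qed

lemma foldr_concat_replicate: "foldr push (concat (replicate m cs)) X = (push_c ^^ m) X"
  by (induction m) auto

end

section \<open>Counting functions: the Bruhat order on subsets\<close>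

definition cnt :: "nat set \<Rightarrow> nat \<Rightarrow> nat" where
  "cnt X t = card (X \<inter> {..t})"

lemma cnt_Suc: "cnt X (Suc t) = cnt X t + of_bool (Suc t \<in> X)"
proof (cases "Suc t \<in> X")
  case True
  then have "X \<inter> {..Suc t} = insert (Suc t) (X \<inter> {..t})" by auto
  then show ?thesis using True by (simp add: cnt_def)
next
  case False
  then have "X \<inter> {..Suc t} = X \<inter> {..t}" by (auto simp: le_Suc_eq)
  then show ?thesis using False by (simp add: cnt_def)
qed

lemma cnt_pred: "1 \<le> t \<Longrightarrow> cnt X t = cnt X (t - 1) + of_bool (t \<in> X)"
  using cnt_Suc[of X "t - 1"] by simp

lemma cnt_swp_other:
  assumes "t \<noteq> s"
  shows "cnt (swp s ` X) t = cnt X t"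
proof -
  have "swp s ` X \<inter> {..t} = swp s ` (X \<inter> {..t})"
  proof -
    have "swp s ` {..t} = {..t}"
      using assms by (intro transpose_image_eq) auto
    then show ?thesis by (metis image_Int inj_transpose)
  qed
  then show ?thesis by (simp add: cnt_def card_image)
qed

lemma cnt_swp_same:
  assumes "1 \<le> s"
  shows "cnt (swp s ` X) s = cnt X (s - 1) + of_bool (Suc s \<in> X)"
proof -
  have "s \<in> swp s ` X \<longleftrightarrow> Suc s \<in> X"
    by (simp add: in_transpose_image_iff)
  then show ?thesis
    using cnt_pred[OF assms, of "swp s ` X"] cnt_swp_other[of "s - 1" s X] assms by simp
qed

lemma push_swp: "push s X = (if s \<in> X \<and> Suc s \<notin> X then swp s ` X else X)"
proof (cases "s \<in> X \<and> Suc s \<notin> X")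
  case True
  then have "x \<in> swp s ` X \<longleftrightarrow> x \<in> insert (Suc s) (X - {s})" for x
    unfolding in_transpose_image_iff by (auto simp: Transposition.transpose_def)
  then show ?thesis using True by (auto simp: push_def)
qed (auto simp: push_def)

lemma cnt_push_other: "t \<noteq> s \<Longrightarrow> cnt (push s X) t = cnt X t"
  by (simp add: push_swp cnt_swp_other)

text \<open>The new count at s no longer depends on the old count at s, and it is monotone in the
  two neighbouring counts. This is what makes \<open>push\<close> monotone.\<close>

lemma cnt_push_same: "1 \<le> s \<Longrightarrow> cnt (push s X) s = max (cnt X (s - 1)) (cnt X (Suc s) - 1)"
  using cnt_pred[of s X] cnt_Suc[of X s]
  by (cases "s \<in> X"; cases "Suc s \<in> X") (auto simp: push_swp cnt_swp_same)

lemma cnt_push_mono: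
  assumes "1 \<le> s" "\<And>t. cnt Y t \<le> cnt X t"
  shows "cnt (push s Y) t \<le> cnt (push s X) t"
proof (cases "t = s")
  case True
  then show ?thesis using assms(2)[of "s - 1"] assms(2)[of "Suc s"]
    by (auto simp: cnt_push_same[OF assms(1)] intro: diff_le_mono max.mono le_max_iff_disj)
next
  case False
  then show ?thesis using assms by (simp add: cnt_push_other)
qed

lemma cnt_push_le: "1 \<le> s \<Longrightarrow> cnt (push s X) t \<le> cnt X t"
  using cnt_pred[of s X] by (cases "t = s") (auto simp: cnt_push_other cnt_swp_other push_swp cnt_swp_same)

lemma cnt_push_swp_le: "1 \<le> s \<Longrightarrow> cnt (push s X) t \<le> cnt (swp s ` X) t"
  using cnt_pred[of s X] cnt_swp_same[of s X] by (cases "t = s") (auto simp: cnt_push_other cnt_swp_other push_swp)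

text \<open>Smaller counts mean a higher set. Pushing with all letters moves a set at least as far
  up as acting by any subword; on subsets this says that the Demazure product dominates all subword
  products in Bruhat order.\<close>

lemma cnt_subword:
  assumes "\<And>x. x \<in> set xs \<Longrightarrow> 1 \<le> f x"
  shows "cnt (foldr push (map f xs) X) t \<le> cnt (perm (map f (filter P xs)) ` X) t"
  using assms
proof (induction xs arbitrary: t)
  case Nil
  then show ?case by simp
next
  case (Cons x xs)
  have 1: "1 \<le> f x" using Cons.prems by simp
  let ?Z = "foldr push (map f xs) X" and ?Y = "perm (map f (filter P xs)) ` X"
  have IH: "cnt ?Z t \<le> cnt ?Y t" for t using Cons by simp
  show ?case
  proof (cases "P x")
    case True
    have "cnt (push (f x) ?Z) t \<le> cnt (push (f x) ?Y) t" by (rule cnt_push_mono[OF 1 IH])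
    also have "\<dots> \<le> cnt (swp (f x) ` ?Y) t" by (rule cnt_push_swp_le[OF 1])
    finally show ?thesis using True by (simp add: image_comp)
  next
    case False
    then show ?thesis using cnt_push_le[OF 1, of ?Z t] IH[of t] by simp
  qed
qed

lemma take_filter_upt:
  assumes "j < length (filter P [0..<b])"
  shows "take j (filter P [0..<b]) = filter P [0..<filter P [0..<b] ! j]"
  using assms
proof (induction b)
  case (Suc b)
  show ?case
  proof (cases "j < length (filter P [0..<b])")
    case True
    then show ?thesis using Suc.IH by (simp add: nth_append)
  next
    case False
    then have "P b" "j = length (filter P [0..<b])" using Suc.prems by (auto split: if_splits)
    then show ?thesis by (simp add: nth_append)
  qed
qed simp

context type_A
begin

text \<open>Reversal complements the counts and so reverses the order; it turns lower bounds for the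
  remaining part of a facet word into upper bounds for the part already read.\<close>

lemma cnt_rev0:
  assumes "X \<subseteq> {1..Suc n}" "t \<le> Suc n"
  shows "cnt (rev0 ` X) t + cnt X (Suc n - t) = card X"
proof -
  have fin: "finite X" using assms(1) finite_subset by blast
  have "rev0 ` X \<inter> {..t} = rev0 ` (X \<inter> {Suc n - t<..})"
  proof -
    have "rev0 x \<le> t \<longleftrightarrow> Suc n - t < x" if "x \<in> X" for x
      using that assms unfolding rev0_def by auto
    then show ?thesis by auto
  qed
  then have "cnt (rev0 ` X) t = card (X \<inter> {Suc n - t<..})"
    unfolding cnt_def using permutes_inj_on[OF rev0_permutes] by (metis card_image)
  moreover have "card X = card (X \<inter> {..Suc n - t}) + card (X \<inter> {Suc n - t<..})"
    using fin by (subst card_Un_disjoint[symmetric]) (auto intro: arg_cong[of _ _ card])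
  ultimately show ?thesis by (simp add: cnt_def)
qed

lemma lookup_wt_diff:
  assumes "finite U" "finite V" "card U = card V"
  shows "Poly_Mapping.lookup (wt U - wt V) t =
    (if t \<in> {1..n} then real (cnt U t) - real (cnt V t) else 0)"
  using assms by (simp add: lookup_minus lookup_wt cnt_def)

text \<open>Summing the membership identity up to x telescopes, because \<open>D\<close> enters with
  opposite signs at neighbouring points.\<close>

lemma cnt_of_bool:
  assumes "\<And>x. of_bool (x \<in> V) = (of_bool (x \<in> U) - of_bool (x \<in> D) + of_bool (x - 1 \<in> D) :: int)"
    and "0 \<notin> D"
  shows "int (cnt V x) = int (cnt U x) - of_bool (x \<in> D)"
proof (induction x)
  case 0
  have "0 \<in> V \<longleftrightarrow> 0 \<in> U" using assms(1)[of 0] assms(2) by (auto split: if_splits)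
  then have "V \<inter> {..0} = U \<inter> {..0}" by auto
  then show ?case using assms(2) by (simp add: cnt_def)
next
  case (Suc x)
  then show ?case using assms(1)[of "Suc x"] by (simp add: cnt_Suc)
qed

end

section \<open>The sorting word as a greedy subword\<close>

context coxeter_word
begin

text \<open>After enough copies of the Coxeter word every {1..s} has become a final segment, and a
  permutation that maps all initial segments to final ones has descents only.\<close>

lemma demazure_per_rev0: "\<exists>M. demazure (sub per UNIV (M * n)) = rev0"
proof -
  have stay: "top_set X \<Longrightarrow> (push_c ^^ j) X = X" for X j
    by (induction j) (auto simp: foldr_push_top[OF _ cs_W])
  have "\<forall>s\<in>{1..n}. \<exists>m. top_set ((push_c ^^ m) {1..s})" using push_c_funpow_top by blast
  then obtain m where m: "\<And>s. s \<in> {1..n} \<Longrightarrow> top_set ((push_c ^^ m s) {1..s})" by metis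
  define M where "M = Max (m ` {1..n})"
  have top: "top_set ((push_c ^^ M) {1..s})" if s: "s \<in> {1..n}" for s
  proof -
    have "m s \<le> M" unfolding M_def using s by (intro Max_ge) auto
    then have "(push_c ^^ M) {1..s} = (push_c ^^ (M - m s)) ((push_c ^^ m s) {1..s})"
      by (simp flip: funpow_add[unfolded comp_def, THEN fun_cong] comp_apply[of "push_c ^^ (M - m s)"])
    then show ?thesis using stay[OF m[OF s]] m[OF s] by simp
  qed
  define w where "w = sub per UNIV (M * n)"
  have w: "w = concat (replicate M cs)" using sub_per[of 0 M] by (simp add: w_def)
  have wW: "w \<in> W" unfolding w_def using per_range by (intro sub_in_W) auto
  note p = demazure_permutes[OF wW]
  have "0 \<notin> set w" using wW by auto
  then have img: "demazure w ` {1..s} = (push_c ^^ M) {1..s}" for s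
    using demazure_image_push[of w s] unfolding w foldr_concat_replicate by simp
  have "demazure w = rev0"
  proof (rule descending_rev0[OF p])
    fix s assume s: "s \<in> {1..n}"
    obtain l where l: "demazure w ` {1..s} = {l..Suc n}" using top[OF s] img[of s] by (auto simp: top_set_def)
    have "demazure w s \<in> {l..Suc n}" using s unfolding l[symmetric] by auto
    moreover have "demazure w (Suc s) \<notin> {l..Suc n}"
    proof
      assume "demazure w (Suc s) \<in> {l..Suc n}"
      then obtain x where "x \<in> {1..s}" "demazure w (Suc s) = demazure w x" unfolding l[symmetric] by auto
      then show False using permutes_inj[OF p] by (auto simp: inj_eq)
    qed
    moreover have "demazure w (Suc s) \<le> Suc n" using permutes_range[OF p, of "Suc s"] s by auto
    ultimately show "demazure w (Suc s) < demazure w s" by auto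
  qed
  then show ?thesis unfolding w_def by blast
qed

text \<open>A prefix length of the infinite word that already gives \<open>rev0\<close>. No later
  position is greedy, so the infinite greedy set lies below this bound.\<close>

definition bd :: nat where
  "bd = (SOME M. demazure (sub per UNIV (M * n)) = rev0) * n"

lemma demazure_bd: "demazure (sub per UNIV bd) = rev0"
  unfolding bd_def by (rule someI_ex[OF demazure_per_rev0])

definition Gc :: "nat set" where
  "Gc = greedy per UNIV"

definition q :: "nat list" where
  "q = sub per Gc bd"

lemma rmult_rev0: "s \<in> {1..n} \<Longrightarrow> rmult s rev0 = rev0"
  by (auto simp: rmult_def rev0_def)

lemma Gc_bound: "Gc \<subseteq> {..<bd}"
proof
  fix p assume p: "p \<in> Gc"
  show "p \<in> {..<bd}"
  proof (rule ccontr)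
    assume "p \<notin> {..<bd}"
    then have "bd \<le> p" by simp
    then have "demazure (sub per UNIV p) = rev0"
      by (induction p rule: dec_induct) (simp_all add: demazure_bd sub_Suc rmult_rev0[OF per_range])
    then show False using p per_range[of p] by (auto simp: Gc_def greedy_def rev0_def)
  qed
qed

lemma q_red: "red q" and perm_q: "perm q = rev0"
  using greedy_red[of UNIV per bd] per_range demazure_bd by (auto simp: q_def Gc_def)

lemma q_W: "q \<in> W"
  using q_red by (simp add: red_def)

lemma length_q: "length q = card pairs"
  using q_red perm_q Inv_rev0 by (simp add: red_def)

lemma card_Gc: "card Gc = card pairs"
  using length_sub[OF Gc_bound, of per] length_q by (simp add: q_def)

lemma periodic_subword_sub:
  assumes "J \<subseteq> {..<b}" shows "periodic_subword cs J = sub per J b"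
  unfolding periodic_subword_def sub_def sorted_list_of_set_filter[OF assms] by (simp add: per_def)

lemma red_w0_iff: "reduced_word n cartan_A ws (longest_element n cartan_A) \<longleftrightarrow> red ws \<and> perm ws = rev0"
  unfolding reduced_word_w0_iff red_def using Inv_rev0 by auto

text \<open>All reduced words of the longest element have the same length, so the comparison at the
  first difference from \<open>greedy_lex_first\<close> decides the lexicographic order.\<close>

lemma sorting_word_q: "sorting_word n cartan_A cs = q"
proof -
  have fin: "finite Gc" using Gc_bound finite_subset by blast
  have "lex_first {J. finite J \<and> reduced_word n cartan_A (periodic_subword cs J) (longest_element n cartan_A)} = Gc"
  proof (rule lex_first_eqI)
    show "Gc \<in> {J. finite J \<and> reduced_word n cartan_A (periodic_subword cs J) (longest_element n cartan_A)}"
      using fin periodic_subword_sub[OF Gc_bound] q_red perm_q by (simp add: red_w0_iff q_def)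
  next
    fix J assume "J \<in> {J. finite J \<and> reduced_word n cartan_A (periodic_subword cs J) (longest_element n cartan_A)}"
    then have J: "finite J" "red (periodic_subword cs J)" "perm (periodic_subword cs J) = rev0"
      by (auto simp: red_w0_iff)
    obtain b where b: "J \<subseteq> {..<b}" using J(1) finite_nat_iff_bounded by blast
    note Js = periodic_subword_sub[OF b]
    have cJ: "card J = card pairs"
      using J(2,3) Inv_rev0 length_sub[OF b, of per] unfolding Js red_def by simp
    show "lex_le Gc J"
    proof (cases "J = Gc")
      case True
      then show ?thesis by (simp add: lex_le_def)
    next
      case False
      obtain p where "p \<in> Gc" "p \<notin> J" "\<And>x. x < p \<Longrightarrow> x \<in> Gc \<longleftrightarrow> x \<in> J"
        using greedy_lex_first[of UNIV per J b] per_range b J(2) fin card_Gc cJ False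
        unfolding Js Gc_def by (metis subset_UNIV)
      then show ?thesis using fin J(1) card_Gc cJ by (intro lex_le_first_diff[of Gc J p]) auto
    qed
  qed
  then show ?thesis
    unfolding sorting_word_def using periodic_subword_sub[OF Gc_bound] by (simp add: q_def)
qed

lemma take_q:
  assumes "j < length q"
  obtains p where "p \<in> Gc" "q ! j = per p" "perm (take j q) = demazure (sub per UNIV p)"
proof -
  define xs where "xs = filter (\<lambda>x. x \<in> Gc) [0..<bd]"
  have j: "j < length xs" using assms by (simp add: xs_def q_def sub_def)
  have "xs ! j \<in> set xs" using j by (rule nth_mem)
  then have 1: "xs ! j \<in> Gc" by (simp add: xs_def)
  have 2: "q ! j = per (xs ! j)" using j by (simp add: q_def sub_def xs_def)
  have "take j q = sub per Gc (xs ! j)"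
    unfolding q_def sub_def take_map using take_filter_upt[of j "\<lambda>x. x \<in> Gc" bd] j
    by (simp add: xs_def)
  then have "perm (take j q) = demazure (sub per UNIV (xs ! j))"
    using greedy_red[of UNIV per "xs ! j"] per_range by (simp add: Gc_def)
  then show ?thesis using that 1 2 by blast
qed

text \<open>Let the letter s stand in copy number m of c, counted from 0. The other letters of that
  copy do not move {1..s}, so the partial product sends {1..s} to the image under m copies of c, and
  including s gives the image under m + 1 copies. One application of c thus exchanges
  \<open>a s\<close> for \<open>a (Suc s)\<close>; \<open>diag_set_step\<close> names the same pair
  as the ends of the diagonal.\<close>

lemma sorting_prefix:
  assumes "j < length q"
  defines "a \<equiv> perm (take j q)" and "s \<equiv> q ! j"
  shows "diag_set (a ` {1..s}) (a s) (a (Suc s))" "a s < a (Suc s)" "s \<in> {1..n}"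
proof -
  obtain p where p: "p \<in> Gc" "s = per p" "a = demazure (sub per UNIV p)"
    using take_q[OF assms(1)] unfolding a_def s_def by metis
  show lt: "a s < a (Suc s)" using p by (auto simp: Gc_def greedy_def)
  show sn: "s \<in> {1..n}" using p per_range by simp
  define m r where "m = p div n" and "r = p mod n"
  have pr: "p = m * n + r" "r < n" using n_pos by (auto simp: m_def r_def)
  have sr: "s = cs ! r" using p by (simp add: per_def length_cs r_def)
  have split: "cs = take r cs @ s # drop (Suc r) cs" using pr sr length_cs by (simp add: id_take_nth_drop)
  have notin: "s \<notin> set (take r cs)" "s \<notin> set (drop (Suc r) cs)"
    using distinct_cs split by (metis distinct.simps(2) distinct_append not_distinct_conv_prefix,
      metis distinct.simps(2) distinct_append)
  have no0: "0 \<notin> set cs" using set_cs by auto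
  then have no0': "0 \<notin> set (take r cs)" "0 \<notin> set (drop (Suc r) cs)"
    by (meson in_set_takeD, meson in_set_dropD)
  have aT: "demazure (sub per UNIV p') ` {1..s} = foldr push (sub per UNIV p') {1..s}" for p'
  proof -
    have "sub per UNIV p' \<in> W" using per_range by (intro sub_in_W) auto
    then have "0 \<notin> set (sub per UNIV p')" by auto
    then show ?thesis using demazure_image_push by blast
  qed
  \<comment> \<open>The letters of the incomplete copy act before the m full copies, directly on
    {1..s}, and none of them is s.\<close>
  have A: "a ` {1..s} = (push_c ^^ m) {1..s}"
    unfolding p(3) aT pr(1) using sub_per[of r m] pr(2) foldr_push_initial[OF notin(1) no0'(1)]
    by (simp add: foldr_concat_replicate)
  have "demazure (sub per UNIV (Suc p)) = a \<circ> swp s"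
    using lt p(2,3) by (simp add: sub_Suc rmult_def)
  then have "(a \<circ> swp s) ` {1..s} = foldr push (sub per UNIV (m * n + Suc r)) {1..s}"
    using aT[of "Suc p"] pr by simp
  also have "sub per UNIV (m * n + Suc r) = concat (replicate m cs) @ take r cs @ [s]"
    using sub_per[of "Suc r" m] pr sr length_cs by (simp add: take_Suc_conv_app_nth)
  also have "foldr push \<dots> {1..s} = (push_c ^^ m) (foldr push (take r cs @ [s]) {1..s})"
    by (simp add: foldr_concat_replicate)
  \<comment> \<open>The letters of c after s would act first and fix {1..s}, so they may be appended
    to complete the copy.\<close>
  also have "foldr push (take r cs @ [s]) {1..s} = push_c {1..s}"
    by (subst (2) split) (simp add: foldr_push_initial[OF notin(2) no0'(2)] del: One_nat_def)
  also have "(push_c ^^ m) (push_c {1..s}) = push_c (a ` {1..s})"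
    unfolding A by (simp add: funpow_swap1)
  finally have next': "(a \<circ> swp s) ` {1..s} = push_c (a ` {1..s})" .
  have aperm: "a permutes {1..Suc n}"
    unfolding p(3) using per_range by (intro demazure_permutes sub_in_W) auto
  have inj: "inj a" using aperm by (rule permutes_inj)
  have sw: "swp s ` {1..s} = insert (Suc s) ({1..s} - {s})"
    using sn push_swp[of s "{1..s}"] by (simp add: push_def)
  have step: "push_c (a ` {1..s}) = insert (a (Suc s)) (a ` {1..s} - {a s})"
    unfolding next'[symmetric] image_comp[symmetric] sw
    using inj by (simp add: image_set_diff)
  have in1: "a s \<in> a ` {1..s}" using sn by auto
  have out1: "a (Suc s) \<notin> a ` {1..s}" using inj by (auto simp: inj_eq)
  \<comment> \<open>A final segment would be fixed by c, but c has just been seen to bring in the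
    new element \<open>a (Suc s)\<close>.\<close>
  have "\<not> top_set (a ` {1..s})"
  proof
    assume "top_set (a ` {1..s})"
    then have "push_c (a ` {1..s}) = a ` {1..s}" by (rule foldr_push_top[OF _ cs_W])
    then show False using step out1 by auto
  qed
  then obtain i k where ik: "diag_set (a ` {1..s}) i k"
    using push_c_funpow[OF sn, of m] unfolding A[symmetric] by blast
  have ik': "i \<in> a ` {1..s}" "k \<notin> a ` {1..s}" using ik by (auto simp: diag_set_def)
  have eq: "insert k (a ` {1..s} - {i}) = insert (a (Suc s)) (a ` {1..s} - {a s})"
    using diag_set_step[OF ik] step by simp
  have "k = a (Suc s)" using eq ik' out1 by (metis DiffD1 insertE insertI1)
  moreover have "i = a s"
  proof (rule ccontr)
    assume "i \<noteq> a s"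
    then have "a s \<in> insert k (a ` {1..s} - {i})" using in1 by simp
    then have "a s \<in> insert (a (Suc s)) (a ` {1..s} - {a s})" unfolding eq .
    then show False using lt by auto
  qed
  ultimately show "diag_set (a ` {1..s}) (a s) (a (Suc s))" using ik by simp
qed

end

section \<open>Facets and weight functions\<close>

context type_A
begin

lemma rev0_image: "s \<le> Suc n \<Longrightarrow> rev0 ` {1..s} = {n + 2 - s..Suc n}"
proof (intro equalityI subsetI)
  fix x assume s: "s \<le> Suc n" and x: "x \<in> {n + 2 - s..Suc n}"
  then have "x = rev0 (n + 2 - x)" "n + 2 - x \<in> {1..s}" unfolding rev0_def by auto
  then show "x \<in> rev0 ` {1..s}" by blast
next
  fix x assume s: "s \<le> Suc n" and "x \<in> rev0 ` {1..s}"
  then obtain y where "y \<in> {1..s}" "x = rev0 y" by blast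
  then show "x \<in> {n + 2 - s..Suc n}" using s unfolding rev0_def by auto
qed

text \<open>Along a reduced word the inversion set grows by exactly one new pair per letter and
  loses none, so each inversion is created at one well-defined place.\<close>

lemma card_Inv_prefix:
  assumes "red ws" "(i, k) \<in> Inv (perm ws)"
  shows "\<exists>!j. j < length ws \<and> perm (take j ws) (ws ! j) = i \<and> perm (take j ws) (Suc (ws ! j)) = k"
  using assms
proof (induction ws rule: rev_induct)
  case Nil
  then show ?case using Inv_id by (simp add: id_def)
next
  case (snoc s ws)
  have r: "red ws" using snoc.prems(1) by (rule red_appendD1)
  have ws: "ws \<in> W" "s \<in> {1..n}" using snoc.prems(1) by (auto simp: red_def)
  note I = Inv_swp_ascent[OF perm_permutes[OF ws(1)] ws(2) red_snoc_ascent[OF snoc.prems(1)]]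
  have pre: "(perm (take j ws) (ws ! j), perm (take j ws) (Suc (ws ! j))) \<in> Inv (perm ws)"
    if j: "j < length ws" for j
  proof -
    have sp: "ws = take (Suc j) ws @ drop (Suc j) ws" by simp
    have mono: "Inv (perm us) \<subseteq> Inv (perm (us @ vs))" if "red (us @ vs)" for us vs
      using that
    proof (induction vs rule: rev_induct)
      case (snoc v vs)
      have r': "red ((us @ vs) @ [v])" using snoc.prems by simp
      then have "us @ vs \<in> W" "v \<in> {1..n}" by (auto simp: red_def)
      then have "Inv (perm (us @ vs)) \<subseteq> Inv (perm (us @ vs) \<circ> swp v)"
        using Inv_swp_ascent[OF perm_permutes _ red_snoc_ascent[OF r']] by blast
      also have "Inv (perm (us @ vs) \<circ> swp v) = Inv (perm (us @ vs @ [v]))"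
        using perm_snoc[of "us @ vs" v] by (simp only: append_assoc)
      finally show ?case using snoc.IH[OF red_appendD1[OF r']] by blast
    qed simp
    have r1: "red (take j ws @ [ws ! j])"
    proof -
      have "red (take (Suc j) ws)"
        by (rule red_appendD1[of _ "drop (Suc j) ws"]) (simp only: append_take_drop_id r)
      then show ?thesis by (simp only: take_Suc_conv_app_nth[OF j])
    qed
    then have w1: "take j ws \<in> W" "ws ! j \<in> {1..n}" by (auto simp: red_def)
    have "(perm (take j ws) (ws ! j), perm (take j ws) (Suc (ws ! j))) \<in> Inv (perm (take j ws @ [ws ! j]))"
      unfolding perm_snoc Inv_swp_ascent(1)[OF perm_permutes[OF w1(1)] w1(2) red_snoc_ascent[OF r1]] by simp
    also have "take j ws @ [ws ! j] = take (Suc j) ws" using j by (simp add: take_Suc_conv_app_nth)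
    finally show ?thesis using mono[of "take (Suc j) ws" "drop (Suc j) ws"] r by auto
  qed
  have ik: "(i, k) \<in> insert (perm ws s, perm ws (Suc s)) (Inv (perm ws))"
    using snoc.prems(2) I(1) by (simp only: perm_snoc)
  show ?case
  proof (cases "(i, k) = (perm ws s, perm ws (Suc s))")
    case True
    show ?thesis
    proof (rule ex1I[of _ "length ws"])
      show "length ws < length (ws @ [s]) \<and> perm (take (length ws) (ws @ [s])) ((ws @ [s]) ! length ws) = i \<and>
        perm (take (length ws) (ws @ [s])) (Suc ((ws @ [s]) ! length ws)) = k" using True by simp
      fix j assume j: "j < length (ws @ [s]) \<and> perm (take j (ws @ [s])) ((ws @ [s]) ! j) = i \<and>
        perm (take j (ws @ [s])) (Suc ((ws @ [s]) ! j)) = k"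
      show "j = length ws"
      proof (rule ccontr)
        assume "j \<noteq> length ws"
        then have "j < length ws" using j by simp
        then have "(i, k) \<in> Inv (perm ws)" using pre[of j] j by (simp add: nth_append)
        then show False using I(2) True by simp
      qed
    qed
  next
    case False
    then have "(i, k) \<in> Inv (perm ws)" using ik by blast
    then obtain j where j: "j < length ws" "perm (take j ws) (ws ! j) = i" "perm (take j ws) (Suc (ws ! j)) = k"
      and u: "\<And>j'. j' < length ws \<Longrightarrow> perm (take j' ws) (ws ! j') = i \<Longrightarrow> perm (take j' ws) (Suc (ws ! j')) = k \<Longrightarrow> j' = j"
      using snoc.IH[OF r] by blast
    show ?thesis
    proof (rule ex1I[of _ j])
      show "j < length (ws @ [s]) \<and> perm (take j (ws @ [s])) ((ws @ [s]) ! j) = i \<and>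
        perm (take j (ws @ [s])) (Suc ((ws @ [s]) ! j)) = k" using j by (simp add: nth_append)
      fix j' assume j': "j' < length (ws @ [s]) \<and> perm (take j' (ws @ [s])) ((ws @ [s]) ! j') = i \<and>
        perm (take j' (ws @ [s])) (Suc ((ws @ [s]) ! j')) = k"
      have "j' \<noteq> length ws" using j' False by auto
      then have "j' < length ws" using j' by simp
      then show "j' = j" using j' u[of j'] by (simp add: nth_append)
    qed
  qed
qed

end

context coxeter_word
begin

definition Q :: "nat list" where
  "Q = cs @ q"

lemma Q_word_eq: "Q_word n cartan_A cs = Q"
  by (simp add: Q_word_def Q_def sorting_word_q)

lemma length_Q: "length Q = n + length q"
  by (simp add: Q_def length_cs)

lemma letter_range: "p \<in> {1..length Q} \<Longrightarrow> letter Q p \<in> {1..n}"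
proof -
  assume "p \<in> {1..length Q}"
  then have "letter Q p \<in> set Q" by (auto simp: letter_def)
  then show ?thesis using q_W set_cs by (auto simp: Q_def)
qed

lemma letter_q: "j < length q \<Longrightarrow> letter Q (n + 1 + j) = q ! j"
  by (simp add: letter_def Q_def nth_append length_cs)

lemma subword_before_sub: "subword_before Q I k = sub (letter Q) ({1..} - I) k"
proof -
  have "filter (\<lambda>x. x \<notin> I) [1..<k] = filter (\<lambda>x. x \<in> {1..} - I) [0..<k]"
  proof (cases "k = 0")
    case False
    then have "[0..<k] = 0 # [1..<k]" by (simp add: upt_conv_Cons)
    then show ?thesis by (auto intro!: filter_cong)
  qed simp
  then show ?thesis by (simp add: subword_before_def sub_def)
qed

lemma map_letter_upt: "k \<le> Suc (length Q) \<Longrightarrow> map (letter Q) [1..<k] = take (k - 1) Q"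
  by (rule nth_equalityI) (auto simp: letter_def)

lemma facets_iff: "I \<in> facets n cartan_A Q \<longleftrightarrow> I \<subseteq> {1..length Q} \<and> card I = n \<and>
    red (sub (letter Q) ({1..length Q} - I) (Suc (length Q))) \<and>
    perm (sub (letter Q) ({1..length Q} - I) (Suc (length Q))) = rev0"
proof -
  have "sub (letter Q) ({1..} - I) (Suc (length Q)) = sub (letter Q) ({1..length Q} - I) (Suc (length Q))"
    by (rule sub_cong) auto
  then show ?thesis
    unfolding facets_def mem_Collect_eq subword_before_sub red_w0_iff by simp
qed

lemma compl_bound: "{1..length Q} - I \<subseteq> {..<Suc (length Q)}"
  by auto

text \<open>A facet is produced by restricting the allowed positions to \<open>P\<close> and taking
  the complement of the greedy subword. Its partial products are then Demazure products of words
  that are known explicitly.\<close>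

lemma greedy_facet_aux:
  assumes P: "P \<subseteq> {1..length Q}" and demazure: "demazure (sub (letter Q) P (Suc (length Q))) = rev0"
  shows "{1..length Q} - greedy (letter Q) P \<in> facets n cartan_A Q"
    and "\<And>k. k \<le> Suc (length Q) \<Longrightarrow> subword_before Q ({1..length Q} - greedy (letter Q) P) k = sub (letter Q) (greedy (letter Q) P) k"
    and "card (greedy (letter Q) P) = card pairs"
proof -
  let ?greedy = "greedy (letter Q) P"
  have GP: "?greedy \<subseteq> {1..length Q}" using greedy_subset[of "letter Q" P] P by blast
  have r: "red (sub (letter Q) ?greedy (Suc (length Q)))" "perm (sub (letter Q) ?greedy (Suc (length Q))) = rev0"
  proof -
    have "letter Q p \<in> {1..n}" if "p \<in> P" for p using letter_range P that by blast
    then have "perm (sub (letter Q) ?greedy (Suc (length Q))) = demazure (sub (letter Q) P (Suc (length Q))) \<and>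
       red (sub (letter Q) ?greedy (Suc (length Q)))" by (rule greedy_red)
    then show "red (sub (letter Q) ?greedy (Suc (length Q)))" "perm (sub (letter Q) ?greedy (Suc (length Q))) = rev0"
      using demazure by simp_all
  qed
  have "?greedy \<subseteq> {..<Suc (length Q)}" using GP by auto
  then have c: "card ?greedy = length (sub (letter Q) ?greedy (Suc (length Q)))" by (simp add: length_sub)
  then show c': "card ?greedy = card pairs"
    using r Inv_rev0 by (simp add: red_def)
  have "card ({1..length Q} - ?greedy) = n"
    using card_Diff_subset[OF finite_subset[OF GP] GP] c' length_q length_Q by simp
  moreover have "{1..length Q} - ({1..length Q} - ?greedy) = ?greedy" using GP by blast
  ultimately show "{1..length Q} - ?greedy \<in> facets n cartan_A Q"
    unfolding facets_iff using r by auto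
  show "subword_before Q ({1..length Q} - ?greedy) k = sub (letter Q) ?greedy k" if "k \<le> Suc (length Q)" for k
    unfolding subword_before_sub using GP that by (intro sub_cong) auto
qed

lemma sub_K:
  assumes P: "P = {p\<in>{1..n}. letter Q p \<in> K} \<union> {n+1..length Q}" and j: "j \<le> length q"
  shows "sub (letter Q) P (n + 1 + j) = filter (\<lambda>s. s \<in> K) cs @ take j q"
proof -
  have sp: "[0..<n + 1 + j] = [0..<1] @ [1..<n + 1] @ [n + 1..<n + 1 + j]"
    using upt_add_eq_append[of 0 "n+1" j] upt_add_eq_append[of 0 1 n] by simp
  have a: "filter (\<lambda>x. x \<in> P) [0..<1] = []" by (simp add: P)
  have b: "map (letter Q) (filter (\<lambda>x. x \<in> P) [1..<n + 1]) = filter (\<lambda>s. s \<in> K) (map (letter Q) [1..<n + 1])"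
    unfolding filter_map by (intro arg_cong[of _ _ "map (letter Q)"] filter_cong) (auto simp: P)
  have c: "map (letter Q) [1..<n + 1] = cs"
    using map_letter_upt[of "n + 1"] by (simp add: length_Q Q_def length_cs)
  have d: "filter (\<lambda>x. x \<in> P) [n + 1..<n + 1 + j] = [n + 1..<n + 1 + j]"
    using j by (auto simp: filter_id_conv P length_Q)
  have e: "map (letter Q) [n + 1..<n + 1 + j] = take j q"
    using j letter_q by (intro nth_equalityI) (auto simp del: upt_Suc)
  show ?thesis
    unfolding sub_def sp filter_append map_append a b c d e by simp
qed

text \<open>The part \<open>q\<close> alone already sends each {1..s} to a final segment, which the
  letters kept from the initial copy of c cannot move any further.\<close>

lemma demazure_K:
  assumes "P = {p\<in>{1..n}. letter Q p \<in> K} \<union> {n+1..length Q}"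
  shows "demazure (sub (letter Q) P (Suc (length Q))) = rev0"
proof -
  let ?w = "filter (\<lambda>s. s \<in> K) cs @ q"
  have w: "sub (letter Q) P (Suc (length Q)) = ?w"
    using sub_K[OF assms, of "length q"] by (simp add: length_Q)
  have wW: "?w \<in> W" using q_W set_cs by auto
  note p = demazure_permutes[OF wW]
  have img: "demazure ?w ` {1..s} = rev0 ` {1..s}" if s: "s \<in> {1..n}" for s
  proof -
    have "0 \<notin> set ?w" using wW by auto
    then have "demazure ?w ` {1..s} = foldr push (filter (\<lambda>s. s \<in> K) cs) (foldr push q {1..s})"
      using demazure_image_push[of ?w s] by simp
    also have "foldr push q {1..s} = rev0 ` {1..s}"
      using red_perm_push[OF q_red, of s] perm_q by simp
    also have "foldr push (filter (\<lambda>s. s \<in> K) cs) (rev0 ` {1..s}) = rev0 ` {1..s}"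
    proof (rule foldr_push_top)
      have "rev0 ` {1..s} = {n + 2 - s..Suc n}" using s by (intro rev0_image) auto
      then show "top_set (rev0 ` {1..s})" using s unfolding top_set_def by (intro exI[of _ "n + 2 - s"]) auto
      show "filter (\<lambda>s. s \<in> K) cs \<in> W" using wW by (simp only: append_in_lists_conv)
    qed
    finally show ?thesis .
  qed
  have "demazure ?w = rev0"
  proof (rule descending_rev0[OF p])
    fix s assume s: "s \<in> {1..n}"
    have r: "rev0 ` {1..s} = {n + 2 - s..Suc n}" using s by (intro rev0_image) auto
    have "demazure ?w s \<in> rev0 ` {1..s}" unfolding img[OF s, symmetric] using s by auto
    then have 1: "n + 2 - s \<le> demazure ?w s" using r by auto
    have 2: "demazure ?w (Suc s) \<notin> rev0 ` {1..s}"
      unfolding img[OF s, symmetric] using permutes_inj[OF p] by (force simp: inj_eq)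
    have "demazure ?w (Suc s) < n + 2 - s"
    proof (rule ccontr)
      assume a: "\<not> demazure ?w (Suc s) < n + 2 - s"
      have "1 \<le> demazure ?w (Suc s) \<and> demazure ?w (Suc s) \<le> Suc n" using permutes_range[OF p, of "Suc s"] s by auto
      then show False using 2 a r by auto
    qed
    then show "demazure ?w (Suc s) < demazure ?w s" using 1 by simp
  qed
  then show ?thesis using w by simp
qed

lemma finite_facet: "I \<in> facets n cartan_A Q \<Longrightarrow> finite I"
  unfolding facets_iff by (meson finite_atLeastAtMost finite_subset)

text \<open>No n-subset of the positions precedes {1..n}, and deleting {1..n} leaves exactly the
  sorting word.\<close>

lemma greedy_facet_eq: "greedy_facet n cartan_A Q = {1..n}"
  unfolding greedy_facet_def
proof (rule lex_first_eqI)
  have "{1..length Q} - {1..n} = {n+1..length Q}" by auto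
  moreover have "sub (letter Q) {n+1..length Q} (Suc (length Q)) = q"
    using sub_K[of "{n+1..length Q}" "{}" "length q"] by (simp add: length_Q)
  ultimately show "{1..n} \<in> facets n cartan_A Q"
    unfolding facets_iff using q_red perm_q length_Q by auto
next
  fix J assume J: "J \<in> facets n cartan_A Q"
  then have cJ: "card J = n" "J \<subseteq> {1..length Q}" by (auto simp: facets_iff)
  show "lex_le {1..n} J"
  proof (cases "{1..n} \<subseteq> J")
    case True
    then have "{1..n} = J" using cJ finite_facet[OF J] by (metis card_atLeastAtMost card_subset_eq diff_Suc_1)
    then show ?thesis by (simp add: lex_le_def)
  next
    case False
    define p where "p = (LEAST p. p \<in> {1..n} \<and> p \<notin> J)"
    have p: "p \<in> {1..n} \<and> p \<notin> J" unfolding p_def by (rule LeastI_ex) (use False in blast)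
    have low: "x \<in> {1..n} \<longleftrightarrow> x \<in> J" if "x < p" for x
    proof -
      have "\<not> (x \<in> {1..n} \<and> x \<notin> J)" using that not_less_Least unfolding p_def by blast
      then show ?thesis using p that cJ by auto
    qed
    show ?thesis
      using p low cJ finite_facet[OF J] by (intro lex_le_first_diff[of _ _ p]) auto
  qed
qed

lemma all_K: "{1..length Q} = {p\<in>{1..n}. letter Q p \<in> UNIV} \<union> {n+1..length Q}"
  by (auto simp: length_Q)

text \<open>Passing to complements reverses the order: where a facet word first differs from the
  greedy one it skips the letter, so its facet contains that position and comes earlier.\<close>

lemma antigreedy_facet_eq: "antigreedy_facet n cartan_A Q = {1..length Q} - greedy (letter Q) {1..length Q}"
  unfolding antigreedy_facet_def
proof (rule lex_last_eqI)
  let ?greedy = "greedy (letter Q) {1..length Q}"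
  note aux = greedy_facet_aux[OF subset_refl demazure_K[OF all_K]]
  show "{1..length Q} - ?greedy \<in> facets n cartan_A Q" by (rule aux(1))
  fix I assume I: "I \<in> facets n cartan_A Q"
  then have cI: "card I = n" "I \<subseteq> {1..length Q}"
    and r: "red (sub (letter Q) ({1..length Q} - I) (Suc (length Q)))" by (auto simp: facets_iff)
  have GQ: "?greedy \<subseteq> {1..length Q}" by (rule greedy_subset)
  show "lex_le I ({1..length Q} - ?greedy)"
  proof (cases "{1..length Q} - I = ?greedy")
    case True
    then have "I = {1..length Q} - ?greedy" using cI by blast
    then show ?thesis by (simp add: lex_le_def)
  next
    case False
    have "card ({1..length Q} - I) = card ?greedy"
      using card_Diff_subset[of I "{1..length Q}"] finite_facet[OF I] cI length_Q length_q aux(3) by simp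
    then obtain p where p: "p \<in> ?greedy" "p \<notin> {1..length Q} - I"
      "\<And>x. x < p \<Longrightarrow> x \<in> ?greedy \<longleftrightarrow> x \<in> {1..length Q} - I"
      using greedy_lex_first[OF letter_range Diff_subset compl_bound r _ _ False] finite_subset[OF GQ] by auto
    have c: "card ({1..length Q} - ?greedy) = n" using aux(1) by (simp add: facets_iff)
    show ?thesis
    proof (rule lex_le_first_diff[of _ _ p])
      show "p \<in> I" "p \<notin> {1..length Q} - ?greedy" using p GQ by auto
      show "x \<in> I \<longleftrightarrow> x \<in> {1..length Q} - ?greedy" if "x < p" for x using p(3)[OF that] GQ cI by blast
    qed (use finite_facet[OF I] c cI in auto)
  qed
qed

definition closed_set :: "nat \<Rightarrow> nat \<Rightarrow> nat set \<Rightarrow> bool" where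
  "closed_set i k S \<longleftrightarrow> S \<subseteq> {i..<k} \<and>
     (\<forall>p. i < p \<longrightarrow> p < k \<longrightarrow> (if lower p then p \<in> S \<longrightarrow> p - 1 \<in> S else p - 1 \<in> S \<longrightarrow> p \<in> S))"

lemma facet_in_W: "I \<in> facets n cartan_A Q \<Longrightarrow> k \<le> Suc (length Q) \<Longrightarrow> subword_before Q I k \<in> W"
  unfolding subword_before_def using letter_range by auto

lemma weight_wt:
  assumes "I \<in> facets n cartan_A Q" "j < length q"
  shows "weight_function n cartan_A Q I (n + 1 + j) =
     wt (perm (subword_before Q I (n + 1 + j)) ` {1..q ! j})"
proof -
  have s: "q ! j \<in> {1..n}" using sorting_prefix(3)[OF assms(2)] .
  have k: "n + 1 + j \<le> Suc (length Q)" using assms(2) by (simp add: length_Q)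
  have "{1..q ! j} \<subseteq> {1..Suc n}" using s by auto
  then show ?thesis
    unfolding weight_function_def letter_q[OF assms(2)] fundamental_weight_wt[OF s]
    by (rule wprod_wt[OF facet_in_W[OF assms(1) k]])
qed

lemma root_function_greedy:
  assumes "j < length q"
  shows "root_function n cartan_A Q {1..n} (n + 1 + j) =
     eps (perm (take j q) (q ! j)) - eps (perm (take j q) (Suc (q ! j)))"
proof -
  have "subword_before Q {1..n} (n + 1 + j) = sub (letter Q) {n+1..length Q} (n + 1 + j)"
    unfolding subword_before_sub using assms by (intro sub_cong) (auto simp: length_Q)
  also have "\<dots> = take j q" using sub_K[of "{n+1..length Q}" "{}" j] assms by simp
  finally have sb: "subword_before Q {1..n} (n + 1 + j) = take j q" .
  have W': "take j q \<in> W" using q_W by (auto dest: in_set_takeD)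
  show ?thesis
    unfolding root_function_def sb letter_q[OF assms]
    using sorting_prefix(3)[OF assms] W'
    by (simp add: simple_root_eps linear_diff[OF linear_word_prod] wprod_eps)
qed

text \<open>The roots of the greedy facet along the sorting word are the inversions of the longest
  element in the order of their creation. Every positive root is such an inversion and is created
  once.\<close>

lemma root_index_unique:
  assumes "(i, k) \<in> pairs"
  shows "\<exists>!\<kappa>. root_index n cartan_A Q (eps i - eps k) \<kappa>"
    and "root_index n cartan_A Q (eps i - eps k) \<kappa> \<Longrightarrow>
      \<exists>j<length q. \<kappa> = n + 1 + j \<and> perm (take j q) (q ! j) = i \<and> perm (take j q) (Suc (q ! j)) = k"
proof -
  have eq: "root_index n cartan_A Q (eps i - eps k) (n + 1 + j) \<longleftrightarrow>
     perm (take j q) (q ! j) = i \<and> perm (take j q) (Suc (q ! j)) = k" if j: "j < length q" for j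
  proof -
    let ?a = "perm (take j q)"
    have W': "take j q \<in> W" using q_W by (auto dest: in_set_takeD)
    have lt: "?a (q ! j) < ?a (Suc (q ! j))" by (rule sorting_prefix(2)[OF j])
    have "q ! j \<in> {1..n}" by (rule sorting_prefix(3)[OF j])
    then have "?a (q ! j) \<in> {1..Suc n}" "?a (Suc (q ! j)) \<in> {1..Suc n}"
      using perm_in_range[OF W', of "q ! j"] perm_in_range[OF W', of "Suc (q ! j)"] by auto
    then have pr: "(?a (q ! j), ?a (Suc (q ! j))) \<in> pairs" using lt by (auto simp: pairs_def)
    have "root_index n cartan_A Q (eps i - eps k) (n + 1 + j) \<longleftrightarrow>
      eps (?a (q ! j)) - eps (?a (Suc (q ! j))) = eps i - eps k"
      unfolding root_index_def greedy_facet_eq root_function_greedy[OF j] card_positive_roots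
      using j length_q by auto
    also have "\<dots> \<longleftrightarrow> (?a (q ! j), ?a (Suc (q ! j))) = (i, k)"
      using inj_on_eq_iff[OF inj_on_pairs pr assms] by simp
    finally show ?thesis by simp
  qed
  have form: "\<exists>j<length q. \<kappa> = n + 1 + j" if "root_index n cartan_A Q (eps i - eps k) \<kappa>" for \<kappa>
    using that unfolding root_index_def card_positive_roots length_q[symmetric]
    by (intro exI[of _ "\<kappa> - (n + 1)"]) auto
  have "(i, k) \<in> Inv (perm q)" using assms Inv_rev0 perm_q by simp
  from card_Inv_prefix[OF q_red this] obtain j where
    j: "j < length q" "perm (take j q) (q ! j) = i" "perm (take j q) (Suc (q ! j)) = k"
    and u: "\<And>j'. j' < length q \<Longrightarrow> perm (take j' q) (q ! j') = i \<Longrightarrow> perm (take j' q) (Suc (q ! j')) = k \<Longrightarrow> j' = j"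
    by blast
  show "\<exists>!\<kappa>. root_index n cartan_A Q (eps i - eps k) \<kappa>"
  proof (rule ex1I[of _ "n + 1 + j"])
    show "root_index n cartan_A Q (eps i - eps k) (n + 1 + j)" using eq[OF j(1)] j by blast
    fix \<kappa> assume r: "root_index n cartan_A Q (eps i - eps k) \<kappa>"
    then obtain j' where j': "j' < length q" "\<kappa> = n + 1 + j'" using form by blast
    then have "j' = j" using eq[OF j'(1)] r u by blast
    then show "\<kappa> = n + 1 + j" using j' by simp
  qed
  show "\<exists>j<length q. \<kappa> = n + 1 + j \<and> perm (take j q) (q ! j) = i \<and> perm (take j q) (Suc (q ! j)) = k"
    if "root_index n cartan_A Q (eps i - eps k) \<kappa>"
    using form[OF that] eq that by blast
qed

section \<open>Weights of all facets at one position of the sorting word\<close>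

context
  fixes j i k :: nat and a :: "nat \<Rightarrow> nat" and s :: nat and A :: "nat set"
  assumes j: "j < length q"
    and a: "a = perm (take j q)" and s: "s = q ! j" and A: "A = a ` {1..s}"
    and i: "i = a s" and k: "k = a (Suc s)"
begin

lemma diag: "diag_set A i k"
  using sorting_prefix(1)[OF j] unfolding A a s i k .

lemma ik: "1 \<le> i" "i < k" "k \<le> Suc n" "A \<subseteq> {1..Suc n}"
  using diag by (auto simp: diag_set_def)

lemma s_range: "s \<in> {1..n}"
  using sorting_prefix(3)[OF j] unfolding s .

lemma take_q_red: "red (take j q)" and take_q_W: "take j q \<in> W"
proof -
  show "red (take j q)"
    by (rule red_appendD1[of _ "drop j q"]) (simp only: append_take_drop_id q_red)
  then show "take j q \<in> W" by (simp add: red_def)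
qed

lemma card_A: "card A = s"
  unfolding A a using perm_permutes[OF take_q_W] by (simp add: card_image permutes_inj_on)

lemma A_push: "A = foldr push (take j q) {1..s}"
  unfolding A a by (rule red_perm_push[OF take_q_red])

text \<open>In the initial copy of c only the letters of \<open>K\<close> are allowed. Whichever of
  them the greedy subword takes, the partial product is the Demazure product, so all of them may be
  pushed.\<close>

lemma greedy_weight:
  assumes P: "P = {p\<in>{1..n}. letter Q p \<in> K} \<union> {n+1..length Q}"
  defines "I \<equiv> {1..length Q} - greedy (letter Q) P"
  shows "I \<in> facets n cartan_A Q"
    and "perm (subword_before Q I (n + 1 + j)) ` {1..s} = foldr push (filter (\<lambda>s. s \<in> K) cs) A"
proof -
  have PQ: "P \<subseteq> {1..length Q}" unfolding P by (auto simp: length_Q)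
  note aux = greedy_facet_aux[OF PQ demazure_K[OF P], folded I_def]
  show "I \<in> facets n cartan_A Q" by (rule aux(1))
  have b: "n + 1 + j \<le> Suc (length Q)" using j by (simp add: length_Q)
  have lr: "letter Q p \<in> {1..n}" if "p \<in> P" for p using letter_range PQ that by blast
  have "perm (subword_before Q I (n + 1 + j)) = demazure (sub (letter Q) P (n + 1 + j))"
  proof -
    have "perm (sub (letter Q) (greedy (letter Q) P) (n + 1 + j)) = demazure (sub (letter Q) P (n + 1 + j)) \<and>
        red (sub (letter Q) (greedy (letter Q) P) (n + 1 + j))"
      by (rule greedy_red) (rule lr)
    then show ?thesis unfolding aux(2)[OF b] by (rule conjunct1)
  qed
  also have "sub (letter Q) P (n + 1 + j) = filter (\<lambda>s. s \<in> K) cs @ take j q"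
    using j by (intro sub_K[OF P]) simp
  finally have "perm (subword_before Q I (n + 1 + j)) ` {1..s} =
     demazure (filter (\<lambda>s. s \<in> K) cs @ take j q) ` {1..s}" by simp
  also have "\<dots> = foldr push (filter (\<lambda>s. s \<in> K) cs @ take j q) {1..s}"
  proof -
    have "filter (\<lambda>s. s \<in> K) cs @ take j q \<in> W" using take_q_W set_cs by auto
    then have "0 \<notin> set (filter (\<lambda>s. s \<in> K) cs @ take j q)" by auto
    then show ?thesis using demazure_image_push by blast
  qed
  also have "\<dots> = foldr push (filter (\<lambda>s. s \<in> K) cs) A"
    by (simp add: A_push)
  finally show "perm (subword_before Q I (n + 1 + j)) ` {1..s} = foldr push (filter (\<lambda>s. s \<in> K) cs) A" .
qed

lemma facet_set:
  assumes "I \<in> facets n cartan_A Q"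
  defines "U \<equiv> perm (subword_before Q I (n + 1 + j)) ` {1..s}"
  shows "U \<subseteq> {1..Suc n}" "card U = s" "weight_function n cartan_A Q I (n + 1 + j) = wt U"
proof -
  have b: "n + 1 + j \<le> Suc (length Q)" using j by (simp add: length_Q)
  note W' = facet_in_W[OF assms(1) b]
  show "card U = s"
    unfolding U_def using perm_permutes[OF W'] by (simp add: card_image permutes_inj_on)
  show "U \<subseteq> {1..Suc n}"
  proof
    fix x assume "x \<in> U"
    then obtain y where "y \<in> {1..s}" "x = perm (subword_before Q I (n + 1 + j)) y" by (auto simp: U_def)
    then show "x \<in> {1..Suc n}" using perm_in_range[OF W', of y] s_range by auto
  qed
  show "weight_function n cartan_A Q I (n + 1 + j) = wt U"
    unfolding U_def s by (rule weight_wt[OF assms(1) j])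
qed

text \<open>The lower bound holds because the facet word up to this position is a subword of c
  followed by \<open>take j q\<close>. For the upper bound the same argument is applied to the rest
  of the word, read backwards, and turned around by \<open>rev0\<close>.\<close>

lemma facet_bounds:
  assumes I: "I \<in> facets n cartan_A Q"
  defines "U \<equiv> perm (subword_before Q I (n + 1 + j)) ` {1..s}"
  shows "cnt (insert k (A - {i})) t \<le> cnt U t" "t \<le> Suc n \<Longrightarrow> cnt U t \<le> cnt A t"
proof -
  let ?L = "length Q" and ?f = "letter Q" and ?P = "\<lambda>x. x \<notin> I"
  have b: "n + 1 + j \<le> Suc ?L" using j by (simp add: length_Q)
  have pos: "1 \<le> ?f x" if "x \<in> set [l..<h]" "1 \<le> l" "h \<le> Suc ?L" for x l h
    using letter_range[of x] that by auto
  have "cnt (foldr push (map ?f [1..<n + 1 + j]) {1..s}) t \<le> cnt U t"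
    unfolding U_def subword_before_def by (rule cnt_subword, rule pos[of _ 1]) (use b in auto)
  also have "map ?f [1..<n + 1 + j] = cs @ take j q"
    using map_letter_upt[OF b] by (simp add: Q_def length_cs)
  also have "foldr push (cs @ take j q) {1..s} = insert k (A - {i})"
    using diag_set_step[OF diag] by (simp add: A_push)
  finally show "cnt (insert k (A - {i})) t \<le> cnt U t" .
  assume t: "t \<le> Suc n"
  \<comment> \<open>The whole facet word multiplies to \<open>rev0\<close>, so its initial part is
    \<open>rev0\<close> times the inverse of \<open>rest\<close>; reversing a word inverts its
    product. Without deletions the remaining word would be \<open>drop j q\<close>, to which the
    same formula applies.\<close>
  define rest where "rest = map ?f (filter ?P [n + 1 + j..<Suc ?L])"
  have full: "subword_before Q I (Suc ?L) = subword_before Q I (n + 1 + j) @ rest"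
  proof -
    have "[1..<Suc ?L] = [1..<n + 1 + j] @ [n + 1 + j..<Suc ?L]"
      using upt_add_eq_append[of 1 "n + 1 + j" "Suc ?L - (n + 1 + j)"] b by simp
    then show ?thesis unfolding subword_before_def rest_def by (simp only: filter_append map_append)
  qed
  have "perm (subword_before Q I (Suc ?L)) = rev0"
    using I unfolding facets_def mem_Collect_eq red_w0_iff by (simp only: Suc_eq_plus1)
  then have uv: "perm (subword_before Q I (n + 1 + j)) \<circ> perm rest = rev0"
    unfolding full perm_append .
  have "perm (subword_before Q I (n + 1 + j)) = perm (subword_before Q I (n + 1 + j)) \<circ> (perm rest \<circ> perm (rev rest))"
    by (simp only: perm_rev' o_id)
  also have "\<dots> = rev0 \<circ> perm (rev rest)" by (simp only: comp_assoc[symmetric] uv)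
  finally have U: "U = rev0 ` (perm (rev rest) ` {1..s})"
    unfolding U_def by (simp only: image_comp)
  let ?d = "drop j q"
  have "perm (take j q) \<circ> perm ?d = rev0"
    by (simp only: perm_append[symmetric] append_take_drop_id perm_q)
  then have "a = rev0 \<circ> perm (rev ?d)"
    unfolding a by (metis comp_assoc o_id perm_rev')
  then have A': "A = rev0 ` (perm (rev ?d) ` {1..s})"
    unfolding A by (simp only: image_comp)
  have "map ?f [n + 1 + j..<Suc ?L] = ?d"
  proof (rule nth_equalityI)
    show "map ?f [n + 1 + j..<Suc ?L] ! l = ?d ! l" if "l < length (map ?f [n + 1 + j..<Suc ?L])" for l
      using that letter_q[of "j + l"] by (simp add: length_Q add.assoc del: upt_Suc)
  qed (simp add: length_Q del: upt_Suc)
  then have revd: "map ?f (rev [n + 1 + j..<Suc ?L]) = rev ?d" by (simp only: rev_map[symmetric])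
  have "cnt (foldr push (map ?f (rev [n + 1 + j..<Suc ?L])) {1..s}) (Suc n - t) \<le>
     cnt (perm (map ?f (filter ?P (rev [n + 1 + j..<Suc ?L]))) ` {1..s}) (Suc n - t)"
    by (rule cnt_subword, rule pos[of _ "n + 1 + j" "Suc ?L"]) (auto simp del: upt_Suc)
  also have "map ?f (filter ?P (rev [n + 1 + j..<Suc ?L])) = rev rest"
    unfolding rest_def by (simp only: rev_map rev_filter)
  finally have "cnt (foldr push (rev ?d) {1..s}) (Suc n - t) \<le> cnt (perm (rev rest) ` {1..s}) (Suc n - t)"
    unfolding revd .
  moreover have "foldr push (rev ?d) {1..s} = perm (rev ?d) ` {1..s}"
  proof -
    have "red ?d" by (rule red_appendD2[of "take j q"]) (simp only: append_take_drop_id q_red)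
    then show ?thesis using red_perm_push[OF red_rev] by simp
  qed
  ultimately have le: "cnt (perm (rev ?d) ` {1..s}) (Suc n - t) \<le> cnt (perm (rev rest) ` {1..s}) (Suc n - t)"
    by simp
  have X: "perm ws ` {1..s} \<subseteq> {1..Suc n}" "card (perm ws ` {1..s}) = s" if "ws \<in> W" for ws
  proof -
    show "card (perm ws ` {1..s}) = s"
      using perm_permutes[OF that] by (simp add: card_image permutes_inj_on)
    show "perm ws ` {1..s} \<subseteq> {1..Suc n}"
    proof
      fix x assume "x \<in> perm ws ` {1..s}"
      then obtain y where "y \<in> {1..s}" "x = perm ws y" by blast
      then show "x \<in> {1..Suc n}" using perm_in_range[OF that, of y] s_range by auto
    qed
  qed
  have w1: "rev ?d \<in> W" using q_W set_drop_subset[of j q] by (auto simp: in_lists_conv_set)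
  have w2: "rev rest \<in> W" unfolding rest_def using letter_range by (auto simp del: upt_Suc)
  have "cnt U t + cnt (perm (rev rest) ` {1..s}) (Suc n - t) = s"
    unfolding U using cnt_rev0[OF X(1)[OF w2] t] X(2)[OF w2] by simp
  moreover have "cnt A t + cnt (perm (rev ?d) ` {1..s}) (Suc n - t) = s"
    unfolding A' using cnt_rev0[OF X(1)[OF w1] t] X(2)[OF w1] by simp
  ultimately show "cnt U t \<le> cnt A t" using le by linarith
qed

text \<open>The two bounds of \<open>facet_bounds\<close> differ by 1 on {i..<k} and agree
  elsewhere. Hence a facet amounts to a choice between them at each point of this interval.\<close>

lemma cnt_step: "int (cnt (insert k (A - {i})) t) = int (cnt A t) - of_bool (t \<in> {i..<k})"
proof (rule cnt_of_bool)
  show "0 \<notin> {i..<k}" using ik by auto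
  fix x
  have "i \<in> A" "k \<notin> A" using diag by (auto simp: diag_set_def)
  then show "of_bool (x \<in> insert k (A - {i})) =
    (of_bool (x \<in> A) - of_bool (x \<in> {i..<k}) + of_bool (x - 1 \<in> {i..<k}) :: int)"
    using ik by (cases "x = i"; cases "x = k") (auto split: if_splits)
qed

lemma antigreedy_weight:
  "antigreedy_facet n cartan_A Q \<in> facets n cartan_A Q"
  "weight_function n cartan_A Q (antigreedy_facet n cartan_A Q) (n + 1 + j) = wt (insert k (A - {i}))"
proof -
  note g = greedy_weight[OF all_K, folded antigreedy_facet_eq]
  show "antigreedy_facet n cartan_A Q \<in> facets n cartan_A Q" by (rule g(1))
  show "weight_function n cartan_A Q (antigreedy_facet n cartan_A Q) (n + 1 + j) = wt (insert k (A - {i}))"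
    unfolding facet_set(3)[OF g(1)] g(2) using diag_set_step[OF diag] by simp
qed

lemma card_step: "card (insert k (A - {i})) = s" "finite A"
proof -
  show fin: "finite A" using ik(4) finite_subset by blast
  have "i \<in> A" "k \<notin> A" using diag by (auto simp: diag_set_def)
  then show "card (insert k (A - {i})) = s" using card_A fin
    by (metis DiffD1 card_Suc_Diff1 card_insert_disjoint finite_Diff)
qed

text \<open>\<open>S\<close> consists of the points where the count of U attains the upper bound.
  The counts grow by 0 or 1 at each point. At a lower p the count of A grows by 1, so equality at p
  forces equality at p - 1; at other p it does not grow, so equality passes from p - 1 to p.\<close>

lemma facet_closed_set:
  assumes I: "I \<in> facets n cartan_A Q"
  shows "\<exists>S. closed_set i k S \<and>
     weight_function n cartan_A Q I (n + 1 + j) - wt (insert k (A - {i})) = (\<Sum>t\<in>S. simple_root t)"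
proof -
  define U where "U = perm (subword_before Q I (n + 1 + j)) ` {1..s}"
  note U = facet_set[OF I, folded U_def] and B = facet_bounds[OF I, folded U_def]
  have finU: "finite U" using U(1) finite_subset by blast
  define S where "S = {t\<in>{i..<k}. cnt U t = cnt A t}"
  have SA: "int (cnt U t) - int (cnt (insert k (A - {i})) t) = of_bool (t \<in> S)" if "t \<in> {1..n}" for t
    using cnt_step[of t] B(1)[of t] B(2)[of t] that unfolding S_def by (auto split: if_splits)
  have mid: "p \<in> A \<longleftrightarrow> lower p" if "i < p" "p < k" for p using diag that by (auto simp: diag_set_def)
  have "closed_set i k S"
    unfolding closed_set_def
  proof (intro conjI allI impI)
    show "S \<subseteq> {i..<k}" by (auto simp: S_def)
    fix p assume p: "i < p" "p < k"
    have pU: "cnt U p = cnt U (p - 1) + of_bool (p \<in> U)" and pA: "cnt A p = cnt A (p - 1) + of_bool (p \<in> A)"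
      using p by (intro cnt_pred; simp)+
    have le: "cnt U p \<le> cnt A p" "cnt U (p - 1) \<le> cnt A (p - 1)"
      using B(2)[of p] B(2)[of "p - 1"] p ik by auto
    show "if lower p then p \<in> S \<longrightarrow> p - 1 \<in> S else p - 1 \<in> S \<longrightarrow> p \<in> S"
      using pU pA le mid[OF p] p unfolding S_def by (auto split: if_splits)
  qed
  moreover have "wt U - wt (insert k (A - {i})) = (\<Sum>t\<in>S. simple_root t)"
  proof (rule poly_mapping_eqI)
    fix t
    have finS: "finite S" and S1: "S \<subseteq> {1..n}" using ik by (auto simp: S_def)
    have "Poly_Mapping.lookup (\<Sum>t\<in>S. simple_root t) t = of_bool (t \<in> S)"
      using lookup_sum_simple_root[OF finS, of "\<lambda>_. 1" t] by simp
    moreover have "Poly_Mapping.lookup (wt U - wt (insert k (A - {i}))) t = of_bool (t \<in> S)"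
    proof (cases "t \<in> {1..n}")
      case True
      have "real (cnt U t) - real (cnt (insert k (A - {i})) t) = of_bool (t \<in> S)"
        using SA[OF True] by (metis of_int_diff of_int_of_bool of_int_of_nat_eq)
      then show ?thesis
        using lookup_wt_diff[OF finU, of "insert k (A - {i})" t] card_step U(2) True by simp
    next
      case False
      then have "t \<notin> S" using S1 by blast
      then show ?thesis
        using lookup_wt_diff[OF finU, of "insert k (A - {i})" t] card_step U(2) False by auto
    qed
    ultimately show "Poly_Mapping.lookup (wt U - wt (insert k (A - {i}))) t = Poly_Mapping.lookup (\<Sum>t\<in>S. simple_root t) t"
      by simp
  qed
  ultimately show ?thesis unfolding U(3) by blast
qed

text \<open>Only the letters of D, the complement of S in {i..<k}, are allowed in the initial copy
  of c. Closedness of S is exactly what \<open>foldr_push_effective\<close> needs for every letter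
  of D to act, and each lowers the count of A by 1 at one point.\<close>

lemma closed_set_facet:
  assumes S: "closed_set i k S"
  shows "\<exists>I\<in>facets n cartan_A Q.
     weight_function n cartan_A Q I (n + 1 + j) - wt (insert k (A - {i})) = (\<Sum>t\<in>S. simple_root t)"
proof -
  define D where "D = {i..<k} - S"
  have SD: "S \<subseteq> {i..<k}" "D \<subseteq> {1..n}" using S ik by (auto simp: closed_set_def D_def)
  have cl: "p \<in> S \<Longrightarrow> p - 1 \<in> S" if "i < p" "p < k" "lower p" for p
    using S that by (auto simp: closed_set_def)
  have cu: "p - 1 \<in> S \<Longrightarrow> p \<in> S" if "i < p" "p < k" "\<not> lower p" for p
    using S that by (auto simp: closed_set_def)
  have mid: "p \<in> A \<longleftrightarrow> lower p" if "i < p" "p < k" for p using diag that by (auto simp: diag_set_def)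
  have iA: "i \<in> A" "k \<notin> A" using diag by (auto simp: diag_set_def)
  define V where "V = foldr push (filter (\<lambda>s. s \<in> D) cs) A"
  have V: "of_bool (x \<in> V) = (of_bool (x \<in> A) - of_bool (x \<in> D) + of_bool (x - 1 \<in> D) :: int)" for x
    unfolding V_def
  proof (rule foldr_push_effective)
    fix t assume t: "t \<in> D"
    then have tk: "i \<le> t" "t < k" "t \<notin> S" by (auto simp: D_def)
    have "t \<in> A \<longleftrightarrow> \<not> (t - 1 \<in> D \<and> before t (t - 1))"
    proof (cases "t = i")
      case True
      then show ?thesis using iA ik by (auto simp: D_def)
    next
      case False
      then have "before t (t - 1) \<longleftrightarrow> \<not> lower t" using tk ik by (intro before_down) auto
      moreover have "t - 1 \<in> D" if "\<not> lower t" using cu[of t] that tk False by (auto simp: D_def)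
      ultimately show ?thesis using mid[of t] tk False by auto
    qed
    moreover have "Suc t \<in> A \<longleftrightarrow> Suc t \<in> D \<and> before t (Suc t)"
    proof (cases "Suc t = k")
      case True
      then show ?thesis using iA by (auto simp: D_def)
    next
      case False
      then have "before t (Suc t) \<longleftrightarrow> lower (Suc t)" using tk ik by (intro before_up) auto
      moreover have "Suc t \<in> D" if "lower (Suc t)" using cl[of "Suc t"] that tk False by (auto simp: D_def)
      ultimately show ?thesis using mid[of "Suc t"] tk False by auto
    qed
    ultimately show "(t \<in> A \<longleftrightarrow> \<not> (t - 1 \<in> D \<and> before t (t - 1))) \<and>
                (Suc t \<in> A \<longleftrightarrow> Suc t \<in> D \<and> before t (Suc t))" by blast
  qed (use SD in auto)
  have D0: "0 \<notin> D" using SD by auto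
  have cV: "int (cnt V t) = int (cnt A t) - of_bool (t \<in> D)" for t
    by (rule cnt_of_bool[OF V D0])
  note g = greedy_weight[OF refl, of D]
  have finV: "finite V" "card V = s"
    using facet_set[OF g(1)] finite_subset unfolding g(2) V_def[symmetric] by blast+
  have "wt V - wt (insert k (A - {i})) = (\<Sum>t\<in>S. simple_root t)"
  proof (rule poly_mapping_eqI)
    fix t
    have finS: "finite S" and S1: "S \<subseteq> {1..n}" using SD(1) finite_subset[OF SD(1)] ik by auto
    have 1: "Poly_Mapping.lookup (\<Sum>t\<in>S. simple_root t) t = of_bool (t \<in> S)"
      using lookup_sum_simple_root[OF finS, of "\<lambda>_. 1" t] by simp
    have "int (cnt V t) - int (cnt (insert k (A - {i})) t) = of_bool (t \<in> S)"
      using cV[of t] cnt_step[of t] SD(1) unfolding D_def by auto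
    then have "real (cnt V t) - real (cnt (insert k (A - {i})) t) = of_bool (t \<in> S)"
      by (metis of_int_diff of_int_of_bool of_int_of_nat_eq)
    then have "Poly_Mapping.lookup (wt V - wt (insert k (A - {i}))) t = of_bool (t \<in> S)"
      using lookup_wt_diff[OF finV(1), of "insert k (A - {i})" t] card_step finV(2) S1 by auto
    then show "Poly_Mapping.lookup (wt V - wt (insert k (A - {i}))) t = Poly_Mapping.lookup (\<Sum>t\<in>S. simple_root t) t"
      using 1 by simp
  qed
  then show ?thesis using g(1) facet_set(3)[OF g(1)] unfolding g(2) V_def[symmetric] by metis
qed

end

theorem weight_differences:
  assumes "(i, k) \<in> pairs" "root_index n cartan_A Q (eps i - eps k) \<kappa>"
  shows "{weight_function n cartan_A Q I \<kappa> -
            weight_function n cartan_A Q (antigreedy_facet n cartan_A Q) \<kappa> | I. I \<in> facets n cartan_A Q} =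
         {\<Sum>t\<in>S. simple_root t | S. closed_set i k S}"
proof -
  obtain j where j: "j < length q" "\<kappa> = n + 1 + j"
    "i = perm (take j q) (q ! j)" "k = perm (take j q) (Suc (q ! j))"
    using root_index_unique(2)[OF assms] by blast
  note f = refl[of "perm (take j q)"] refl[of "q ! j"] refl[of "perm (take j q) ` {1..q ! j}"]
  have ag: "weight_function n cartan_A Q (antigreedy_facet n cartan_A Q) \<kappa> =
     wt (insert k (perm (take j q) ` {1..q ! j} - {i}))"
    unfolding j(2) by (rule antigreedy_weight(2)[OF j(1) f j(3,4)])
  show ?thesis
    unfolding ag
  proof (intro equalityI subsetI)
    fix v assume "v \<in> {weight_function n cartan_A Q I \<kappa> - wt (insert k (perm (take j q) ` {1..q ! j} - {i})) | I.
       I \<in> facets n cartan_A Q}"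
    then obtain I where "I \<in> facets n cartan_A Q"
      "v = weight_function n cartan_A Q I \<kappa> - wt (insert k (perm (take j q) ` {1..q ! j} - {i}))" by blast
    moreover from facet_closed_set[OF j(1) f j(3,4) this(1)]
    obtain S where "closed_set i k S"
      "weight_function n cartan_A Q I (n + 1 + j) - wt (insert k (perm (take j q) ` {1..q ! j} - {i})) = (\<Sum>t\<in>S. simple_root t)"
      by blast
    ultimately show "v \<in> {\<Sum>t\<in>S. simple_root t | S. closed_set i k S}" unfolding j(2) by blast
  next
    fix v assume "v \<in> {\<Sum>t\<in>S. simple_root t | S. closed_set i k S}"
    then obtain S where "closed_set i k S" "v = (\<Sum>t\<in>S. simple_root t)" by blast
    moreover from closed_set_facet[OF j(1) f j(3,4) this(1)]
    obtain I where "I \<in> facets n cartan_A Q"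
      "weight_function n cartan_A Q I (n + 1 + j) - wt (insert k (perm (take j q) ` {1..q ! j} - {i})) = (\<Sum>t\<in>S. simple_root t)"
      by blast
    ultimately show "v \<in> {weight_function n cartan_A Q I \<kappa> - wt (insert k (perm (take j q) ` {1..q ! j} - {i})) | I.
       I \<in> facets n cartan_A Q}" unfolding j(2) mem_Collect_eq by metis
  qed
qed

end

section \<open>Triangulations and seeds\<close>

definition cyc :: "nat \<Rightarrow> nat \<Rightarrow> nat \<Rightarrow> bool" where
  "cyc x y z \<longleftrightarrow> x < y \<and> y < z \<or> y < z \<and> z < x \<or> z < x \<and> x < y"

lemma cyc_rotate: "cyc x y z \<Longrightarrow> cyc y z x"
  by (auto simp: cyc_def)

lemma cyc_distinct: "cyc x y z \<Longrightarrow> x \<noteq> y \<and> y \<noteq> z \<and> z \<noteq> x"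
  by (auto simp: cyc_def)

definition crossing :: "nat \<Rightarrow> nat \<Rightarrow> nat \<Rightarrow> nat \<Rightarrow> bool" where
  "crossing p q a b \<longleftrightarrow> cyc p a q \<and> cyc q b p \<or> cyc p b q \<and> cyc q a p"

lemma cyc_trans:
  assumes "cyc a b c" "cyc a c d"
  shows "cyc a b d" "cyc b c d"
proof -
  have 1: "cyc x y z \<Longrightarrow> cyc x z u \<Longrightarrow> cyc x y u" for x y z u
    unfolding cyc_def by (meson less_trans less_asym)
  show "cyc a b d" using 1[OF assms] .
  have "cyc c d a" "cyc c a b" using assms cyc_rotate by blast+
  then show "cyc b c d" using 1 cyc_rotate by blast
qed

lemma crossing_swap: "crossing p q a b \<Longrightarrow> crossing q p a b"
  unfolding crossing_def by blast

lemma crossing_sym: "crossing p q a b \<Longrightarrow> crossing a b p q"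
proof -
  have *: "cyc a q b \<and> cyc b p a" if "cyc p a q" "cyc q b p" for a b
  proof -
    have "cyc p q b" using that cyc_rotate by blast
    from cyc_trans[OF that(1) this] show ?thesis using cyc_rotate by blast
  qed
  assume "crossing p q a b"
  then show ?thesis unfolding crossing_def using *[of a b] *[of b a] by blast
qed

lemma cyc_total: "a \<noteq> b \<Longrightarrow> b \<noteq> c \<Longrightarrow> a \<noteq> c \<Longrightarrow> cyc a b c \<or> cyc a c b"
  unfolding cyc_def by (meson linorder_neqE_nat)

text \<open>The point p lies on the arc from w to z that contains y and differs from y, so one of
  the sides wy and yz cuts it off from q.\<close>

lemma crossing_beyond_side:
  assumes "cyc w y z" "cyc w p z" "cyc z q w" "p \<noteq> y"
  shows "crossing p q w y \<or> crossing p q y z"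
proof -
  have wzq: "cyc w z q" using assms(3) cyc_rotate by blast
  have wpq: "cyc w p q" using cyc_trans(1)[OF assms(2) wzq] .
  have "cyc w p y \<or> cyc w y p"
    using cyc_total[of w p y] cyc_distinct[OF assms(1)] cyc_distinct[OF assms(2)] assms(4) by metis
  then show ?thesis
  proof
    assume wpy: "cyc w p y"
    have "cyc w y q" using cyc_trans(1)[OF assms(1) wzq] .
    then have "cyc p y q" using cyc_trans(2)[OF wpy] by blast
    moreover have "cyc q w p" using wpq cyc_rotate by blast
    ultimately show ?thesis unfolding crossing_def by blast
  next
    assume wyp: "cyc w y p"
    have "cyc p z q" using cyc_trans(2)[OF assms(2) wzq] .
    moreover have "cyc q y p" using cyc_trans(2)[OF wyp wpq] cyc_rotate by blast
    ultimately show ?thesis unfolding crossing_def by blast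
  qed
qed

lemma cyc_quadrilateral:
  assumes "cyc x w y" "cyc y z x"
  shows "cyc w y z" "cyc z x w"
proof -
  have "cyc y x w" using assms(1) cyc_rotate by blast
  from cyc_trans[OF assms(2) this] show "cyc w y z" "cyc z x w" using cyc_rotate by blast+
qed

text \<open>After a flip the new diagonal wz must not cross any old edge. An edge that crosses wz
  but no side of the quadrilateral has to be the old diagonal.\<close>

lemma crossing_other_diagonal:
  assumes "cyc x w y" "cyc y z x" "cyc w p z" "cyc z q w"
    and "\<not> crossing p q x w" "\<not> crossing p q w y" "\<not> crossing p q y z" "\<not> crossing p q z x"
  shows "p = y \<and> q = x"
proof -
  have "p = y" using crossing_beyond_side[OF cyc_quadrilateral(1)[OF assms(1,2)] assms(3,4)] assms(6,7) by blast
  moreover have "\<not> crossing q p z x" "\<not> crossing q p x w"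
    using assms(5,8) crossing_swap[of q p] by blast+
  then have "q = x" using crossing_beyond_side[OF cyc_quadrilateral(2)[OF assms(1,2)] assms(4,3)] by blast
  ultimately show ?thesis by simp
qed

definition same_arc :: "nat \<times> nat \<Rightarrow> nat \<Rightarrow> nat \<Rightarrow> bool" where
  "same_arc e p q \<longleftrightarrow> e = (p, q) \<or> e = (q, p)"

definition arc_ind :: "nat \<times> nat \<Rightarrow> nat \<Rightarrow> nat \<Rightarrow> int" where
  "arc_ind e p q = of_bool (same_arc e p q)"

lemma arc_ind_sym: "arc_ind e p q = arc_ind e q p"
  by (auto simp: arc_ind_def same_arc_def)

text \<open>A triangulation is a set \<open>T\<close> of triangles, given as counterclockwise triples closed under
  rotation, so that every oriented edge has at most one triangle on its left.\<close>

definition edge :: "(nat \<times> nat \<times> nat) set \<Rightarrow> nat \<Rightarrow> nat \<Rightarrow> bool" where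
  "edge T p q \<longleftrightarrow> (\<exists>u. (p, q, u) \<in> T)"

definition third :: "(nat \<times> nat \<times> nat) set \<Rightarrow> nat \<Rightarrow> nat \<Rightarrow> nat" where
  "third T p q = (THE u. (p, q, u) \<in> T)"

text \<open>The contribution of the triangle on the left of the oriented edge from p to q: the value
  of \<tau> on the next side minus its value on the previous one. If \<tau> is the indicator of an
  arc, \<open>shear\<close> gives the signed adjacency of the two arcs; for frozen rows it gives
  shear coordinates.\<close>

definition half_shear :: "(nat \<Rightarrow> nat \<Rightarrow> int) \<Rightarrow> (nat \<times> nat \<times> nat) set \<Rightarrow> nat \<Rightarrow> nat \<Rightarrow> int" where
  "half_shear \<tau> T p q = \<tau> q (third T p q) - \<tau> (third T p q) p"

definition shear :: "(nat \<Rightarrow> nat \<Rightarrow> int) \<Rightarrow> (nat \<times> nat \<times> nat) set \<Rightarrow> nat \<times> nat \<Rightarrow> int" where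
  "shear \<tau> T e = half_shear \<tau> T (fst e) (snd e) + half_shear \<tau> T (snd e) (fst e)"

definition rot :: "nat \<Rightarrow> nat \<Rightarrow> nat \<Rightarrow> (nat \<times> nat \<times> nat) set" where
  "rot x y z = {(x, y, z), (y, z, x), (z, x, y)}"

text \<open>The six oriented edges in the exclusion list are the sides of the two old triangles with
  their rotations. A triangle is determined by an oriented edge, so exactly these two
  disappear.\<close>

definition flip :: "nat \<Rightarrow> nat \<Rightarrow> nat \<Rightarrow> nat \<Rightarrow> (nat \<times> nat \<times> nat) set \<Rightarrow> (nat \<times> nat \<times> nat) set" where
  "flip x y z w T = {(p, q, u). (p, q, u) \<in> T \<and>
       (p, q) \<notin> {(x, y), (y, z), (z, x), (y, x), (x, w), (w, y)}} \<union> rot x w z \<union> rot w y z"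

definition boundary :: "nat \<Rightarrow> nat \<Rightarrow> nat \<Rightarrow> bool" where
  "boundary n p q \<longleftrightarrow> q = Suc p \<or> p = n + 2 \<and> q = 0"

text \<open>Only what mutation needs is recorded: a labelled diagonal has a triangle on both sides,
  different labels are different diagonals, and every edge is labelled or a side of the
  polygon.\<close>

locale triangulation =
  fixes n :: nat and diag :: "nat \<Rightarrow> nat \<times> nat" and T :: "(nat \<times> nat \<times> nat) set"
  assumes rotate: "(x, y, z) \<in> T \<Longrightarrow> (y, z, x) \<in> T"
    and oriented: "(x, y, z) \<in> T \<Longrightarrow> cyc x y z"
    and bounded: "(x, y, z) \<in> T \<Longrightarrow> x \<le> n + 2"
    and unique: "(x, y, z) \<in> T \<Longrightarrow> (x, y, z') \<in> T \<Longrightarrow> z = z'"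
    and noncrossing: "edge T p q \<Longrightarrow> edge T x y \<Longrightarrow> \<not> crossing p q x y"
    and arcs: "k \<in> {1..n} \<Longrightarrow> edge T (fst (diag k)) (snd (diag k)) \<and> edge T (snd (diag k)) (fst (diag k))"
    and inj_arcs: "i \<in> {1..n} \<Longrightarrow> j \<in> {1..n} \<Longrightarrow> i \<noteq> j \<Longrightarrow> \<not> same_arc (diag i) (fst (diag j)) (snd (diag j))"
    and edges: "edge T p q \<Longrightarrow> boundary n p q \<or> (\<exists>k\<in>{1..n}. same_arc (diag k) p q)"
begin

lemma third_eq: "(p, q, u) \<in> T \<Longrightarrow> third T p q = u"
  unfolding third_def using unique by blast

lemma third_mem: "edge T p q \<Longrightarrow> (p, q, third T p q) \<in> T"
  unfolding edge_def using third_eq by auto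

lemma boundary_not_rev: "boundary n p q \<Longrightarrow> \<not> edge T q p"
proof
  assume b: "boundary n p q" and "edge T q p"
  then obtain u where u: "(q, p, u) \<in> T" by (auto simp: edge_def)
  then have "u \<le> n + 2" using rotate bounded by blast
  then show False using oriented[OF u] b unfolding boundary_def cyc_def by auto
qed

end

section \<open>Flips and matrix mutation\<close>

locale flippable = triangulation +
  fixes k x y z w :: nat
  assumes k: "k \<in> {1..n}" and arck: "diag k = (x, y)"
    and xyz: "(x, y, z) \<in> T" and yxw: "(y, x, w) \<in> T"
begin

abbreviation "T' \<equiv> flip x y z w T"
abbreviation "diag' \<equiv> diag(k := (w, z))"

lemma mem: "(y, z, x) \<in> T" "(z, x, y) \<in> T" "(x, w, y) \<in> T" "(w, y, x) \<in> T"
  using xyz yxw rotate by blast+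

text \<open>The quadrilateral has the vertices x, w, y, z in this cyclic order; the flip replaces
  its diagonal xy by wz.\<close>

lemma cyc4: "cyc x w y" "cyc y z x" "cyc w y z" "cyc z x w"
proof -
  show "cyc x w y" using oriented mem by blast
  show "cyc y z x" using oriented mem by blast
  then show "cyc w y z" "cyc z x w" using cyc_quadrilateral \<open>cyc x w y\<close> by blast+
qed

lemma dist: "x \<noteq> y" "x \<noteq> z" "x \<noteq> w" "y \<noteq> z" "y \<noteq> w" "z \<noteq> w"
  using cyc_distinct[OF cyc4(1)] cyc_distinct[OF cyc4(2)] cyc_distinct[OF cyc4(3)] by auto

lemma edges_T: "edge T x y" "edge T y x" "edge T y z" "edge T z x" "edge T x w" "edge T w y"
  using xyz yxw mem by (auto simp: edge_def)

lemma no_wz: "\<not> edge T w z" "\<not> edge T z w"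
proof -
  have "crossing x y w z" "crossing x y z w" using cyc4 by (auto simp: crossing_def)
  then show "\<not> edge T w z" "\<not> edge T z w" using noncrossing[OF edges_T(1)] by blast+
qed

lemma flip_iff: "(p, q, u) \<in> T' \<longleftrightarrow> (p, q, u) \<in> rot x w z \<union> rot w y z \<or>
    (p, q, u) \<in> T \<and> (p, q) \<notin> {(x, y), (y, z), (z, x), (y, x), (x, w), (w, y)}"
  unfolding flip_def by blast

lemma edge_flip: "edge T' p q \<longleftrightarrow> (edge T p q \<and> (p, q) \<noteq> (x, y) \<and> (p, q) \<noteq> (y, x)) \<or> (p, q) = (w, z) \<or> (p, q) = (z, w)"
proof
  assume "edge T' p q"
  then obtain u where u: "(p, q, u) \<in> T'" by (auto simp: edge_def)
  show "(edge T p q \<and> (p, q) \<noteq> (x, y) \<and> (p, q) \<noteq> (y, x)) \<or> (p, q) = (w, z) \<or> (p, q) = (z, w)"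
  proof (cases "(p, q, u) \<in> rot x w z \<union> rot w y z")
    case True
    then have "(p, q) \<in> {(x, w), (w, z), (z, x), (w, y), (y, z), (z, w)}" by (auto simp: rot_def)
    then show ?thesis using edges_T dist by auto
  next
    case False
    then show ?thesis using u unfolding flip_iff edge_def by blast
  qed
next
  assume a: "(edge T p q \<and> (p, q) \<noteq> (x, y) \<and> (p, q) \<noteq> (y, x)) \<or> (p, q) = (w, z) \<or> (p, q) = (z, w)"
  show "edge T' p q"
  proof (cases "(p, q) \<in> {(x, w), (w, z), (z, x), (w, y), (y, z), (z, w)}")
    case True
    then have "(p, q, z) \<in> rot x w z \<union> rot w y z \<or> (p, q, x) \<in> rot x w z \<or> (p, q, w) \<in> rot x w z \<union> rot w y z \<or>
       (p, q, y) \<in> rot w y z"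
      unfolding rot_def by auto
    then show ?thesis unfolding edge_def flip_iff by blast
  next
    case False
    then obtain u where "(p, q, u) \<in> T" "(p, q) \<noteq> (x, y)" "(p, q) \<noteq> (y, x)"
      using a unfolding edge_def by auto
    then have "(p, q, u) \<in> T'" using False unfolding flip_iff by blast
    then show ?thesis unfolding edge_def by blast
  qed
qed

lemma thirds:
  "third T x y = z" "third T y z = x" "third T z x = y" "third T y x = w" "third T x w = y" "third T w y = x"
  using xyz yxw mem by (auto intro: third_eq)

lemma unique_flip:
  assumes "(p, q, u) \<in> T'" "(p, q, u') \<in> T'"
  shows "u = u'"
proof -
  have no: "(w, z, v) \<notin> T" "(z, w, v) \<notin> T" for v using no_wz by (auto simp: edge_def)
  show ?thesis
  proof (cases "(p, q, u) \<in> rot x w z \<union> rot w y z")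
    case True
    then have pq: "(p, q) \<in> {(x, w), (w, z), (z, x), (w, y), (y, z), (z, w)}" by (auto simp: rot_def)
    have "(p, q, u') \<in> rot x w z \<union> rot w y z"
    proof (rule ccontr)
      assume "(p, q, u') \<notin> rot x w z \<union> rot w y z"
      then have "(p, q, u') \<in> T" "(p, q) \<notin> {(x, y), (y, z), (z, x), (y, x), (x, w), (w, y)}"
        using assms(2) unfolding flip_iff by blast+
      then show False using pq no by auto
    qed
    then show ?thesis using True dist unfolding rot_def by auto
  next
    case False
    then have old: "(p, q, u) \<in> T" "(p, q) \<notin> {(x, y), (y, z), (z, x), (y, x), (x, w), (w, y)}"
      using assms(1) unfolding flip_iff by blast+
    have "(p, q, u') \<in> T"
    proof (rule ccontr)
      assume "(p, q, u') \<notin> T"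
      then have "(p, q, u') \<in> rot x w z \<union> rot w y z" using assms(2) unfolding flip_iff by blast
      then have "(p, q) \<in> {(x, w), (w, z), (z, x), (w, y), (y, z), (z, w)}" by (auto simp: rot_def)
      then show False using old no by auto
    qed
    then show ?thesis using old unique by blast
  qed
qed

lemma third_flip_eq: "(p, q, u) \<in> T' \<Longrightarrow> third T' p q = u"
  unfolding third_def using unique_flip by blast

lemma thirds_flip:
  "third T' x w = z" "third T' w z = x" "third T' z x = w" "third T' w y = z" "third T' y z = w" "third T' z w = y"
  by (rule third_flip_eq, simp add: flip_iff rot_def)+

lemma third_flip_other:
  assumes "edge T p q" "(p, q) \<notin> {(x, y), (y, z), (z, x), (y, x), (x, w), (w, y)}"
  shows "third T' p q = third T p q"
proof (rule third_flip_eq)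
  show "(p, q, third T p q) \<in> T'"
    unfolding flip_iff using third_mem[OF assms(1)] assms(2) by blast
qed

lemma triangulation_flip: "triangulation n diag' T'"
proof
  fix p q u assume pqu: "(p, q, u) \<in> T'"
  show "(q, u, p) \<in> T'"
  proof (cases "(p, q, u) \<in> rot x w z \<union> rot w y z")
    case True
    then show ?thesis unfolding flip_iff rot_def by auto
  next
    case False
    then have t: "(p, q, u) \<in> T" "(p, q) \<notin> {(x, y), (y, z), (z, x), (y, x), (x, w), (w, y)}"
      using pqu unfolding flip_iff by auto
    then have r: "(q, u, p) \<in> T" using rotate by blast
    have "(q, u) \<notin> {(x, y), (y, z), (z, x), (y, x), (x, w), (w, y)}"
    proof
      assume a: "(q, u) \<in> {(x, y), (y, z), (z, x), (y, x), (x, w), (w, y)}"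
      have "p = third T q u" using third_eq[OF r] by simp
      then show False using a t(2) thirds by auto
    qed
    then show ?thesis using r unfolding flip_iff by blast
  qed
  show "cyc p q u"
    using pqu oriented cyc4 cyc_rotate unfolding flip_iff rot_def by auto
  show "p \<le> n + 2"
    using pqu bounded xyz yxw mem unfolding flip_iff rot_def by auto
  show "u = u'" if "(p, q, u') \<in> T'" for u' using unique_flip[OF pqu that] .
next
  fix p q a b assume e: "edge T' p q" "edge T' a b"
  \<comment> \<open>An old edge crossing wz crosses no side of the quadrilateral, so it is the
    diagonal xy, which has been removed.\<close>
  have old: "\<not> crossing w z p q" if "edge T p q" "(p, q) \<noteq> (x, y)" "(p, q) \<noteq> (y, x)" for p q
  proof
    assume "crossing w z p q"
    then consider "cyc w p z" "cyc z q w" | "cyc w q z" "cyc z p w" by (auto simp: crossing_def)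
    then show False
    proof cases
      case 1
      then have "p = y \<and> q = x"
        using noncrossing[OF that(1)] edges_T cyc4 by (intro crossing_other_diagonal[of x w y z]) auto
      then show False using that by auto
    next
      case 2
      have "\<not> crossing q p a b" if "edge T a b" for a b
        using noncrossing[OF \<open>edge T p q\<close> that] crossing_swap by blast
      then have "q = y \<and> p = x"
        using 2 edges_T cyc4 by (intro crossing_other_diagonal[of x w y z]) auto
      then show False using that by auto
    qed
  qed
  have self: "\<not> crossing w z w z" "\<not> crossing w z z w" "\<not> crossing z w w z" "\<not> crossing z w z w"
    by (auto simp: crossing_def dest: cyc_distinct)
  show "\<not> crossing p q a b"
  proof
    assume c: "crossing p q a b"
    consider "edge T p q" "edge T a b" | "(p, q) = (w, z) \<or> (p, q) = (z, w)" | "(a, b) = (w, z) \<or> (a, b) = (z, w)"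
      using e unfolding edge_flip by blast
    then show False
    proof cases
      case 1
      then show ?thesis using noncrossing c by blast
    next
      case 2
      then have "crossing w z a b" using c crossing_swap by auto
      then show ?thesis using e(2) old[of a b] self unfolding edge_flip by auto
    next
      case 3
      then have "crossing w z p q" using crossing_sym[OF c] crossing_swap by auto
      then show ?thesis using e(1) old[of p q] self unfolding edge_flip by auto
    qed
  qed
next
  fix m assume m: "m \<in> {1..n}"
  show "edge T' (fst (diag' m)) (snd (diag' m)) \<and> edge T' (snd (diag' m)) (fst (diag' m))"
  proof (cases "m = k")
    case True
    then show ?thesis unfolding edge_flip by simp
  next
    case False
    then have "\<not> same_arc (diag m) x y" using inj_arcs[OF m k False] arck by simp
    then show ?thesis using False arcs[OF m] unfolding edge_flip same_arc_def by (cases "diag m") auto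
  qed
next
  fix i j assume ij: "i \<in> {1..n}" "j \<in> {1..n}" "i \<noteq> j"
  show "\<not> same_arc (diag' i) (fst (diag' j)) (snd (diag' j))"
    using inj_arcs[OF ij] arcs[OF ij(1)] arcs[OF ij(2)] no_wz ij unfolding same_arc_def
    by (cases "i = k"; cases "j = k"; cases "diag i"; cases "diag j") auto
next
  fix p q assume e: "edge T' p q"
  show "boundary n p q \<or> (\<exists>m\<in>{1..n}. same_arc (diag' m) p q)"
  proof (cases "(p, q) = (w, z) \<or> (p, q) = (z, w)")
    case True
    then show ?thesis using k by (intro disjI2 bexI[of _ k]) (auto simp: same_arc_def)
  next
    case False
    then have t: "edge T p q" "(p, q) \<noteq> (x, y)" "(p, q) \<noteq> (y, x)" using e unfolding edge_flip by auto
    from edges[OF t(1)] show ?thesis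
    proof
      assume "\<exists>m\<in>{1..n}. same_arc (diag m) p q"
      then obtain m where m: "m \<in> {1..n}" "same_arc (diag m) p q" by blast
      then have "m \<noteq> k" using t arck by (auto simp: same_arc_def)
      then show ?thesis using m by (intro disjI2 bexI[of _ m]) auto
    qed simp
  qed
qed

lemma half_shear_other:
  assumes e: "edge T p q" "(p, q) \<notin> {(x, y), (y, z), (z, x), (y, x), (x, w), (w, y)}"
  shows "half_shear (arc_ind (x, y)) T p q = 0"
proof -
  define u where "u = third T p q"
  have m: "(p, q, u) \<in> T" unfolding u_def by (rule third_mem[OF e(1)])
  then have m': "(q, u, p) \<in> T" "(u, p, q) \<in> T" using rotate by blast+
  have "\<not> same_arc (x, y) q u"
  proof
    assume "same_arc (x, y) q u"
    then have "p = z \<or> p = w" "(q, u) = (x, y) \<or> (q, u) = (y, x)"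
      using third_eq[OF m'(1)] thirds by (auto simp: same_arc_def)
    then show False using e(2) third_eq[OF m'(1)] thirds by auto
  qed
  moreover have "\<not> same_arc (x, y) u p"
  proof
    assume "same_arc (x, y) u p"
    then show False using e(2) third_eq[OF m'(2)] thirds by (auto simp: same_arc_def)
  qed
  ultimately show ?thesis by (simp add: half_shear_def arc_ind_def u_def)
qed

text \<open>\<open>tropical\<close> is the tropical Ptolemy relation; it holds for the indicator of every diagonal other
  than the flipped one and for the frozen rows.\<close>

lemma half_shear_flip:
  assumes sym: "\<And>p q. \<tau> p q = \<tau> q p"
    and tropical: "\<tau> x y + \<tau> w z = min (\<tau> x w + \<tau> y z) (\<tau> w y + \<tau> z x)"
    and e: "edge T p q" "(p, q) \<noteq> (x, y)" "(p, q) \<noteq> (y, x)"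
  defines "s \<equiv> shear \<tau> T (x, y)" and "h \<equiv> half_shear (arc_ind (x, y)) T p q"
  shows "half_shear \<tau> T' p q = half_shear \<tau> T p q + max 0 s * max 0 h - max 0 (- s) * max 0 (- h)"
proof -
  have s: "s = \<tau> x w + \<tau> y z - (\<tau> w y + \<tau> z x)"
    unfolding s_def shear_def half_shear_def using thirds sym by (simp add: sym)
  have ai: "arc_ind (x, y) x y = 1" "arc_ind (x, y) y x = 1" "arc_ind (x, y) a b = 0"
    if "a \<notin> {x, y} \<or> b \<notin> {x, y}" for a b
    using that by (auto simp: arc_ind_def same_arc_def)
  \<comment> \<open>On each of the four sides h is 1 or -1, and the claim is the tropical relation
    solved for \<open>\<tau> w z\<close>. All other edges keep their left triangle.\<close>
  consider "(p, q) = (x, w)" | "(p, q) = (w, y)" | "(p, q) = (y, z)" | "(p, q) = (z, x)"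
    | "(p, q) \<notin> {(x, y), (y, z), (z, x), (y, x), (x, w), (w, y)}" using e by blast
  then show ?thesis
  proof cases
    case 1
    then have "h = -1" using dist by (simp add: h_def half_shear_def thirds arc_ind_def same_arc_def)
    moreover have "half_shear \<tau> T' p q = \<tau> w z - \<tau> z x" "half_shear \<tau> T p q = \<tau> w y - \<tau> x y"
      using 1 sym[of y x] by (simp_all add: half_shear_def thirds thirds_flip)
    ultimately show ?thesis using tropical s by (simp add: min_def max_def split: if_splits)
  next
    case 2
    then have "h = 1" using dist by (simp add: h_def half_shear_def thirds arc_ind_def same_arc_def)
    moreover have "half_shear \<tau> T' p q = \<tau> y z - \<tau> w z" "half_shear \<tau> T p q = \<tau> x y - \<tau> x w"
      using 2 sym[of y x] sym[of z w] by (simp_all add: half_shear_def thirds thirds_flip)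
    ultimately show ?thesis using tropical s by (simp add: min_def max_def split: if_splits)
  next
    case 3
    then have "h = -1" using dist by (simp add: h_def half_shear_def thirds arc_ind_def same_arc_def)
    moreover have "half_shear \<tau> T' p q = \<tau> w z - \<tau> w y" "half_shear \<tau> T p q = \<tau> z x - \<tau> x y"
      using 3 sym[of z w] by (simp_all add: half_shear_def thirds thirds_flip)
    ultimately show ?thesis using tropical s by (simp add: min_def max_def split: if_splits)
  next
    case 4
    then have "h = 1" using dist by (simp add: h_def half_shear_def thirds arc_ind_def same_arc_def)
    moreover have "half_shear \<tau> T' p q = \<tau> x w - \<tau> w z" "half_shear \<tau> T p q = \<tau> x y - \<tau> y z"
      using 4 by (simp_all add: half_shear_def thirds thirds_flip)
    ultimately show ?thesis using tropical s by (simp add: min_def max_def split: if_splits)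
  next
    case 5
    have "h = 0" unfolding h_def by (rule half_shear_other[OF e(1) 5])
    then show ?thesis using third_flip_other[OF e(1) 5] by (simp add: half_shear_def)
  qed
qed

end

section \<open>Seeds attached to triangulations\<close>

locale cluster_polygon =
  fixes n :: nat and \<phi> :: "nat \<Rightarrow> nat \<Rightarrow> mpol fract" and Y :: "nat \<Rightarrow> mpol fract"
    and t :: "nat \<Rightarrow> nat \<Rightarrow> nat \<Rightarrow> int"
  assumes phi_sym: "\<phi> p q = \<phi> q p" and t_sym: "t i p q = t i q p"
    and t_tropical: "\<lbrakk>i \<in> {1..n}; cyc x w y; cyc y z x; x \<le> n + 2; w \<le> n + 2; y \<le> n + 2; z \<le> n + 2\<rbrakk> \<Longrightarrow>
      t i x y + t i w z = min (t i x w + t i y z) (t i w y + t i z x)"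
    and exchange: "\<lbrakk>cyc x w y; cyc y z x; x \<le> n + 2; w \<le> n + 2; y \<le> n + 2; z \<le> n + 2\<rbrakk> \<Longrightarrow>
      \<phi> x y * \<phi> w z =
        (\<Prod>i\<in>{1..n}. Y i ^ nat (t i x w + t i y z - (t i w y + t i z x))) * (\<phi> x w * \<phi> y z) +
        (\<Prod>i\<in>{1..n}. Y i ^ nat (t i w y + t i z x - (t i x w + t i y z))) * (\<phi> w y * \<phi> z x)"
    and phi_boundary: "boundary n p q \<Longrightarrow> p \<le> n + 2 \<Longrightarrow> q \<le> n + 2 \<Longrightarrow> \<phi> p q = 1"
    and phi_nonzero: "p \<le> n + 2 \<Longrightarrow> q \<le> n + 2 \<Longrightarrow> p \<noteq> q \<Longrightarrow> \<phi> p q \<noteq> 0"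
begin

text \<open>Row i of the exchange matrix as a function on pairs of vertices: the indicator of the
  i-th arc for mutable rows, the tropical coefficient for frozen ones.\<close>

definition mrow :: "(nat \<Rightarrow> nat \<times> nat) \<Rightarrow> nat \<Rightarrow> nat \<Rightarrow> nat \<Rightarrow> int" where
  "mrow diag i = (if i \<le> n then arc_ind (diag i) else t (i - n))"

definition represents :: "(nat \<Rightarrow> mpol fract) \<Rightarrow> (nat \<Rightarrow> nat \<Rightarrow> int) \<Rightarrow> (nat \<Rightarrow> nat \<times> nat) \<Rightarrow>
    (nat \<times> nat \<times> nat) set \<Rightarrow> bool" where
  "represents z b diag T \<longleftrightarrow> triangulation n diag T \<and>
     (\<forall>i\<in>{1..n}. z i = \<phi> (fst (diag i)) (snd (diag i))) \<and> (\<forall>i\<in>{1..n}. z (n + i) = Y i) \<and>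
     (\<forall>i\<in>{1..2 * n}. \<forall>j\<in>{1..n}. b i j = shear (mrow diag i) T (diag j))"

lemma row_sym: "mrow diag i p q = mrow diag i q p"
  by (simp add: mrow_def arc_ind_sym t_sym)

end

locale mutation = flippable n diag T k x y z w + cluster_polygon n \<phi> Y t
  for n diag T k x y z w \<phi> Y t
begin

lemma vertices: "x \<le> n + 2" "w \<le> n + 2" "y \<le> n + 2" "z \<le> n + 2"
  using bounded mem xyz by blast+

lemma arc_edge: "i \<in> {1..n} \<Longrightarrow> same_arc (diag i) p q \<Longrightarrow> edge T p q"
  using arcs[of i] by (cases "diag i") (auto simp: same_arc_def)

lemma arc_neq: "i \<in> {1..n} \<Longrightarrow> i \<noteq> k \<Longrightarrow> \<not> same_arc (diag i) x y"
  using inj_arcs[OF _ k, of i] arck by simp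

lemma sides_distinct: 
  "arc_ind e x w + arc_ind e y z + arc_ind e w y + arc_ind e z x \<le> 1"
  using dist by (auto simp: arc_ind_def same_arc_def)

lemma arc_ind_nonneg: "0 \<le> arc_ind e p q"
  by (simp add: arc_ind_def)

text \<open>An arc other than xy is neither diagonal of the quadrilateral and is at most one of its
  four sides, so both sides of the relation vanish. For frozen rows the relation is assumed.\<close>

lemma row_tropical:
  assumes i: "i \<in> {1..2 * n}" "i \<noteq> k"
  shows "mrow diag i x y + mrow diag i w z = min (mrow diag i x w + mrow diag i y z) (mrow diag i w y + mrow diag i z x)"
proof (cases "i \<le> n")
  case True
  then have i': "i \<in> {1..n}" using i by auto
  have "arc_ind (diag i) x y = 0" using arc_neq[OF i' i(2)] by (simp add: arc_ind_def)
  moreover have "arc_ind (diag i) w z = 0" using arc_edge[OF i', of w z] no_wz by (auto simp: arc_ind_def)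
  moreover have "min (arc_ind (diag i) x w + arc_ind (diag i) y z) (arc_ind (diag i) w y + arc_ind (diag i) z x) = 0"
    using sides_distinct[of "diag i"] arc_ind_nonneg[of "diag i" x w] arc_ind_nonneg[of "diag i" y z]
      arc_ind_nonneg[of "diag i" w y] arc_ind_nonneg[of "diag i" z x] by linarith
  ultimately show ?thesis using True by (simp add: mrow_def)
next
  case False
  then have "i - n \<in> {1..n}" using i by auto
  from t_tropical[OF this cyc4(1,2) vertices] show ?thesis using False by (simp add: mrow_def)
qed

lemma shear_xy: "(\<And>p q. \<tau> p q = \<tau> q p) \<Longrightarrow> shear \<tau> T (x, y) = \<tau> x w + \<tau> y z - (\<tau> w y + \<tau> z x)"
  by (simp add: shear_def half_shear_def thirds)

lemma shear_wz: "(\<And>p q. \<tau> p q = \<tau> q p) \<Longrightarrow> shear \<tau> T' (w, z) = \<tau> w y + \<tau> z x - (\<tau> x w + \<tau> y z)"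
  by (simp add: shear_def half_shear_def thirds_flip)

lemma half_shear_new:
  assumes e: "edge T p q" "(p, q) \<noteq> (x, y)" "(p, q) \<noteq> (y, x)"
  shows "half_shear (arc_ind (w, z)) T' p q = - half_shear (arc_ind (x, y)) T p q"
proof -
  consider "(p, q) = (x, w)" | "(p, q) = (w, y)" | "(p, q) = (y, z)" | "(p, q) = (z, x)"
    | "(p, q) \<notin> {(x, y), (y, z), (z, x), (y, x), (x, w), (w, y)}" using e by blast
  then show ?thesis
  proof cases
    case 5
    have m: "(p, q, third T p q) \<in> T" by (rule third_mem[OF e(1)])
    then have "edge T q (third T p q)" "edge T (third T p q) p"
      using rotate unfolding edge_def by blast+
    then have "\<not> same_arc (w, z) q (third T p q)" "\<not> same_arc (w, z) (third T p q) p"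
      using no_wz by (auto simp: same_arc_def)
    then have "half_shear (arc_ind (w, z)) T p q = 0" by (simp add: half_shear_def arc_ind_def)
    then show ?thesis using third_flip_other[OF e(1) 5] half_shear_other[OF e(1) 5]
      by (simp add: half_shear_def)
  qed (use dist in \<open>simp_all add: half_shear_def thirds thirds_flip arc_ind_def same_arc_def\<close>)
qed

text \<open>An edge other than xy is a side of the quadrilateral in at most one of its orientations.
  Positive and negative parts of the sum over both orientations therefore split, as matrix mutation
  requires.\<close>

lemma one_side:
  assumes e: "edge T p q" "edge T q p" "(p, q) \<noteq> (x, y)" "(p, q) \<noteq> (y, x)"
  shows "half_shear (arc_ind (x, y)) T p q = 0 \<or> half_shear (arc_ind (x, y)) T q p = 0"
proof (rule ccontr)
  assume "\<not> ?thesis"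
  then have "(p, q) \<in> {(x, y), (y, z), (z, x), (y, x), (x, w), (w, y)}"
    "(q, p) \<in> {(x, y), (y, z), (z, x), (y, x), (x, w), (w, y)}"
    using half_shear_other[OF e(1)] half_shear_other[OF e(2)] by blast+
  then show False using e(3,4) dist by auto
qed

lemma mutate_matrix_shear:
  assumes i: "i \<in> {1..2 * n}" and j: "j \<in> {1..n}"
    and b: "\<And>i j. i \<in> {1..2 * n} \<Longrightarrow> j \<in> {1..n} \<Longrightarrow> b i j = shear (mrow diag i) T (diag j)"
  shows "mutate_matrix k b i j = shear (mrow diag' i) T' (diag' j)"
proof -
  have k2: "k \<in> {1..2 * n}" using k by auto
  have rowk: "mrow diag k = arc_ind (x, y)" "mrow diag' k = arc_ind (w, z)"
    using k arck by (auto simp: mrow_def)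
  have rowi: "mrow diag' i = mrow diag i" if "i \<noteq> k" using that by (auto simp: mrow_def)
  show ?thesis
  proof (cases "j = k")
    case True
    have "shear (mrow diag' i) T' (w, z) = - shear (mrow diag i) T (x, y)"
    proof (cases "i = k")
      case True
      then show ?thesis using dist unfolding True rowk
        by (simp add: shear_xy[OF arc_ind_sym] shear_wz[OF arc_ind_sym] arc_ind_def same_arc_def)
    next
      case False
      show ?thesis unfolding rowi[OF False] shear_xy[OF row_sym] shear_wz[OF row_sym] by simp
    qed
    then show ?thesis using True b[OF i k] arck by (simp add: mutate_matrix_def)
  next
    case False
    obtain p q where pq: "diag j = (p, q)" by force
    have e: "edge T p q" "edge T q p" using arcs[OF j] pq by auto
    have ne: "(p, q) \<noteq> (x, y)" "(p, q) \<noteq> (y, x)" "(q, p) \<noteq> (x, y)" "(q, p) \<noteq> (y, x)"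
      using arc_neq[OF j False] pq by (auto simp: same_arc_def)
    let ?h1 = "half_shear (arc_ind (x, y)) T p q" and ?h2 = "half_shear (arc_ind (x, y)) T q p"
    have bkj: "b k j = ?h1 + ?h2"
      using b[OF k2 j] pq by (simp add: rowk shear_def)
    show ?thesis
    proof (cases "i = k")
      case True
      have "shear (mrow diag' k) T' (p, q) = - (?h1 + ?h2)"
        unfolding rowk shear_def using half_shear_new[OF e(1) ne(1,2)] half_shear_new[OF e(2) ne(3,4)] by simp
      then show ?thesis using True False pq bkj by (simp add: mutate_matrix_def)
    next
      case ik: False
      let ?\<tau> = "mrow diag i" and ?s = "shear (mrow diag i) T (x, y)"
      have h1: "half_shear ?\<tau> T' p q = half_shear ?\<tau> T p q + max 0 ?s * max 0 ?h1 - max 0 (- ?s) * max 0 (- ?h1)"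
        by (rule half_shear_flip[OF row_sym row_tropical[OF i ik] e(1) ne(1,2)])
      have h2: "half_shear ?\<tau> T' q p = half_shear ?\<tau> T q p + max 0 ?s * max 0 ?h2 - max 0 (- ?s) * max 0 (- ?h2)"
        by (rule half_shear_flip[OF row_sym row_tropical[OF i ik] e(2) ne(3,4)])
      have "mutate_matrix k b i j = b i j + max 0 ?s * max 0 (?h1 + ?h2) - max 0 (- ?s) * max 0 (- (?h1 + ?h2))"
        using ik False b[OF i k] arck bkj by (simp add: mutate_matrix_def)
      also have "b i j = half_shear ?\<tau> T p q + half_shear ?\<tau> T q p"
        using b[OF i j] pq by (simp add: shear_def)
      finally show ?thesis
        unfolding rowi[OF ik] using False pq one_side[OF e ne(1,2)] h1 h2 by (auto simp: shear_def)
    qed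
  qed
qed

text \<open>A labelled edge contributes its variable once; a side of the polygon gives the empty
  product, in accordance with its normalisation to 1.\<close>

lemma prod_edge:
  assumes e: "edge T p q"
  shows "(\<Prod>i\<in>{1..n}. \<phi> (fst (diag i)) (snd (diag i)) ^ nat (arc_ind (diag i) p q)) = \<phi> p q"
proof (cases "\<exists>m\<in>{1..n}. same_arc (diag m) p q")
  case True
  then obtain m where m: "m \<in> {1..n}" "same_arc (diag m) p q" by blast
  have "\<not> same_arc (diag i) p q" if "i \<in> {1..n}" "i \<noteq> m" for i
    using inj_arcs[OF that(1) m(1) that(2)] m(2) unfolding same_arc_def by (cases "diag m") auto
  then have "(\<Prod>i\<in>{1..n}. \<phi> (fst (diag i)) (snd (diag i)) ^ nat (arc_ind (diag i) p q)) =
      (\<Prod>i\<in>{m}. \<phi> (fst (diag i)) (snd (diag i)) ^ nat (arc_ind (diag i) p q))"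
    using m(1) by (intro prod.mono_neutral_right) (auto simp: arc_ind_def)
  also have "\<dots> = \<phi> p q"
    using m(2) phi_sym[of q p] by (auto simp: arc_ind_def same_arc_def)
  finally show ?thesis .
next
  case False
  then have "boundary n p q" using edges[OF e] by blast
  moreover have "(\<Prod>i\<in>{1..n}. \<phi> (fst (diag i)) (snd (diag i)) ^ nat (arc_ind (diag i) p q)) = 1"
    using False by (intro prod.neutral) (auto simp: arc_ind_def)
  moreover have "p \<le> n + 2" "q \<le> n + 2" using e bounded rotate unfolding edge_def by blast+
  ultimately show ?thesis using phi_boundary by simp
qed

lemma mutate_cluster_phi:
  assumes "represents v b diag T"
  shows "mutate_cluster n k b v k = \<phi> w z"
proof -
  have v: "v i = \<phi> (fst (diag i)) (snd (diag i))" "v (n + i) = Y i" if "i \<in> {1..n}" for i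
    using assms that by (auto simp: represents_def)
  have b: "b i k = shear (mrow diag i) T (x, y)" if "i \<in> {1..2 * n}" for i
    using assms that k arck by (auto simp: represents_def)
  have split: "(\<Prod>i\<in>{1..2 * n}. g i) = (\<Prod>i\<in>{1..n}. g i) * (\<Prod>i\<in>{1..n}. g (n + i))" for g :: "nat \<Rightarrow> mpol fract"
  proof -
    have "{1..2 * n} = {1..n} \<union> (+) n ` {1..n}" by (auto simp: image_iff)
    moreover have "{1..n} \<inter> (+) n ` {1..n} = {}" by auto
    ultimately have "(\<Prod>i\<in>{1..2 * n}. g i) = (\<Prod>i\<in>{1..n}. g i) * (\<Prod>i\<in>(+) n ` {1..n}. g i)"
      by (simp add: prod.union_disjoint)
    also have "(\<Prod>i\<in>(+) n ` {1..n}. g i) = (\<Prod>i\<in>{1..n}. g (n + i))"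
      by (subst prod.reindex) (simp_all only: inj_on_add comp_def)
    finally show ?thesis .
  qed
  define s where "s = (\<lambda>i. t i x w + t i y z - (t i w y + t i z x))"
  have bt: "b (n + i) k = s i" if "i \<in> {1..n}" for i
    using b[of "n + i"] that by (simp add: shear_xy[OF t_sym] mrow_def s_def)
  \<comment> \<open>An arc is at most one of the four sides, so at most one of the indicators is
    nonzero and the positive and negative parts of the entry separate them.\<close>
  have bm: "nat (b i k) = nat (arc_ind (diag i) x w) + nat (arc_ind (diag i) y z)"
    "nat (- b i k) = nat (arc_ind (diag i) w y) + nat (arc_ind (diag i) z x)" if "i \<in> {1..n}" for i
  proof -
    have "b i k = arc_ind (diag i) x w + arc_ind (diag i) y z - (arc_ind (diag i) w y + arc_ind (diag i) z x)"
      using b[of i] that by (simp add: shear_xy[OF arc_ind_sym] mrow_def)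
    then show "nat (b i k) = nat (arc_ind (diag i) x w) + nat (arc_ind (diag i) y z)"
      "nat (- b i k) = nat (arc_ind (diag i) w y) + nat (arc_ind (diag i) z x)"
      using sides_distinct[of "diag i"] arc_ind_nonneg[of "diag i" x w] arc_ind_nonneg[of "diag i" y z]
        arc_ind_nonneg[of "diag i" w y] arc_ind_nonneg[of "diag i" z x] by arith+
  qed
  have pos: "(\<Prod>i\<in>{1..2 * n}. v i ^ nat (b i k)) = (\<phi> x w * \<phi> y z) * (\<Prod>i\<in>{1..n}. Y i ^ nat (s i))"
    unfolding split using v bm(1) bt prod_edge[OF edges_T(5)] prod_edge[OF edges_T(3)]
    by (simp add: power_add prod.distrib)
  have neg: "(\<Prod>i\<in>{1..2 * n}. v i ^ nat (- b i k)) = (\<phi> w y * \<phi> z x) * (\<Prod>i\<in>{1..n}. Y i ^ nat (- s i))"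
    unfolding split using v bm(2) bt prod_edge[OF edges_T(6)] prod_edge[OF edges_T(4)]
    by (simp add: power_add prod.distrib)
  have "(\<Prod>i\<in>{1..2 * n}. v i ^ nat (b i k)) + (\<Prod>i\<in>{1..2 * n}. v i ^ nat (- b i k)) = \<phi> x y * \<phi> w z"
    unfolding pos neg exchange[OF cyc4(1,2) vertices] s_def by (simp add: mult.commute)
  moreover have "v k = \<phi> x y" using v(1)[OF k] arck by simp
  ultimately show ?thesis
    unfolding mutate_cluster_def using phi_nonzero[OF vertices(1,3)] dist by simp
qed

lemma represents_mutation:
  assumes "represents v b diag T"
  shows "represents (mutate_cluster n k b v) (mutate_matrix k b) diag' T'"
  unfolding represents_def
proof (intro conjI ballI)
  show "triangulation n diag' T'" by (rule triangulation_flip)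
  have v: "v i = \<phi> (fst (diag i)) (snd (diag i))" "v (n + i) = Y i" if "i \<in> {1..n}" for i
    using assms that by (auto simp: represents_def)
  show "mutate_cluster n k b v i = \<phi> (fst (diag' i)) (snd (diag' i))" if "i \<in> {1..n}" for i
    using mutate_cluster_phi[OF assms] v(1)[OF that] by (cases "i = k") (auto simp: mutate_cluster_def)
  show "mutate_cluster n k b v (n + i) = Y i" if "i \<in> {1..n}" for i
    using v(2)[OF that] k that by (auto simp: mutate_cluster_def)
  show "mutate_matrix k b i j = shear (mrow diag' i) T' (diag' j)" if "i \<in> {1..2 * n}" "j \<in> {1..n}" for i j
    using assms unfolding represents_def by (intro mutate_matrix_shear[OF that]) auto
qed

end

context cluster_polygon
begin

lemma represents_flip:
  assumes "represents v b diag T" "k \<in> {1..n}" "diag k = (x, y)" "(x, y, z) \<in> T" "(y, x, w) \<in> T"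
  shows "represents (mutate_cluster n k b v) (mutate_matrix k b) (diag(k := (w, z))) (flip x y z w T)"
proof -
  have "triangulation n diag T" using assms(1) by (simp add: represents_def)
  then interpret mutation n diag T k x y z w \<phi> Y t
    using assms(2-5) cluster_polygon_axioms
    by (intro mutation.intro flippable.intro flippable_axioms.intro)
  show ?thesis by (rule represents_mutation[OF assms(1)])
qed

lemma seeds_represented:
  assumes init: "represents (fst (initial_seed n a cs)) (snd (initial_seed n a cs)) diag0 T0"
    and "(v, b) \<in> seeds n a cs"
  shows "\<exists>diag T. represents v b diag T"
  using assms(2)
proof (induction rule: seeds.induct[split_format(complete)])
  case initial
  then show ?case using init by (auto simp: initial_seed_def)
next
  case (mutation v b k)
  then obtain diag T where r: "represents v b diag T" by blast
  obtain x y where xy: "diag k = (x, y)" by force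
  have "triangulation n diag T" using r by (simp add: represents_def)
  then obtain z w where "(x, y, z) \<in> T" "(y, x, w) \<in> T"
    using triangulation.arcs[of n diag T k] mutation xy by (auto simp: edge_def)
  then show ?case using represents_flip[OF r mutation(2) xy] by blast
qed

lemma cluster_variable_phi:
  assumes init: "represents (fst (initial_seed n a cs)) (snd (initial_seed n a cs)) diag0 T0"
    and "u \<in> cluster_variables n a cs"
  shows "\<exists>p q. u = \<phi> p q \<and> p \<le> n + 2 \<and> q \<le> n + 2 \<and> p \<noteq> q \<and> \<not> boundary n p q \<and> \<not> boundary n q p"
proof -
  obtain v b i where v: "(v, b) \<in> seeds n a cs" "i \<in> {1..n}" "u = v i"
    using assms(2) by (auto simp: cluster_variables_def)
  obtain diag T where r: "represents v b diag T" using seeds_represented[OF init v(1)] by blast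
  then interpret triangulation n diag T by (simp add: represents_def)
  obtain p q where pq: "diag i = (p, q)" by force
  have e: "edge T p q" "edge T q p" using arcs[OF v(2)] pq by auto
  then obtain c where c: "(p, q, c) \<in> T" by (auto simp: edge_def)
  have "p \<le> n + 2" "q \<le> n + 2" "p \<noteq> q"
    using c rotate bounded cyc_distinct[OF oriented[OF c]] by blast+
  moreover have "u = \<phi> p q" using r v pq by (auto simp: represents_def)
  ultimately show ?thesis using boundary_not_rev e by blast
qed

end

section \<open>The initial triangulation and its exchange relations\<close>

lemma Var_nonzero: "Var i \<noteq> 0"
  by (metis Var_def lookup_single_eq lookup_zero zero_neq_one)

text \<open>\<open>pos\<close> inverts \<open>letter cs\<close>, and \<open>R s\<close> says that
  node s precedes node s + 1. The values of \<open>R\<close> at 0 and n are left free: they only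
  choose on which side the first and the last triangle add a vertex.\<close>

locale fan =
  fixes n :: nat and cs :: "nat list" and R :: "nat \<Rightarrow> bool" and pos :: "nat \<Rightarrow> nat"
  assumes n_pos: "1 \<le> n"
    and node: "i \<in> {1..n} \<Longrightarrow> letter cs i \<in> {1..n} \<and> pos (letter cs i) = i"
    and pos: "s \<in> {1..n} \<Longrightarrow> pos s \<in> {1..n} \<and> letter cs (pos s) = s"
    and R_pos: "1 \<le> s \<Longrightarrow> s < n \<Longrightarrow> R s \<longleftrightarrow> pos s < pos (Suc s)"
begin

text \<open>The initial triangulation consists of the nested diagonals from \<open>lft s\<close> to \<open>rgt s\<close>; passing
  from \<open>s\<close> to \<open>s + 1\<close> the vertex \<open>obs s\<close> is replaced by its outer neighbour \<open>nvx s\<close>.\<close>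

definition lft :: "nat \<Rightarrow> nat" where
  "lft s = card {t \<in> {s..n}. \<not> R t}"

text \<open>Diagonal s spans s + 1 sides of the polygon. For s = 0 and s = n + 1 it is itself a
  side, in the second case the one that joins n + 2 to 0.\<close>

definition rgt :: "nat \<Rightarrow> nat" where
  "rgt s = lft s + s + 1"

definition nvx :: "nat \<Rightarrow> nat" where
  "nvx s = (if R s then rgt (Suc s) else lft (Suc s))"

definition obs :: "nat \<Rightarrow> nat" where
  "obs s = (if R s then rgt s else lft s)"

lemma lft_Suc: "s \<le> n \<Longrightarrow> lft s = lft (Suc s) + of_bool (\<not> R s)"
proof -
  assume s: "s \<le> n"
  have "{t \<in> {s..n}. \<not> R t} = (if R s then {} else {s}) \<union> {t \<in> {Suc s..n}. \<not> R t}"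
    using s by (auto simp: Suc_le_eq) (metis le_neq_implies_less)
  moreover have "finite {t \<in> {Suc s..n}. \<not> R t}" "s \<notin> {t \<in> {Suc s..n}. \<not> R t}" by auto
  ultimately show ?thesis by (simp add: lft_def)
qed

lemma lft_top [simp]: "lft (Suc n) = 0"
  by (simp add: lft_def)

lemma rgt_top [simp]: "rgt (Suc n) = n + 2"
  by (simp add: rgt_def)

lemma lft_R: "s \<le> n \<Longrightarrow> R s \<Longrightarrow> lft (Suc s) = lft s" and lft_notR: "s \<le> n \<Longrightarrow> \<not> R s \<Longrightarrow> lft s = Suc (lft (Suc s))"
  by (simp_all add: lft_Suc)

lemma rgt_R: "s \<le> n \<Longrightarrow> R s \<Longrightarrow> rgt (Suc s) = Suc (rgt s)" and rgt_notR: "s \<le> n \<Longrightarrow> \<not> R s \<Longrightarrow> rgt (Suc s) = rgt s"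
  by (simp_all add: rgt_def lft_Suc)

lemma mono: "s \<le> s' \<Longrightarrow> s' \<le> Suc n \<Longrightarrow> lft s' \<le> lft s \<and> rgt s \<le> rgt s'"
proof (induction s' rule: dec_induct)
  case (step m)
  then have "m \<le> n" by simp
  then have "lft (Suc m) \<le> lft m \<and> rgt m \<le> rgt (Suc m)"
    by (cases "R m") (simp_all add: lft_R lft_notR rgt_R rgt_notR)
  then show ?case using step by auto
qed simp

lemma width: "rgt s = lft s + s + 1"
  by (rule rgt_def)

lemma lft_less_rgt: "lft s < rgt s"
  by (simp add: rgt_def)

lemma rgt_bound: "s \<le> Suc n \<Longrightarrow> rgt s \<le> n + 2"
  using mono[of s "Suc n"] by simp

lemma step_cases:
  assumes "s \<le> n"
  obtains (right) "R s" "nvx s = Suc (rgt s)" "obs s = rgt s" "lft (Suc s) = lft s" "rgt (Suc s) = Suc (rgt s)"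
  | (left) "\<not> R s" "lft s = Suc (nvx s)" "obs s = lft s" "lft (Suc s) = nvx s" "rgt (Suc s) = rgt s"
proof (cases "R s")
  case True
  show ?thesis
    by (rule that(1)[OF True]) (use True lft_R[OF assms True] rgt_R[OF assms True] in \<open>simp_all add: nvx_def obs_def\<close>)
next
  case False
  show ?thesis
    by (rule that(2)[OF False]) (use False lft_notR[OF assms False] rgt_notR[OF assms False] in \<open>simp_all add: nvx_def obs_def\<close>)
qed

lemma obs_inside: "s < j \<Longrightarrow> j \<le> Suc n \<Longrightarrow> lft j < obs s \<and> obs s < rgt j"
proof -
  assume a: "s < j" "j \<le> Suc n"
  then have s: "s \<le> n" by simp
  have "lft j \<le> lft (Suc s) \<and> rgt (Suc s) \<le> rgt j" using mono[of "Suc s" j] a by simp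
  then show ?thesis using s lft_less_rgt[of s] by (cases rule: step_cases[OF s]) auto
qed

lemma nvx_outside: "s \<le> n \<Longrightarrow> nvx s < lft s \<or> rgt s < nvx s"
  by (cases rule: step_cases[of s]) auto

section \<open>Plane vectors, coefficients and exchange relations\<close>

definition X :: "nat \<Rightarrow> mpol" where
  "X s = (if s \<in> {1..n} then Var (pos s) else 1)"

definition Yv :: "nat \<Rightarrow> mpol" where
  "Yv s = Var (n + pos s)"

definition lam :: "nat \<Rightarrow> nat \<Rightarrow> nat \<Rightarrow> int" where
  "lam s p q = of_bool (p \<in> {lft s..<rgt s} \<and> q \<in> {lft s..<rgt s})"

definition Yf :: "nat \<Rightarrow> mpol fract" where
  "Yf i = to_fract (Var (n + i))"

definition tt :: "nat \<Rightarrow> nat \<Rightarrow> nat \<Rightarrow> int" where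
  "tt i = lam (letter cs i)"

definition Yp :: "nat \<Rightarrow> nat \<Rightarrow> mpol fract" where
  "Yp p q = (\<Prod>i\<in>{1..n}. Yf i ^ nat (tt i p q))"

lemma lam_sym: "lam s p q = lam s q p"
  by (auto simp: lam_def)

lemma Yp_sym: "Yp p q = Yp q p"
  by (simp add: Yp_def tt_def lam_sym)

lemma X_nonzero: "X s \<noteq> 0"
  by (simp add: X_def Var_nonzero)

lemma Yf_nonzero: "Yf i \<noteq> 0"
  by (simp add: Yf_def Var_nonzero)

lemma Yp_nonzero: "Yp p q \<noteq> 0"
  by (simp add: Yp_def Yf_nonzero)

text \<open>The relation could fail only if two opposite corners lie in the interval and the other
  two outside. Between two points of an interval one of the two arcs stays inside it, so this does
  not happen.\<close>

lemma lam_tropical: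
  assumes c: "cyc x w y" "cyc y z x"
  shows "lam s x y + lam s w z = min (lam s x w + lam s y z) (lam s w y + lam s z x)"
proof -
  let ?S = "{lft s..<rgt s}"
  have conv: "b \<in> ?S \<or> d \<in> ?S" if "a \<in> ?S" "e \<in> ?S" "cyc a b e" "cyc e d a" for a b d e
    using that unfolding cyc_def by auto
  have 1: "\<not> (x \<in> ?S \<and> y \<in> ?S \<and> w \<notin> ?S \<and> z \<notin> ?S)" using conv[of x y w z] c by blast
  have "cyc w y z" "cyc z x w" using cyc_quadrilateral[OF c] .
  then have 2: "\<not> (w \<in> ?S \<and> z \<in> ?S \<and> x \<notin> ?S \<and> y \<notin> ?S)" using conv[of w z y x] by blast
  show ?thesis
    using 1 2 unfolding lam_def
    by (cases "x \<in> ?S"; cases "y \<in> ?S"; cases "w \<in> ?S"; cases "z \<in> ?S") (simp_all only:, simp_all)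
qed

text \<open>The prescribed determinants: \<open>Gv s\<close> on the initial diagonal s, so that its
  normalised value becomes \<open>X s\<close>, and \<open>Ev s\<close> on the side between
  \<open>obs s\<close> and \<open>nvx s\<close>, whose normalised value becomes 1.\<close>

definition Gv :: "nat \<Rightarrow> mpol fract" where
  "Gv s = to_fract (X s) * Yp (lft s) (rgt s)"

definition Ev :: "nat \<Rightarrow> mpol fract" where
  "Ev s = Yp (obs s) (nvx s)"

lemma Gv_nonzero: "Gv s \<noteq> 0"
  by (simp add: Gv_def X_nonzero Yp_nonzero)

text \<open>Vertices are realised by plane vectors, so that the Ptolemy relations become Pluecker
  relations between determinants; each new vector is determined by two prescribed
  determinants.\<close>

primrec vecs :: "nat \<Rightarrow> nat \<Rightarrow> mpol fract \<times> mpol fract" where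
  "vecs 0 = (\<lambda>_. (0, 0))(lft 0 := (1, 0), rgt 0 := (0, Gv 0))"
| "vecs (Suc s) = (let u = vecs s (lft s); v = vecs s (rgt s);
      \<alpha> = (if R s then - Ev s / Gv s else Gv (Suc s) / Gv s);
      \<beta> = (if R s then Gv (Suc s) / Gv s else - Ev s / Gv s)
    in (vecs s)(nvx s := (\<alpha> * fst u + \<beta> * fst v, \<alpha> * snd u + \<beta> * snd v)))"

definition det2 :: "mpol fract \<times> mpol fract \<Rightarrow> mpol fract \<times> mpol fract \<Rightarrow> mpol fract" where
  "det2 u v = fst u * snd v - snd u * fst v"

lemma vecs_stable: "s \<le> s' \<Longrightarrow> s' \<le> Suc n \<Longrightarrow> p \<in> {lft s..rgt s} \<Longrightarrow> vecs s' p = vecs s p"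
proof (induction s' rule: dec_induct)
  case (step m)
  have "lft m \<le> lft s \<and> rgt s \<le> rgt m" using mono[of s m] step by simp
  then have "p \<noteq> nvx m" using nvx_outside[of m] step by auto
  then show ?case using step by (simp add: Let_def)
qed simp

definition vec :: "nat \<Rightarrow> mpol fract \<times> mpol fract" where
  "vec = vecs (Suc n)"

lemma vec_eq: "s \<le> Suc n \<Longrightarrow> p \<in> {lft s..rgt s} \<Longrightarrow> vec p = vecs s p"
  unfolding vec_def by (rule vecs_stable) auto

text \<open>Determinants are antisymmetric while a diagonal has no direction; the order of the
  vertices fixes the sign.\<close>

definition D :: "nat \<Rightarrow> nat \<Rightarrow> mpol fract" where
  "D p q = (if p \<le> q then det2 (vec p) (vec q) else det2 (vec q) (vec p))"

lemma D_sym: "D p q = D q p"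
  by (simp add: D_def)

lemma det2_comb:
  "det2 u (\<alpha> * fst u + \<beta> * fst v, \<alpha> * snd u + \<beta> * snd v) = \<beta> * det2 u v"
  "det2 v (\<alpha> * fst u + \<beta> * fst v, \<alpha> * snd u + \<beta> * snd v) = - (\<alpha> * det2 u v)"
  by (simp_all add: det2_def algebra_simps)

lemma det2_anti: "det2 u v = - det2 v u"
  by (simp add: det2_def)

text \<open>Both values belong to one induction: the vector added at step s is a combination of the
  vectors at the ends of diagonal s, whose determinant is already known to be \<open>Gv s\<close>,
  and its two coefficients were chosen to give the two claims.\<close>

lemma D_gamma: "s \<le> Suc n \<Longrightarrow> D (lft s) (rgt s) = Gv s"
  and D_step: "s \<le> n \<Longrightarrow> D (obs s) (nvx s) = Ev s"
proof -
  have base: "vecs s (lft s) = vec (lft s)" "vecs s (rgt s) = vec (rgt s)" if "s \<le> Suc n" for s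
    using vec_eq[OF that, of "lft s"] vec_eq[OF that, of "rgt s"] lft_less_rgt[of s] by auto
  have both: "(s \<le> Suc n \<longrightarrow> det2 (vec (lft s)) (vec (rgt s)) = Gv s) \<and>
     (s \<le> n \<longrightarrow> D (obs s) (nvx s) = Ev s)" for s
  proof -
    have stp: "det2 (vec (lft (Suc s))) (vec (rgt (Suc s))) = Gv (Suc s) \<and> D (obs s) (nvx s) = Ev s"
      if s: "s \<le> n" and G: "det2 (vec (lft s)) (vec (rgt s)) = Gv s" for s
    proof -
      let ?u = "vec (lft s)" and ?v = "vec (rgt s)"
      have nb: "nvx s \<in> {lft (Suc s)..rgt (Suc s)}"
        using lft_less_rgt[of "Suc s"] by (auto simp: nvx_def)
      have nv: "vec (nvx s) = vecs (Suc s) (nvx s)"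
        using s nb by (intro vec_eq) auto
      note b = base[of s]
      from s show ?thesis
      proof (cases rule: step_cases)
        case right
        have v: "vec (nvx s) = ((- Ev s / Gv s) * fst ?u + (Gv (Suc s) / Gv s) * fst ?v,
            (- Ev s / Gv s) * snd ?u + (Gv (Suc s) / Gv s) * snd ?v)"
          unfolding nv using right(1) b s by (simp add: Let_def)
        have "det2 (vec (lft (Suc s))) (vec (rgt (Suc s))) = det2 ?u (vec (nvx s))"
          using right by simp
        also have "\<dots> = Gv (Suc s)" unfolding v det2_comb G using Gv_nonzero by simp
        finally have 1: "det2 (vec (lft (Suc s))) (vec (rgt (Suc s))) = Gv (Suc s)" .
        have "D (obs s) (nvx s) = det2 ?v (vec (nvx s))"
          using right by (simp add: D_def)
        also have "\<dots> = Ev s" unfolding v det2_comb G using Gv_nonzero by simp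
        finally show ?thesis using 1 by blast
      next
        case left
        have v: "vec (nvx s) = ((Gv (Suc s) / Gv s) * fst ?u + (- Ev s / Gv s) * fst ?v,
            (Gv (Suc s) / Gv s) * snd ?u + (- Ev s / Gv s) * snd ?v)"
          unfolding nv using left(1) b s by (simp add: Let_def)
        have "det2 (vec (lft (Suc s))) (vec (rgt (Suc s))) = - det2 ?v (vec (nvx s))"
          using left det2_anti[of "vec (nvx s)" ?v] by simp
        also have "\<dots> = Gv (Suc s)" unfolding v det2_comb G using Gv_nonzero by simp
        finally have 1: "det2 (vec (lft (Suc s))) (vec (rgt (Suc s))) = Gv (Suc s)" .
        have "D (obs s) (nvx s) = - det2 ?u (vec (nvx s))"
          using left det2_anti[of "vec (nvx s)" ?u] by (simp add: D_def)
        also have "\<dots> = Ev s" unfolding v det2_comb G using Gv_nonzero by simp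
        finally show ?thesis using 1 by blast
      qed
    qed
    have G: "s \<le> Suc n \<Longrightarrow> det2 (vec (lft s)) (vec (rgt s)) = Gv s" for s
    proof (induction s)
      case 0
      have "vec (lft 0) = (1, 0)" "vec (rgt 0) = (0, Gv 0)"
        using base[of 0] lft_less_rgt[of 0] by simp_all
      then show ?case by (simp add: det2_def)
    next
      case (Suc s)
      then show ?case using stp[of s] by simp
    qed
    show ?thesis using G stp by simp
  qed
  show "s \<le> Suc n \<Longrightarrow> D (lft s) (rgt s) = Gv s" using both[of s] lft_less_rgt[of s] by (simp add: D_def)
  show "s \<le> n \<Longrightarrow> D (obs s) (nvx s) = Ev s" using both[of s] by simp
qed

lemma pluecker:
  "det2 a c * det2 b d = det2 a b * det2 c d + det2 b c * det2 a d"
  by (simp add: det2_def algebra_simps)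

text \<open>For vertices in increasing order this is the Pluecker relation. The other positions of
  the cyclic order are rotations of it, absorbed by the symmetry of \<open>D\<close>.\<close>

lemma D_ptolemy:
  assumes "cyc x w y" "cyc y z x"
  shows "D x y * D w z = D x w * D y z + D w y * D z x"
proof -
  have *: "D a c * D b d = D a b * D c d + D b c * D a d" if "a < b" "b < c" "c < d" for a b c d
  proof -
    have "D a c = det2 (vec a) (vec c)" "D b d = det2 (vec b) (vec d)" "D a b = det2 (vec a) (vec b)"
      "D c d = det2 (vec c) (vec d)" "D b c = det2 (vec b) (vec c)" "D a d = det2 (vec a) (vec d)"
      using that by (simp_all add: D_def)
    then show ?thesis by (simp only: pluecker[of "vec a" "vec c" "vec b" "vec d"])
  qed
  have "x \<noteq> y" using cyc_distinct[OF assms(1)] by simp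
  then consider "x < w" "w < y" "y < z" | "w < y" "y < z" "z < x" | "y < z" "z < x" "x < w" | "z < x" "x < w" "w < y"
    using assms unfolding cyc_def by (meson less_asym less_trans linorder_neqE_nat)
  then show ?thesis
  proof cases
    case 1
    show ?thesis using *[OF 1] D_sym[of z x] by metis
  next
    case 2
    show ?thesis using *[OF 2] D_sym[of y x] D_sym[of w x] by (metis add.commute mult.commute)
  next
    case 3
    show ?thesis using *[OF 3] D_sym[of y x] D_sym[of z w] D_sym[of y w] by (metis add.commute mult.commute)
  next
    case 4
    show ?thesis using *[OF 4] D_sym[of z w] D_sym[of z y] by (metis add.commute mult.commute)
  qed
qed

definition phi :: "nat \<Rightarrow> nat \<Rightarrow> mpol fract" where
  "phi p q = D p q / Yp p q"

lemma phi_sym: "phi p q = phi q p"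
  by (simp add: phi_def D_sym Yp_sym)

lemma phi_gamma: "s \<le> Suc n \<Longrightarrow> phi (lft s) (rgt s) = to_fract (X s)"
  by (simp add: phi_def D_gamma Gv_def Yp_nonzero)

lemma phi_step: "s \<le> n \<Longrightarrow> phi (obs s) (nvx s) = 1"
  by (simp add: phi_def D_step Ev_def Yp_nonzero)

lemma lam_nonneg: "0 \<le> lam s p q"
  by (simp add: lam_def)

text \<open>Divide the relation for \<open>D\<close> by \<open>Yp x y * Yp w z\<close>. By the
  tropical relation each exponent of this product is the minimum of the exponents in the two terms
  on the right, so every term keeps just its excess over the minimum.\<close>

lemma phi_exchange:
  assumes c: "cyc x w y" "cyc y z x"
  shows "phi x y * phi w z =
        (\<Prod>i\<in>{1..n}. Yf i ^ nat (tt i x w + tt i y z - (tt i w y + tt i z x))) * (phi x w * phi y z) +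
        (\<Prod>i\<in>{1..n}. Yf i ^ nat (tt i w y + tt i z x - (tt i x w + tt i y z))) * (phi w y * phi z x)"
proof -
  define A where "A i = tt i x w + tt i y z" for i
  define B where "B i = tt i w y + tt i z x" for i
  have tr: "tt i x y + tt i w z = min (A i) (B i)" for i
    unfolding A_def B_def tt_def by (rule lam_tropical[OF c])
  have nn: "0 \<le> tt i p q" for i p q by (simp add: tt_def lam_nonneg)
  have eA: "Yf i ^ nat (tt i x w) * Yf i ^ nat (tt i y z) =
    Yf i ^ nat (A i - B i) * (Yf i ^ nat (tt i x y) * Yf i ^ nat (tt i w z))" for i
  proof -
    have "nat (tt i x w) + nat (tt i y z) = nat (A i - B i) + (nat (tt i x y) + nat (tt i w z))"
      using tr[of i] nn[of i x w] nn[of i y z] nn[of i x y] nn[of i w z] unfolding A_def B_def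
      by (auto simp: min_def nat_add_distrib[symmetric] split: if_splits)
    then show ?thesis by (simp only: power_add[symmetric])
  qed
  have eB: "Yf i ^ nat (tt i w y) * Yf i ^ nat (tt i z x) =
    Yf i ^ nat (B i - A i) * (Yf i ^ nat (tt i x y) * Yf i ^ nat (tt i w z))" for i
  proof -
    have "nat (tt i w y) + nat (tt i z x) = nat (B i - A i) + (nat (tt i x y) + nat (tt i w z))"
      using tr[of i] nn[of i w y] nn[of i z x] nn[of i x y] nn[of i w z] unfolding A_def B_def
      by (auto simp: min_def nat_add_distrib[symmetric] split: if_splits)
    then show ?thesis by (simp only: power_add[symmetric])
  qed
  let ?PA = "\<Prod>i\<in>{1..n}. Yf i ^ nat (A i - B i)" and ?PB = "\<Prod>i\<in>{1..n}. Yf i ^ nat (B i - A i)"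
  have pA: "Yp x w * Yp y z = ?PA * (Yp x y * Yp w z)"
    unfolding Yp_def prod.distrib[symmetric] by (intro prod.cong refl eA)
  have pB: "Yp w y * Yp z x = ?PB * (Yp x y * Yp w z)"
    unfolding Yp_def prod.distrib[symmetric] by (intro prod.cong refl eB)
  have ph: "D p q = phi p q * Yp p q" for p q by (simp add: phi_def Yp_nonzero)
  have "phi x y * phi w z * (Yp x y * Yp w z) = D x y * D w z"
    by (simp add: ph mult_ac)
  also have "\<dots> = (phi x w * phi y z) * (Yp x w * Yp y z) + (phi w y * phi z x) * (Yp w y * Yp z x)"
    unfolding D_ptolemy[OF c] by (simp add: ph mult_ac)
  also have "\<dots> = (?PA * (phi x w * phi y z) + ?PB * (phi w y * phi z x)) * (Yp x y * Yp w z)"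
    unfolding pA pB by (simp add: algebra_simps)
  finally show ?thesis
    using Yp_nonzero[of x y] Yp_nonzero[of w z] unfolding A_def B_def by simp
qed

lemma rgt_reaches: "rgt 0 \<le> p \<Longrightarrow> p \<le> rgt m \<Longrightarrow> m \<le> Suc n \<Longrightarrow> p \<noteq> rgt 0 \<Longrightarrow> \<exists>s<m. R s \<and> Suc (rgt s) = p"
proof (induction m)
  case (Suc m)
  show ?case
  proof (cases "p \<le> rgt m")
    case True
    then show ?thesis using Suc by (auto simp: less_Suc_eq)
  next
    case False
    have m: "m \<le> n" using Suc by simp
    then show ?thesis using False Suc.prems by (cases rule: step_cases[OF m]) (auto intro!: exI[of _ m])
  qed
qed simp

lemma lft_reaches: "p < lft 0 \<Longrightarrow> lft m \<le> p \<Longrightarrow> m \<le> Suc n \<Longrightarrow> \<exists>s<m. \<not> R s \<and> lft s = Suc p"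
proof (induction m)
  case (Suc m)
  show ?case
  proof (cases "lft m \<le> p")
    case True
    then show ?thesis using Suc by (auto simp: less_Suc_eq)
  next
    case False
    have m: "m \<le> n" using Suc by simp
    then show ?thesis using False Suc.prems by (cases rule: step_cases[OF m]) (auto intro!: exI[of _ m])
  qed
qed simp

lemma phi_boundary:
  assumes "boundary n p q" "p \<le> n + 2" "q \<le> n + 2"
  shows "phi p q = 1"
proof -
  consider "p = n + 2" "q = 0" | "q = Suc p" using assms(1) by (auto simp: boundary_def)
  then show ?thesis
  proof cases
    case 1
    then show ?thesis using phi_gamma[of "Suc n"] phi_sym[of 0 "n + 2"] by (simp add: X_def)
  next
    case 2
    consider "p < lft 0" | "p = lft 0" | "rgt 0 \<le> p" using width[of 0] by linarith
    then show ?thesis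
    proof cases
      case 1
      then obtain s where "s < Suc n" "\<not> R s" "lft s = Suc p" using lft_reaches[of p "Suc n"] by auto
      then show ?thesis using 2 phi_step[of s] phi_sym[of p q] lft_notR[of s] by (simp add: obs_def nvx_def)
    next
      case 2
      then show ?thesis using \<open>q = Suc p\<close> phi_gamma[of 0] width[of 0] by (simp add: X_def)
    next
      case 3
      then obtain s where "s < Suc n" "R s" "Suc (rgt s) = q"
        using rgt_reaches[of q "Suc n"] assms 2 by auto
      then show ?thesis using 2 phi_step[of s] rgt_R[of s] by (simp add: obs_def nvx_def)
    qed
  qed
qed

lemma vertex_cases: "s \<le> Suc n \<Longrightarrow> p \<in> {lft s..rgt s} \<Longrightarrow> p = lft s \<or> p = rgt s \<or> (\<exists>i<s. p = obs i)"
proof (induction s)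
  case 0
  then show ?case using width[of 0] by auto
next
  case (Suc s)
  have s: "s \<le> n" using Suc by simp
  show ?case
  proof (cases "p \<in> {lft s..rgt s}")
    case True
    then consider "p = lft s" | "p = rgt s" | "\<exists>i<s. p = obs i" using Suc by auto
    then show ?thesis
    proof cases
      case 3
      then show ?thesis using less_Suc_eq by blast
    qed (cases rule: step_cases[OF s]; force)+
  next
    case False
    then show ?thesis using Suc.prems by (cases rule: step_cases[OF s]) auto
  qed
qed

text \<open>Each step adds the single vertex \<open>nvx s\<close>. The pairs {obs i, nvx j} are
  sides for i = j; for i < j they cross the initial diagonals i + 1, ..., j and belong to the root
  with this support.\<close>

lemma pair_cases:
  "s \<le> Suc n \<Longrightarrow> p \<in> {lft s..rgt s} \<Longrightarrow> q \<in> {lft s..rgt s} \<Longrightarrow> p \<noteq> q \<Longrightarrow>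
     (\<exists>u\<le>s. {p, q} = {lft u, rgt u}) \<or> (\<exists>i j. i \<le> j \<and> j < s \<and> {p, q} = {obs i, nvx j})"
proof (induction s)
  case 0
  then have "{p, q} = {lft 0, rgt 0}" using width[of 0] by auto
  then show ?case by auto
next
  case (Suc s)
  have s: "s \<le> n" using Suc by simp
  have new: "(\<exists>u\<le>Suc s. {p, q} = {lft u, rgt u}) \<or> (\<exists>i j. i \<le> j \<and> j < Suc s \<and> {p, q} = {obs i, nvx j})"
    if pq: "q = nvx s" "p \<in> {lft s..rgt s}" for p q
  proof -
    consider "\<exists>i<s. p = obs i" | "p = obs s" | "{p, q} = {lft (Suc s), rgt (Suc s)}"
    proof -
      have vc: "p = lft s \<or> p = rgt s \<or> (\<exists>i<s. p = obs i)" using vertex_cases[of s p] pq(2) s by simp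
      have "(\<exists>i<s. p = obs i) \<or> p = obs s \<or> {p, q} = {lft (Suc s), rgt (Suc s)}"
        using vc pq(1) by (cases rule: step_cases[OF s]) auto
      then show ?thesis using that by blast
    qed
    then show ?thesis
    proof cases
      case 1
      then show ?thesis using that by (auto simp: less_Suc_eq_le intro: less_imp_le)
    next
      case 2
      then show ?thesis using that by (intro disjI2 exI[of _ s]) auto
    qed auto
  qed
  have out: "x = nvx s" if "x \<in> {lft (Suc s)..rgt (Suc s)}" "x \<notin> {lft s..rgt s}" for x
    using that by (cases rule: step_cases[OF s]) auto
  show ?case
  proof (cases "p \<in> {lft s..rgt s} \<and> q \<in> {lft s..rgt s}")
    case True
    have "s \<le> Suc n" using s by simp
    from Suc.IH[OF this] True Suc.prems(4)
    have "(\<exists>u\<le>s. {p, q} = {lft u, rgt u}) \<or> (\<exists>i j. i \<le> j \<and> j < s \<and> {p, q} = {obs i, nvx j})" by blast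
    then show ?thesis
    proof
      assume "\<exists>u\<le>s. {p, q} = {lft u, rgt u}"
      then show ?thesis using le_SucI by blast
    next
      assume "\<exists>i j. i \<le> j \<and> j < s \<and> {p, q} = {obs i, nvx j}"
      then show ?thesis using less_SucI by blast
    qed
  next
    case False
    show ?thesis
    proof (cases "q \<in> {lft s..rgt s}")
      case True
      then have "p = nvx s" using False out Suc.prems by blast
      then show ?thesis using new[of p q] True by (simp add: insert_commute)
    next
      case qF: False
      then have "q = nvx s" using out Suc.prems by blast
      moreover have "p \<in> {lft s..rgt s}" using out[of p] Suc.prems calculation by blast
      ultimately show ?thesis using new[of q p] by simp
    qed
  qed
qed

end

section \<open>Laurent forms and F-polynomials\<close>

definition mon :: "(nat \<Rightarrow> mpol) \<Rightarrow> (nat \<Rightarrow>\<^sub>0 nat) \<Rightarrow> mpol" where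
  "mon f m = (\<Prod>i\<in>Poly_Mapping.keys m. f i ^ Poly_Mapping.lookup m i)"

lemma mon_superset:
  assumes "finite A" "Poly_Mapping.keys m \<subseteq> A"
  shows "mon f m = (\<Prod>i\<in>A. f i ^ Poly_Mapping.lookup m i)"
  unfolding mon_def using assms by (intro prod.mono_neutral_left) (auto simp: in_keys_iff)

lemma mon_shift: "mon f (Poly_Mapping.single i 1 + m) = f i * mon f m"
proof -
  let ?A = "insert i (Poly_Mapping.keys m)"
  have "mon f (Poly_Mapping.single i 1 + m) = (\<Prod>k\<in>?A. f k ^ Poly_Mapping.lookup (Poly_Mapping.single i 1 + m) k)"
    using keys_add[of "Poly_Mapping.single i 1" m] by (intro mon_superset) auto
  also have "\<dots> = (\<Prod>k\<in>?A. f k ^ (1 when i = k)) * (\<Prod>k\<in>?A. f k ^ Poly_Mapping.lookup m k)"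
    by (simp only: lookup_add lookup_single power_add prod.distrib)
  also have "(\<Prod>k\<in>?A. f k ^ (1 when i = k)) = (\<Prod>k\<in>{i}. f k ^ (1 when i = k))"
    by (intro prod.mono_neutral_right) auto
  also have "(\<Prod>k\<in>?A. f k ^ Poly_Mapping.lookup m k) = mon f m"
    by (intro mon_superset[symmetric]) auto
  finally show ?thesis by simp
qed

lemma mpol_subst_superset:
  assumes "finite A" "Poly_Mapping.keys p \<subseteq> A"
  shows "mpol_subst f p = (\<Sum>m\<in>A. of_int (Poly_Mapping.lookup p m) * mon f m)"
  unfolding mpol_subst_def mon_def[symmetric] using assms
  by (intro sum.mono_neutral_left) (auto simp: in_keys_iff)

lemma mpol_subst_add: "mpol_subst f (p + q) = mpol_subst f p + mpol_subst f q"
proof -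
  let ?A = "Poly_Mapping.keys p \<union> Poly_Mapping.keys q"
  have "mpol_subst f r = (\<Sum>m\<in>?A. of_int (Poly_Mapping.lookup r m) * mon f m)"
    if "r \<in> {p, q, p + q}" for r
    using that keys_add[of p q] by (intro mpol_subst_superset) auto
  then show ?thesis by (simp add: lookup_add algebra_simps sum.distrib)
qed

lemma mpol_subst_0 [simp]: "mpol_subst f 0 = 0"
  by (simp add: mpol_subst_def)

lemma mpol_subst_sum: "mpol_subst f (\<Sum>x\<in>A. g x) = (\<Sum>x\<in>A. mpol_subst f (g x))"
  by (induction A rule: infinite_finite_induct) (simp_all add: mpol_subst_add)

lemma mpol_subst_single: "mpol_subst f (Poly_Mapping.single m c) = of_int c * mon f m"
  using mpol_subst_superset[of "{m}" "Poly_Mapping.single m c" f] by (simp add: lookup_single)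

lemma mpol_expand: "(\<Sum>m\<in>Poly_Mapping.keys p. Poly_Mapping.single m (Poly_Mapping.lookup p m)) = (p :: mpol)"
proof (rule poly_mapping_eqI)
  fix k
  have "Poly_Mapping.lookup (\<Sum>m\<in>Poly_Mapping.keys p. Poly_Mapping.single m (Poly_Mapping.lookup p m)) k =
    (\<Sum>m\<in>Poly_Mapping.keys p. if m = k then Poly_Mapping.lookup p m else 0)"
    unfolding lookup_sum lookup_single by (intro sum.cong) (auto simp: when_def)
  also have "\<dots> = Poly_Mapping.lookup p k"
    by (simp add: in_keys_iff)
  finally show "Poly_Mapping.lookup (\<Sum>m\<in>Poly_Mapping.keys p. Poly_Mapping.single m (Poly_Mapping.lookup p m)) k =
    Poly_Mapping.lookup p k" .
qed

lemma Var_mult_expand: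
  "Var i * p = (\<Sum>m\<in>Poly_Mapping.keys p. Poly_Mapping.single (Poly_Mapping.single i 1 + m) (Poly_Mapping.lookup p m))"
  by (subst mpol_expand[of p, symmetric]) (simp add: sum_distrib_left Var_def mult_single)

lemma mpol_subst_Var_mult [simp]: "mpol_subst f (Var i * p) = f i * mpol_subst f p"
proof -
  have "mpol_subst f (Var i * p) = (\<Sum>m\<in>Poly_Mapping.keys p. of_int (Poly_Mapping.lookup p m) * (f i * mon f m))"
    unfolding Var_mult_expand mpol_subst_sum mpol_subst_single mon_shift ..
  also have "\<dots> = f i * mpol_subst f p"
    by (simp add: mpol_subst_superset[of "Poly_Mapping.keys p"] sum_distrib_left mult_ac)
  finally show ?thesis .
qed

lemma mpol_subst_1 [simp]: "mpol_subst f 1 = 1"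
  using mpol_subst_single[of f 0 1] by (simp add: mon_def)

lemma lookup_Var_mult: "Poly_Mapping.lookup (Var i * p) (Poly_Mapping.single i 1 + m) = Poly_Mapping.lookup p m"
proof -
  have "Poly_Mapping.lookup (Var i * p) (Poly_Mapping.single i 1 + m) =
     (\<Sum>m'\<in>Poly_Mapping.keys p. if m' = m then Poly_Mapping.lookup p m' else 0)"
    unfolding Var_mult_expand lookup_sum lookup_single by (intro sum.cong) (auto simp: when_def)
  then show ?thesis by (simp add: in_keys_iff)
qed

lemma keys_Var_mult: "Poly_Mapping.keys (Var i * p) = (+) (Poly_Mapping.single i 1) ` Poly_Mapping.keys p"
proof
  show "Poly_Mapping.keys (Var i * p) \<subseteq> (+) (Poly_Mapping.single i 1) ` Poly_Mapping.keys p"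
    unfolding Var_mult_expand
    by (rule order.trans[OF keys_sum]) (auto split: if_splits)
  show "(+) (Poly_Mapping.single i 1) ` Poly_Mapping.keys p \<subseteq> Poly_Mapping.keys (Var i * p)"
    by (auto simp: in_keys_iff lookup_Var_mult simp del: One_nat_def)
qed

lemma Var_dvd_iff: "Var i dvd p \<longleftrightarrow> (\<forall>m\<in>Poly_Mapping.keys p. Poly_Mapping.lookup m i \<noteq> 0)"
proof
  assume "Var i dvd p"
  then obtain r where "p = Var i * r" by (elim dvdE)
  then show "\<forall>m\<in>Poly_Mapping.keys p. Poly_Mapping.lookup m i \<noteq> 0"
    by (auto simp: keys_Var_mult lookup_add)
next
  assume a: "\<forall>m\<in>Poly_Mapping.keys p. Poly_Mapping.lookup m i \<noteq> 0"
  have "Var i dvd Poly_Mapping.single m c" if m: "Poly_Mapping.lookup m i \<noteq> 0" for m and c :: int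
  proof -
    have "m = Poly_Mapping.single i 1 + (m - Poly_Mapping.single i 1)"
      using m by (intro poly_mapping_eqI) (auto simp: lookup_add lookup_minus lookup_single when_def)
    then have "Poly_Mapping.single m c = Var i * Poly_Mapping.single (m - Poly_Mapping.single i 1) c"
      by (simp add: Var_def mult_single)
    then show ?thesis by simp
  qed
  then have "Var i dvd (\<Sum>m\<in>Poly_Mapping.keys p. Poly_Mapping.single m (Poly_Mapping.lookup p m))"
    using a by (intro dvd_sum) auto
  then show "Var i dvd p" by (simp only: mpol_expand)
qed

lemma Var_dvd_Var_mult: "i \<noteq> j \<Longrightarrow> Var i dvd Var j * p \<longleftrightarrow> Var i dvd p"
  by (simp add: Var_dvd_iff keys_Var_mult lookup_add lookup_single)

lemma Var_dvd_prod:
  assumes "finite A" "\<And>i. i \<in> A \<Longrightarrow> i = j \<Longrightarrow> a i = 0"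
  shows "Var j dvd (\<Prod>i\<in>A. Var i ^ a i) * p \<longleftrightarrow> Var j dvd p"
  using assms
proof (induction A)
  case (insert i A)
  have pw: "Var j dvd Var i ^ e * r \<longleftrightarrow> Var j dvd r" if "i = j \<longrightarrow> e = 0" for e r
  proof (cases "i = j")
    case False
    then show ?thesis by (induction e) (simp_all add: Var_dvd_Var_mult mult.assoc)
  qed (use that in simp)
  have "Var j dvd (\<Prod>i\<in>insert i A. Var i ^ a i) * p \<longleftrightarrow> Var j dvd Var i ^ a i * ((\<Prod>i\<in>A. Var i ^ a i) * p)"
    using insert by (simp add: mult.assoc)
  also have "\<dots> \<longleftrightarrow> Var j dvd (\<Prod>i\<in>A. Var i ^ a i) * p" using insert by (intro pw) auto
  finally show ?case using insert by simp
qed simp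

lemma not_Var_dvd_1: "\<not> Var i dvd 1"
  by (simp add: Var_dvd_iff)

lemma not_Var_dvd_subst: "mpol_subst f p \<noteq> 0 \<Longrightarrow> f i = 0 \<Longrightarrow> \<not> Var i dvd p"
  by (auto elim!: dvdE)

lemma to_fract_prod_mpol: "to_fract (\<Prod>i\<in>A. f i :: mpol) = (\<Prod>i\<in>A. to_fract (f i))"
  by (induction A rule: infinite_finite_induct) simp_all

lemma to_fract_power_mpol: "to_fract ((a :: mpol) ^ e) = to_fract a ^ e"
  by (induction e) simp_all

text \<open>After clearing denominators, a variable with different exponents in the two forms would
  divide one of the numerators, which the definition excludes.\<close>

lemma laurent_form_unique:
  assumes "laurent_form n u p d" "laurent_form n u p' d'"
  shows "p = p' \<and> (\<forall>i\<in>{1..n}. d i = d' i)"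
proof -
  let ?x = "\<lambda>i. to_fract (Var i) :: mpol fract"
  have x0: "?x i \<noteq> 0" for i by (simp add: Var_nonzero)
  have pw: "?x i powi e = ?x i powi (min e e') * ?x i ^ nat (e - e')" for i e e'
  proof -
    have "e = min e e' + int (nat (e - e'))" by (simp add: min_def)
    then have "?x i powi e = ?x i powi (min e e' + int (nat (e - e')))" by (rule arg_cong)
    also have "\<dots> = ?x i powi (min e e') * ?x i ^ nat (e - e')"
      unfolding power_int_add[OF disjI1[OF x0]] power_int_of_nat ..
    finally show ?thesis .
  qed
  \<comment> \<open>The common part of both denominators. What remains are monomials with
    nonnegative exponents and no common variable, so cross-multiplication takes place in the
    polynomial ring.\<close>
  define M where "M = (\<Prod>i\<in>{1..n}. ?x i powi (min (d i) (d' i)))"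
  have M0: "M \<noteq> 0" by (simp add: M_def power_int_eq_0_iff Var_nonzero)
  have d1: "(\<Prod>i\<in>{1..n}. ?x i powi d i) = M * to_fract (\<Prod>i\<in>{1..n}. Var i ^ nat (d i - d' i))"
    unfolding M_def to_fract_prod_mpol to_fract_power_mpol prod.distrib[symmetric]
    by (intro prod.cong refl pw)
  have d2: "(\<Prod>i\<in>{1..n}. ?x i powi d' i) = M * to_fract (\<Prod>i\<in>{1..n}. Var i ^ nat (d' i - d i))"
    unfolding M_def to_fract_prod_mpol to_fract_power_mpol prod.distrib[symmetric]
    by (intro prod.cong refl) (subst min.commute, rule pw)
  define A where "A = (\<Prod>i\<in>{1..n}. Var i ^ nat (d i - d' i))"
  define B where "B = (\<Prod>i\<in>{1..n}. Var i ^ nat (d' i - d i))"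
  have AB0: "A \<noteq> 0" "B \<noteq> 0" by (simp_all add: A_def B_def Var_nonzero)
  have "to_fract p / (M * to_fract A) = to_fract p' / (M * to_fract B)"
    using assms unfolding laurent_form_def d1 d2 A_def B_def by simp
  then have "to_fract p * to_fract B = to_fract p' * to_fract A"
    using M0 AB0 by (simp add: field_simps)
  then have "to_fract (B * p) = to_fract (A * p')" by (simp add: mult.commute)
  then have eq: "B * p = A * p'" by (simp only: to_fract_eq_iff)
  have dd: "d j = d' j" if j: "j \<in> {1..n}" for j
  proof (rule ccontr)
    assume "d j \<noteq> d' j"
    then consider "d j < d' j" | "d' j < d j" by linarith
    then show False
    proof cases
      case 1
      then have "Var j dvd Var j ^ nat (d' j - d j)" by (intro dvd_power) auto
      also have "\<dots> dvd B" unfolding B_def using j by (intro dvd_prodI) auto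
      finally have "Var j dvd A * p'" unfolding eq[symmetric] by simp
      then have "Var j dvd p'" unfolding A_def using 1 by (subst (asm) Var_dvd_prod) auto
      then show False using assms(2) j by (auto simp: laurent_form_def)
    next
      case 2
      then have "Var j dvd Var j ^ nat (d j - d' j)" by (intro dvd_power) auto
      also have "\<dots> dvd A" unfolding A_def using j by (intro dvd_prodI) auto
      finally have "Var j dvd B * p" unfolding eq by simp
      then have "Var j dvd p" unfolding B_def using 2 by (subst (asm) Var_dvd_prod) auto
      then show False using assms(1) j by (auto simp: laurent_form_def)
    qed
  qed
  then have "A = 1" "B = 1" by (simp_all add: A_def B_def)
  then show ?thesis using eq dd by simp
qed

section \<open>Recursion for the numerators\<close>

context fan
begin

text \<open>The exchange relation in the quadrilateral \<open>lft j\<close>, \<open>a\<close>,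
  \<open>rgt j\<close>, \<open>nvx j\<close>. A variable y_k enters only if the interval of k
  contains \<open>lft j\<close> and \<open>a\<close> but neither of the other two vertices; this
  means i \<le> k \<le> j and that k still has the left end of j.\<close>

lemma phi_recursion:
  assumes ij: "1 \<le> i" "i \<le> j" "j \<le> n"
  defines "a \<equiv> obs (i - 1)"
  shows "to_fract (X j) * phi a (nvx j) =
     (\<Prod>k\<in>{k\<in>{i..j}. lft k = lft j}. to_fract (Yv k)) * (phi a (lft j) * phi (rgt j) (nvx j)) +
     phi a (rgt j) * phi (lft j) (nvx j)"
proof -
  have a: "lft j < a" "a < rgt j" using obs_inside[of "i - 1" j] ij by (auto simp: a_def)
  have b: "nvx j < lft j \<or> rgt j < nvx j" using nvx_outside ij by blast
  have c: "cyc (lft j) a (rgt j)" "cyc (rgt j) (nvx j) (lft j)" using a b by (auto simp: cyc_def)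
  have lamk: "lam k (lft j) a + lam k (rgt j) (nvx j) - (lam k a (rgt j) + lam k (nvx j) (lft j)) =
      of_bool (k \<in> {k\<in>{i..j}. lft k = lft j})" if k: "k \<in> {1..n}" for k
  proof -
    consider "k < j" | "k = j" | "j < k" by linarith
    then show ?thesis
    proof cases
      case 2
      then show ?thesis using a b ij by (auto simp: lam_def)
    next
      case 3
      then have m: "lft k \<le> lft (Suc j)" "rgt (Suc j) \<le> rgt k" using mono[of "Suc j" k] k by auto
      have "j \<le> n" using ij by simp
      then show ?thesis
        using a m 3 by (cases rule: step_cases[of j]) (auto simp: lam_def)
    next
      case 1
      then have m: "lft j \<le> lft k" "rgt k \<le> rgt j" using mono[of k j] ij by auto
      have inside: "a \<in> {lft k..<rgt k}" if "i \<le> k"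
      proof -
        have "i - 1 < k" using that ij by linarith
        then show ?thesis using obs_inside[of "i - 1" k] k by (auto simp: a_def)
      qed
      have out: "a \<notin> {lft k..<rgt k}" if ki: "k < i" "lft k = lft j"
      proof -
        have "k \<le> i - 1" "i - 1 \<le> n" using ki ij by auto
        then have m2: "lft (i - 1) \<le> lft k \<and> rgt k \<le> rgt (i - 1)" "lft j \<le> lft i"
          using mono[of k "i - 1"] mono[of i j] ij by auto
        have si: "Suc (i - 1) = i" using ij by simp
        from \<open>i - 1 \<le> n\<close> show ?thesis
        proof (cases rule: step_cases)
          case right
          then show ?thesis using m2 by (simp add: a_def)
        next
          case left
          then show ?thesis using m2 ki unfolding si a_def by auto
        qed
      qed
      have "rgt j \<notin> {lft k..<rgt k}" "nvx j \<notin> {lft k..<rgt k}" using m b by auto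
      moreover have "lft j \<in> {lft k..<rgt k} \<longleftrightarrow> lft k = lft j" using m lft_less_rgt[of k] by auto
      ultimately show ?thesis using inside out 1 by (auto simp: lam_def)
    qed
  qed
  have e1: "(\<Prod>m\<in>{1..n}. Yf m ^ nat (tt m (lft j) a + tt m (rgt j) (nvx j) - (tt m a (rgt j) + tt m (nvx j) (lft j)))) =
      (\<Prod>k\<in>{k\<in>{i..j}. lft k = lft j}. to_fract (Yv k))"
  proof -
    have "(\<Prod>m\<in>{1..n}. Yf m ^ nat (tt m (lft j) a + tt m (rgt j) (nvx j) - (tt m a (rgt j) + tt m (nvx j) (lft j)))) =
      (\<Prod>m\<in>{1..n}. Yf m ^ of_bool (letter cs m \<in> {k\<in>{i..j}. lft k = lft j}))"
      using lamk node by (intro prod.cong refl) (simp add: tt_def)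
    also have "\<dots> = (\<Prod>k\<in>{1..n}. Yf (pos k) ^ of_bool (k \<in> {k\<in>{i..j}. lft k = lft j}))"
      by (rule prod.reindex_bij_witness[of _ pos "letter cs"]) (use node pos in auto)
    also have "\<dots> = (\<Prod>k\<in>{k\<in>{i..j}. lft k = lft j}. Yf (pos k) ^ of_bool (k \<in> {k\<in>{i..j}. lft k = lft j}))"
      using ij by (intro prod.mono_neutral_right) auto
    also have "\<dots> = (\<Prod>k\<in>{k\<in>{i..j}. lft k = lft j}. to_fract (Yv k))"
      by (intro prod.cong) (auto simp: Yf_def Yv_def)
    finally show ?thesis .
  qed
  have e2: "(\<Prod>m\<in>{1..n}. Yf m ^ nat (tt m a (rgt j) + tt m (nvx j) (lft j) - (tt m (lft j) a + tt m (rgt j) (nvx j)))) = 1"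
  proof (intro prod.neutral ballI)
    fix m assume m: "m \<in> {1..n}"
    have "tt m (lft j) a + tt m (rgt j) (nvx j) - (tt m a (rgt j) + tt m (nvx j) (lft j)) \<ge> 0"
      using lamk[of "letter cs m"] node[OF m] by (simp add: tt_def)
    then have "nat (tt m a (rgt j) + tt m (nvx j) (lft j) - (tt m (lft j) a + tt m (rgt j) (nvx j))) = 0" by simp
    then show "Yf m ^ nat (tt m a (rgt j) + tt m (nvx j) (lft j) - (tt m (lft j) a + tt m (rgt j) (nvx j))) = 1" by simp
  qed
  have "phi (lft j) (rgt j) * phi a (nvx j) =
     (\<Prod>k\<in>{k\<in>{i..j}. lft k = lft j}. to_fract (Yv k)) * (phi (lft j) a * phi (rgt j) (nvx j)) +
     phi a (rgt j) * phi (nvx j) (lft j)"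
    using phi_exchange[OF c] unfolding e1 e2 by simp
  then show ?thesis using phi_gamma[of j] ij phi_sym[of "lft j" a] phi_sym[of "nvx j" "lft j"] by simp
qed

lemma phi_nvx_right: "j \<le> n \<Longrightarrow> R j \<Longrightarrow> phi (rgt j) (nvx j) = 1 \<and> phi (lft j) (nvx j) = to_fract (X (Suc j))"
  using phi_step[of j] phi_gamma[of "Suc j"] by (simp add: obs_def nvx_def lft_R)

lemma phi_nvx_left: "j \<le> n \<Longrightarrow> \<not> R j \<Longrightarrow> phi (lft j) (nvx j) = 1 \<and> phi (rgt j) (nvx j) = to_fract (X (Suc j))"
  using phi_step[of j] phi_gamma[of "Suc j"] phi_sym[of "rgt j" "nvx j"] by (simp add: obs_def nvx_def rgt_notR)

text \<open>\<open>num i d\<close> is the numerator of the cluster variable of \<open>\<alpha>\<^sub>i + \<dots> + \<alpha>\<^sub>j\<close> with \<open>j = i + d\<close>; the two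
  components of \<open>lr i d\<close> collect the terms with and without \<open>y\<^sub>j\<close>.\<close>

definition num_step :: "nat \<Rightarrow> mpol \<times> mpol \<Rightarrow> mpol" where
  "num_step j u = (if R j then Yv j * fst u + X (Suc j) * snd u else Yv j * (X (Suc j) * fst u) + snd u)"

primrec lr :: "nat \<Rightarrow> nat \<Rightarrow> mpol \<times> mpol" where
  "lr i 0 = (if R (i - 1) then (X (i - 1), 1) else (1, X (i - 1)))"
| "lr i (Suc d) = (if R (i + d) then (Yv (i + d) * (X (i + d) * fst (lr i d)), num_step (i + d) (lr i d))
     else (num_step (i + d) (lr i d), X (i + d) * snd (lr i d)))"

definition num :: "nat \<Rightarrow> nat \<Rightarrow> mpol" where
  "num i d = num_step (i + d) (lr i d)"

text \<open>The exchange relation multiplies the term through \<open>lft j\<close> by y_k for the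
  whole run of k with the same left end. Storing the earlier part of the run in the first component
  leaves only y_j for the current step, which makes the recursion local.\<close>

lemma phi_lr:
  assumes i: "1 \<le> i" and d: "i + d \<le> n"
  defines "a \<equiv> obs (i - 1)"
  shows "(\<Prod>k\<in>{k\<in>{i..<i + d}. lft k = lft (i + d)}. to_fract (Yv k)) * (phi a (lft (i + d)) *
        (\<Prod>k\<in>{i..<i + d}. to_fract (X k))) = to_fract (fst (lr i d)) \<and>
      phi a (rgt (i + d)) * (\<Prod>k\<in>{i..<i + d}. to_fract (X k)) = to_fract (snd (lr i d)) \<and>
      phi a (nvx (i + d)) * (\<Prod>k\<in>{i..i + d}. to_fract (X k)) = to_fract (num i d)"
  using d
proof (induction d)
  have step: "phi a (nvx j) * (\<Prod>k\<in>{i..j}. to_fract (X k)) = to_fract (num_step j u)"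
    if j: "i \<le> j" "j \<le> n" and
      L: "(\<Prod>k\<in>{k\<in>{i..<j}. lft k = lft j}. to_fract (Yv k)) * (phi a (lft j) *
        (\<Prod>k\<in>{i..<j}. to_fract (X k))) = to_fract (fst u)" and
      Rr: "phi a (rgt j) * (\<Prod>k\<in>{i..<j}. to_fract (X k)) = to_fract (snd u)" for j u
  proof -
    let ?P = "\<Prod>k\<in>{i..<j}. to_fract (X k)" and ?Y = "\<Prod>k\<in>{k\<in>{i..<j}. lft k = lft j}. to_fract (Yv k)"
    have s1: "(\<Prod>k\<in>{i..j}. to_fract (X k)) = ?P * to_fract (X j)"
      using j by (simp add: atLeastLessThanSuc_atLeastAtMost[symmetric])
    have "{k\<in>{i..j}. lft k = lft j} = insert j {k\<in>{i..<j}. lft k = lft j}" using j by auto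
    then have s2: "(\<Prod>k\<in>{k\<in>{i..j}. lft k = lft j}. to_fract (Yv k)) = to_fract (Yv j) * ?Y" by simp
    have "phi a (nvx j) * (\<Prod>k\<in>{i..j}. to_fract (X k)) = (to_fract (X j) * phi a (nvx j)) * ?P"
      unfolding s1 by (simp add: mult_ac)
    also have "\<dots> = to_fract (Yv j) * phi (rgt j) (nvx j) * (?Y * (phi a (lft j) * ?P)) +
        phi (lft j) (nvx j) * (phi a (rgt j) * ?P)"
      unfolding a_def phi_recursion[OF i j] s2 by (simp add: algebra_simps)
    also have "\<dots> = to_fract (Yv j) * phi (rgt j) (nvx j) * to_fract (fst u) + phi (lft j) (nvx j) * to_fract (snd u)"
      unfolding L Rr ..
    also have "\<dots> = to_fract (num_step j u)"
    proof (cases "R j")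
      case True
      then show ?thesis using phi_nvx_right[of j] j by (simp add: num_step_def)
    next
      case False
      then show ?thesis using phi_nvx_left[of j] j by (simp add: num_step_def mult_ac)
    qed
    finally show ?thesis .
  qed
  {
    case 0
    have i1: "i - 1 \<le> n" "i - 1 \<le> Suc n" "Suc (i - 1) = i" using i 0 by auto
    have b: "phi a (lft i) = to_fract (fst (lr i 0)) \<and> phi a (rgt i) = to_fract (snd (lr i 0))"
    proof (cases "R (i - 1)")
      case True
      have "phi a (lft i) = phi (lft (i - 1)) (rgt (i - 1))"
        using True lft_R[OF i1(1)] i1 phi_sym by (simp add: a_def obs_def)
      moreover have "phi a (rgt i) = 1"
        using phi_step[OF i1(1)] True i1 by (simp add: a_def nvx_def)
      ultimately show ?thesis using True phi_gamma[OF i1(2)] by simp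
    next
      case False
      have "phi a (rgt i) = phi (lft (i - 1)) (rgt (i - 1))"
        using False rgt_notR[OF i1(1)] i1 by (simp add: a_def obs_def)
      moreover have "phi a (lft i) = 1"
        using phi_step[OF i1(1)] False i1 by (simp add: a_def nvx_def)
      ultimately show ?thesis using False phi_gamma[OF i1(2)] by simp
    qed
    have "phi a (nvx i) * (\<Prod>k\<in>{i..i}. to_fract (X k)) = to_fract (num_step i (lr i 0))"
      using b 0 by (intro step) (simp_all del: lr.simps)
    then show ?case using b by (simp add: num_def del: lr.simps)
  next
    case (Suc d)
    let ?j = "i + d"
    have j: "?j \<le> n" "i \<le> ?j" using Suc.prems by auto
    note IH = Suc.IH[OF j(1)]
    have P: "(\<Prod>k\<in>{i..<i + Suc d}. to_fract (X k)) = (\<Prod>k\<in>{i..<?j}. to_fract (X k)) * to_fract (X ?j)"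
      by simp
    have P': "(\<Prod>k\<in>{i..<i + Suc d}. to_fract (X k)) = (\<Prod>k\<in>{i..?j}. to_fract (X k))"
      by (simp add: atLeastLessThanSuc_atLeastAtMost)
    have b: "(\<Prod>k\<in>{k\<in>{i..<i + Suc d}. lft k = lft (i + Suc d)}. to_fract (Yv k)) * (phi a (lft (i + Suc d)) *
        (\<Prod>k\<in>{i..<i + Suc d}. to_fract (X k))) = to_fract (fst (lr i (Suc d))) \<and>
      phi a (rgt (i + Suc d)) * (\<Prod>k\<in>{i..<i + Suc d}. to_fract (X k)) = to_fract (snd (lr i (Suc d)))"
    proof (cases "R ?j")
      case True
      have l: "lft (i + Suc d) = lft ?j" using lft_R[OF j(1) True] by simp
      have r: "rgt (i + Suc d) = nvx ?j" using True by (simp add: nvx_def)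
      have "{k\<in>{i..<i + Suc d}. lft k = lft (i + Suc d)} = insert ?j {k\<in>{i..<?j}. lft k = lft ?j}"
        unfolding l using j by auto
      then have Y: "(\<Prod>k\<in>{k\<in>{i..<i + Suc d}. lft k = lft (i + Suc d)}. to_fract (Yv k)) =
        to_fract (Yv ?j) * (\<Prod>k\<in>{k\<in>{i..<?j}. lft k = lft ?j}. to_fract (Yv k))" by simp
      have f: "fst (lr i (Suc d)) = Yv ?j * (X ?j * fst (lr i d))" "snd (lr i (Suc d)) = num i d"
        using True by (simp_all add: num_def)
      have "(\<Prod>k\<in>{k\<in>{i..<i + Suc d}. lft k = lft (i + Suc d)}. to_fract (Yv k)) * (phi a (lft (i + Suc d)) *
          (\<Prod>k\<in>{i..<i + Suc d}. to_fract (X k))) =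
        to_fract (Yv ?j) * (to_fract (X ?j) * ((\<Prod>k\<in>{k\<in>{i..<?j}. lft k = lft ?j}. to_fract (Yv k)) *
          (phi a (lft ?j) * (\<Prod>k\<in>{i..<?j}. to_fract (X k)))))"
        unfolding Y P unfolding l by (simp only: mult_ac)
      also have "\<dots> = to_fract (fst (lr i (Suc d)))"
        unfolding conjunct1[OF IH] f(1) by simp
      finally show ?thesis
        unfolding r P' f(2) using conjunct2[OF conjunct2[OF IH]] by blast
    next
      case False
      have r: "rgt (i + Suc d) = rgt ?j" using rgt_notR[OF j(1) False] by simp
      have l: "lft (i + Suc d) = nvx ?j" using False by (simp add: nvx_def)
      \<comment> \<open>The left end has just moved, so a new run begins and its product of
        coefficients is empty.\<close>
      have "{k\<in>{i..<i + Suc d}. lft k = lft (i + Suc d)} = {}"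
      proof -
        have "lft k \<noteq> lft (i + Suc d)" if "k \<in> {i..<i + Suc d}" for k
          using mono[of k ?j] lft_notR[OF j(1) False] that j by auto
        then show ?thesis by blast
      qed
      then have "(\<Prod>k\<in>{k\<in>{i..<i + Suc d}. lft k = lft (i + Suc d)}. to_fract (Yv k)) = 1"
        by (simp only: prod.empty)
      moreover have f: "fst (lr i (Suc d)) = num i d" "snd (lr i (Suc d)) = X ?j * snd (lr i d)"
        using False by (simp_all add: num_def)
      moreover have "phi a (rgt ?j) * ((\<Prod>k\<in>{i..<?j}. to_fract (X k)) * to_fract (X ?j)) = to_fract (X ?j * snd (lr i d))"
        using conjunct1[OF conjunct2[OF IH]] by (simp add: mult.assoc[symmetric])
      moreover have "phi a (nvx ?j) * (\<Prod>k\<in>{i..<i + Suc d}. to_fract (X k)) = to_fract (num i d)"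
        unfolding P' using conjunct2[OF conjunct2[OF IH]] .
      ultimately show ?thesis unfolding r f P[symmetric] unfolding l by simp
    qed
    have "phi a (nvx (i + Suc d)) * (\<Prod>k\<in>{i..i + Suc d}. to_fract (X k)) = to_fract (num_step (i + Suc d) (lr i (Suc d)))"
      using b Suc.prems by (intro step) (simp_all del: lr.simps)
    then show ?case using b by (simp only: num_def)
  }
qed

text \<open>With x_s = 0 and all other variables 1 the recursion only adds nonnegative integers, so
  it suffices to see that the total never drops to 0. Nonvanishing of the numerator and
  indivisibility by x_s follow together.\<close>

lemma num_positive_at_zero:
  assumes i: "1 \<le> i" and s: "s \<in> {1..n}" and d: "i + d \<le> n"
  defines "g \<equiv> (\<lambda>k. if k = pos s then 0 else 1) :: nat \<Rightarrow> mpol"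
  shows "mpol_subst g (num i d) \<noteq> 0"
proof -
  have gX: "mpol_subst g (X k * p) = (if k = s then 0 else 1) * mpol_subst g p" for k p
  proof (cases "k \<in> {1..n}")
    case True
    then have "pos k = pos s \<longleftrightarrow> k = s" using pos s by metis
    then show ?thesis using True by (simp add: X_def g_def)
  next
    case False
    then show ?thesis using s by (auto simp: X_def)
  qed
  have gX1: "mpol_subst g (X k) = (if k = s then 0 else 1)" for k using gX[of k 1] by simp
  have gY: "mpol_subst g (Yv k * p) = mpol_subst g p" if "k \<in> {1..n}" for k p
    using pos[OF that] pos[OF s] by (simp add: Yv_def g_def)
  \<comment> \<open>Both components have to stay positive as long as j \<le> s, because the step
    with j + 1 = s loses one of them. Afterwards a positive sum is enough.\<close>
  define S where "S u l r j \<longleftrightarrow> mpol_subst g (fst u) = of_nat l \<and> mpol_subst g (snd u) = of_nat r \<and>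
     0 < l + r \<and> (i \<le> s \<and> j \<le> s \<longrightarrow> 0 < l \<and> 0 < r)" for u and l r j :: nat
  have N: "\<exists>m>0. mpol_subst g (num_step j u) = of_nat m" if S: "S u l r j" and j: "i \<le> j" "j \<in> {1..n}" for u l r j
  proof -
    have "mpol_subst g (num_step j u) = of_nat (if R j then l + (if Suc j = s then 0 else 1) * r
       else (if Suc j = s then 0 else 1) * l + r)"
      using S gY[OF j(2)] by (simp add: num_step_def mpol_subst_add gX S_def)
    moreover have "0 < (if R j then l + (if Suc j = s then 0 else 1) * r
       else (if Suc j = s then 0 else 1) * l + r)"
      using S j unfolding S_def by auto
    ultimately show ?thesis by blast
  qed
  have lrS: "\<exists>l r. S (lr i d) l r (i + d)" if "i + d \<le> n" for d
    using that
  proof (induction d)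
    case 0
    show ?case
    proof (cases "R (i - 1)")
      case True
      then show ?thesis using i unfolding S_def
        by (intro exI[of _ "if i - 1 = s then 0 else 1"] exI[of _ 1]) (auto simp: gX1)
    next
      case False
      then show ?thesis using i unfolding S_def
        by (intro exI[of _ 1] exI[of _ "if i - 1 = s then 0 else 1"]) (auto simp: gX1)
    qed
  next
    case (Suc d)
    then obtain l r where S: "S (lr i d) l r (i + d)" by auto
    have j: "i \<le> i + d" "i + d \<in> {1..n}" using Suc.prems i by auto
    obtain m where m: "0 < m" "mpol_subst g (num_step (i + d) (lr i d)) = of_nat m" using N[OF S j] by blast
    show ?case
    proof (cases "R (i + d)")
      case True
      have "S (lr i (Suc d)) ((if i + d = s then 0 else 1) * l) m (i + Suc d)"
        using True S m gY[OF j(2)] unfolding S_def by (auto simp: gX)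
      then show ?thesis by blast
    next
      case False
      have "S (lr i (Suc d)) m ((if i + d = s then 0 else 1) * r) (i + Suc d)"
        using False S m unfolding S_def by (auto simp: gX)
      then show ?thesis by blast
    qed
  qed
  obtain l r where "S (lr i d) l r (i + d)" using lrS[OF d] by blast
  then obtain m where "0 < m" "mpol_subst g (num i d) = of_nat m"
    using N[of "lr i d" l r "i + d"] i d unfolding num_def by auto
  then show ?thesis by simp
qed

lemma num_nonzero: "1 \<le> i \<Longrightarrow> i + d \<le> n \<Longrightarrow> num i d \<noteq> 0"
  using num_positive_at_zero[of i 1 d] n_pos by auto

section \<open>Specialisation at x = 1 and closed sets\<close>

definition oset :: "nat \<Rightarrow> nat \<Rightarrow> nat set \<Rightarrow> bool" where
  "oset i k S \<longleftrightarrow> S \<subseteq> {i..<k} \<and>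
     (\<forall>p. i < p \<longrightarrow> p < k \<longrightarrow> (if R (p - 1) then p \<in> S \<longrightarrow> p - 1 \<in> S else p - 1 \<in> S \<longrightarrow> p \<in> S))"

definition ymon :: "nat set \<Rightarrow> mpol" where
  "ymon S = (\<Prod>t\<in>S. Yv t)"

definition ev1 :: "mpol \<Rightarrow> mpol" where
  "ev1 = mpol_subst (\<lambda>i. if i \<in> {1..n} then 1 else Var i)"

lemma ev1_add: "ev1 (p + r) = ev1 p + ev1 r"
  unfolding ev1_def by (rule mpol_subst_add)

lemma finite_oset: "finite {S. oset i k S}" "oset i k S \<Longrightarrow> finite S"
proof -
  show "finite {S. oset i k S}"
    by (rule finite_subset[of _ "Pow {i..<k}"]) (auto simp: oset_def)
  show "oset i k S \<Longrightarrow> finite S"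
    unfolding oset_def using finite_subset by blast
qed

lemma oset_Suc:
  assumes "i \<le> j"
  shows "oset i (Suc (Suc j)) S \<longleftrightarrow> oset i (Suc j) (S - {Suc j}) \<and> S \<subseteq> {i..Suc j} \<and>
     (if R j then Suc j \<in> S \<longrightarrow> j \<in> S else j \<in> S \<longrightarrow> Suc j \<in> S)"
proof
  assume a: "oset i (Suc (Suc j)) S"
  have "oset i (Suc j) (S - {Suc j})"
    unfolding oset_def
  proof (intro conjI allI impI)
    show "S - {Suc j} \<subseteq> {i..<Suc j}" using a by (auto simp: oset_def less_Suc_eq)
    fix p assume p: "i < p" "p < Suc j"
    then have "p \<noteq> Suc j" "p - 1 \<noteq> Suc j" "p < Suc (Suc j)" by auto
    then show "if R (p - 1) then p \<in> S - {Suc j} \<longrightarrow> p - 1 \<in> S - {Suc j} else p - 1 \<in> S - {Suc j} \<longrightarrow> p \<in> S - {Suc j}"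
      using a p unfolding oset_def by (auto split: if_splits)
  qed
  moreover have "S \<subseteq> {i..Suc j}" using a by (auto simp: oset_def)
  moreover have "if R j then Suc j \<in> S \<longrightarrow> j \<in> S else j \<in> S \<longrightarrow> Suc j \<in> S"
    using a assms unfolding oset_def by (auto dest!: conjunct2 spec[of _ "Suc j"])
  ultimately show "oset i (Suc j) (S - {Suc j}) \<and> S \<subseteq> {i..Suc j} \<and>
     (if R j then Suc j \<in> S \<longrightarrow> j \<in> S else j \<in> S \<longrightarrow> Suc j \<in> S)" by blast
next
  assume a: "oset i (Suc j) (S - {Suc j}) \<and> S \<subseteq> {i..Suc j} \<and>
     (if R j then Suc j \<in> S \<longrightarrow> j \<in> S else j \<in> S \<longrightarrow> Suc j \<in> S)"
  show "oset i (Suc (Suc j)) S"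
    unfolding oset_def
  proof (intro conjI allI impI)
    show "S \<subseteq> {i..<Suc (Suc j)}" using a by auto
    fix p assume p: "i < p" "p < Suc (Suc j)"
    show "if R (p - 1) then p \<in> S \<longrightarrow> p - 1 \<in> S else p - 1 \<in> S \<longrightarrow> p \<in> S"
    proof (cases "p = Suc j")
      case True
      then show ?thesis using a by simp
    next
      case False
      then have "p < Suc j" "p - 1 \<noteq> Suc j" using p by auto
      then show ?thesis using a p False unfolding oset_def by (auto split: if_splits)
    qed
  qed
qed

text \<open>With j = i + d, the first component collects the closed sets containing j, with the
  factor y_j left out, and the second those avoiding j. In the next step, sets with j + 1 come from
  sets with j if \<open>R j\<close> and from all sets otherwise; for sets without j + 1 it is all
  sets if \<open>R j\<close> and the sets without j otherwise.\<close>

lemma ev1_lr: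
  assumes i: "1 \<le> i" and d: "i + d \<le> n"
  shows "ev1 (fst (lr i d)) = (\<Sum>S\<in>{S. S \<subseteq> {i..<i + d} \<and> oset i (Suc (i + d)) (insert (i + d) S)}. ymon S) \<and>
     ev1 (snd (lr i d)) = (\<Sum>S\<in>{S. i + d \<notin> S \<and> oset i (Suc (i + d)) S}. ymon S) \<and>
     ev1 (num i d) = (\<Sum>S\<in>{S. oset i (Suc (i + d)) S}. ymon S)"
  using d
proof (induction d)
  have sX: "ev1 (X k * p) = ev1 p" for k p
    by (cases "k \<in> {1..n}") (use pos in \<open>simp_all add: X_def ev1_def\<close>)
  have sX1: "ev1 (X k) = 1" "ev1 1 = 1" for k using sX[of k 1] by (simp_all add: ev1_def)
  have sY: "ev1 (Yv k * p) = Yv k * ev1 p" if "k \<in> {1..n}" for k p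
    using pos[OF that] by (simp add: Yv_def ev1_def)
  have YA: "Yv j * (\<Sum>S\<in>{S. S \<subseteq> {i..<j} \<and> oset i (Suc j) (insert j S)}. ymon S) =
     (\<Sum>S\<in>{S. j \<in> S \<and> oset i (Suc j) S}. ymon S)" for j
  proof -
    have "Yv j * (\<Sum>S\<in>{S. S \<subseteq> {i..<j} \<and> oset i (Suc j) (insert j S)}. ymon S) = (\<Sum>S\<in>{S. S \<subseteq> {i..<j} \<and> oset i (Suc j) (insert j S)}. ymon (insert j S))"
      unfolding sum_distrib_left
    proof (intro sum.cong refl)
      fix S assume "S \<in> {S. S \<subseteq> {i..<j} \<and> oset i (Suc j) (insert j S)}"
      then have "S \<subseteq> {i..<j}" by simp
      then have "finite S" "j \<notin> S" using finite_subset by auto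
      then show "Yv j * ymon S = ymon (insert j S)" by (simp add: ymon_def)
    qed
    also have "\<dots> = (\<Sum>S\<in>{S. j \<in> S \<and> oset i (Suc j) S}. ymon S)"
    proof (rule sum.reindex_bij_witness[of _ "\<lambda>S. S - {j}" "insert j"])
      fix S assume "S \<in> {S. j \<in> S \<and> oset i (Suc j) S}"
      then have S: "j \<in> S" "oset i (Suc j) S" by auto
      then show "insert j (S - {j}) = S" by auto
      then show "S - {j} \<in> {S. S \<subseteq> {i..<j} \<and> oset i (Suc j) (insert j S)}"
        using S by (auto simp: oset_def less_Suc_eq)
    qed auto
    finally show ?thesis .
  qed
  have N: "ev1 (num_step j u) = (\<Sum>S\<in>{S. oset i (Suc j) S}. ymon S)"
    if j: "i \<le> j" "j \<in> {1..n}"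
      and A: "ev1 (fst u) = (\<Sum>S\<in>{S. S \<subseteq> {i..<j} \<and> oset i (Suc j) (insert j S)}. ymon S)"
      and B: "ev1 (snd u) = (\<Sum>S\<in>{S. j \<notin> S \<and> oset i (Suc j) S}. ymon S)" for j u
  proof -
    have "ev1 (num_step j u) = Yv j * ev1 (fst u) + ev1 (snd u)"
      using sY[OF j(2)] by (simp add: num_step_def ev1_add sX)
    also have "Yv j * ev1 (fst u) = (\<Sum>S\<in>{S. j \<in> S \<and> oset i (Suc j) S}. ymon S)"
      unfolding A by (rule YA)
    also have "(\<Sum>S\<in>{S. j \<in> S \<and> oset i (Suc j) S}. ymon S) + ev1 (snd u) = (\<Sum>S\<in>{S. oset i (Suc j) S}. ymon S)"
    proof -
      have "{S. oset i (Suc j) S} = {S. j \<in> S \<and> oset i (Suc j) S} \<union> {S. j \<notin> S \<and> oset i (Suc j) S}" by auto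
      moreover have "finite {S. j \<in> S \<and> oset i (Suc j) S}" "finite {S. j \<notin> S \<and> oset i (Suc j) S}"
        using finite_oset(1)[of i "Suc j"] by (auto intro: rev_finite_subset)
      moreover have "{S. j \<in> S \<and> oset i (Suc j) S} \<inter> {S. j \<notin> S \<and> oset i (Suc j) S} = {}" by auto
      ultimately show ?thesis unfolding B by (simp only: sum.union_disjoint)
    qed
    finally show ?thesis .
  qed
  {
    case 0
    have o: "oset i (Suc i) S \<longleftrightarrow> S \<subseteq> {i}" for S by (auto simp: oset_def)
    have "{S. S \<subseteq> {i..<i} \<and> oset i (Suc i) (insert i S)} = {{}}" unfolding o by auto
    moreover have "{S. i \<notin> S \<and> oset i (Suc i) S} = {{}}" unfolding o by auto
    ultimately have b: "ev1 (fst (lr i 0)) = (\<Sum>S\<in>{S. S \<subseteq> {i..<i} \<and> oset i (Suc i) (insert i S)}. ymon S) \<and>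
      ev1 (snd (lr i 0)) = (\<Sum>S\<in>{S. i \<notin> S \<and> oset i (Suc i) S}. ymon S)"
      by (simp add: sX1 ymon_def)
    then have "ev1 (num_step i (lr i 0)) = (\<Sum>S\<in>{S. oset i (Suc i) S}. ymon S)"
      using i 0 by (intro N) (simp_all del: lr.simps)
    then show ?case using b by (simp add: num_def del: lr.simps)
  next
    case (Suc d)
    let ?j = "i + d"
    have j: "i \<le> ?j" "?j \<in> {1..n}" using i Suc.prems by auto
    have IH: "ev1 (fst (lr i d)) = (\<Sum>S\<in>{S. S \<subseteq> {i..<?j} \<and> oset i (Suc ?j) (insert ?j S)}. ymon S)"
      "ev1 (snd (lr i d)) = (\<Sum>S\<in>{S. ?j \<notin> S \<and> oset i (Suc ?j) S}. ymon S)"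
      "ev1 (num i d) = (\<Sum>S\<in>{S. oset i (Suc ?j) S}. ymon S)" using Suc by auto
    have ins: "S \<subseteq> {i..<Suc ?j} \<and> oset i (Suc (Suc ?j)) (insert (Suc ?j) S) \<longleftrightarrow>
       oset i (Suc ?j) S \<and> (R ?j \<longrightarrow> ?j \<in> S)" for S
    proof (cases "S \<subseteq> {i..<Suc ?j}")
      case True
      then have e: "insert (Suc ?j) S - {Suc ?j} = S" and m: "insert (Suc ?j) S \<subseteq> {i..Suc ?j}" using j by auto
      show ?thesis unfolding oset_Suc[OF j(1)] e using True m by simp
    next
      case False
      then have "\<not> oset i (Suc ?j) S" by (simp add: oset_def)
      then show ?thesis using False by simp
    qed
    have out: "Suc ?j \<notin> S \<and> oset i (Suc (Suc ?j)) S \<longleftrightarrow> oset i (Suc ?j) S \<and> (\<not> R ?j \<longrightarrow> ?j \<notin> S)" for S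
    proof (cases "Suc ?j \<in> S")
      case True
      then have "\<not> oset i (Suc ?j) S" by (auto simp: oset_def)
      then show ?thesis using True by simp
    next
      case False
      then have e: "S - {Suc ?j} = S" by simp
      have m: "S \<subseteq> {i..Suc ?j}" if "oset i (Suc ?j) S" using that by (auto simp: oset_def)
      show ?thesis unfolding oset_Suc[OF j(1)] e using False m by auto
    qed
    have b: "ev1 (fst (lr i (Suc d))) = (\<Sum>S\<in>{S. S \<subseteq> {i..<Suc ?j} \<and> oset i (Suc (Suc ?j)) (insert (Suc ?j) S)}. ymon S) \<and>
      ev1 (snd (lr i (Suc d))) = (\<Sum>S\<in>{S. Suc ?j \<notin> S \<and> oset i (Suc (Suc ?j)) S}. ymon S)"
    proof (cases "R ?j")
      case True
      have "ev1 (fst (lr i (Suc d))) = Yv ?j * ev1 (fst (lr i d))"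
        using True sY[OF j(2)] by (simp add: sX)
      also have "\<dots> = (\<Sum>S\<in>{S. oset i (Suc ?j) S \<and> ?j \<in> S}. ymon S)"
        unfolding IH(1) YA by (simp only: conj_commute)
      finally have 1: "ev1 (fst (lr i (Suc d))) = (\<Sum>S\<in>{S. oset i (Suc ?j) S \<and> ?j \<in> S}. ymon S)" .
      have 2: "ev1 (snd (lr i (Suc d))) = (\<Sum>S\<in>{S. oset i (Suc ?j) S}. ymon S)"
        using True IH(3) by (simp add: num_def)
      show ?thesis unfolding ins out using 1 2 True by simp
    next
      case False
      have 1: "ev1 (fst (lr i (Suc d))) = (\<Sum>S\<in>{S. oset i (Suc ?j) S}. ymon S)"
        using False IH(3) by (simp add: num_def)
      have "ev1 (snd (lr i (Suc d))) = ev1 (snd (lr i d))"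
        using False by (simp add: sX)
      then have 2: "ev1 (snd (lr i (Suc d))) = (\<Sum>S\<in>{S. oset i (Suc ?j) S \<and> ?j \<notin> S}. ymon S)"
        unfolding IH(2) by (simp add: conj_commute)
      show ?thesis unfolding ins out using 1 2 False by simp
    qed
    then have "ev1 (num_step (Suc ?j) (lr i (Suc d))) = (\<Sum>S\<in>{S. oset i (Suc (Suc ?j)) S}. ymon S)"
      using i Suc.prems by (intro N) (simp_all del: lr.simps)
    then show ?case using b by (simp add: num_def del: lr.simps)
  }
qed

definition yexp :: "nat set \<Rightarrow> nat \<Rightarrow>\<^sub>0 nat" where
  "yexp S = (\<Sum>t\<in>S. Poly_Mapping.single (n + pos t) 1)"

lemma ymon_single: "finite S \<Longrightarrow> ymon S = Poly_Mapping.single (yexp S) 1"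
  by (induction S rule: finite_induct) (simp_all add: ymon_def yexp_def Yv_def Var_def mult_single)

lemma lookup_yexp:
  assumes "S \<subseteq> {1..n}" "m \<in> {1..n}"
  shows "Poly_Mapping.lookup (yexp S) (n + m) = of_bool (letter cs m \<in> S)"
proof -
  have "finite S" using assms(1) finite_subset by blast
  have "Poly_Mapping.lookup (yexp S) (n + m) = (\<Sum>t\<in>S. if t = letter cs m then 1 else 0)"
    unfolding yexp_def lookup_sum lookup_single
  proof (intro sum.cong refl)
    fix t assume "t \<in> S"
    then have "n + pos t = n + m \<longleftrightarrow> t = letter cs m" using assms pos[of t] node[OF assms(2)] by auto
    then show "(1 when n + pos t = n + m) = (if t = letter cs m then 1 else 0 :: nat)" by simp
  qed
  then show ?thesis using \<open>finite S\<close> by simp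
qed

text \<open>Different sets give different monomials, each with coefficient 1, so nothing cancels and
  the support can be read off.\<close>

lemma keys_sum_ymon:
  assumes "finite C" "\<And>S. S \<in> C \<Longrightarrow> S \<subseteq> {1..n}"
  shows "Poly_Mapping.keys (\<Sum>S\<in>C. ymon S) = yexp ` C"
proof -
  have fin: "finite S" if "S \<in> C" for S using assms(2)[OF that] finite_subset by blast
  have inj: "S = S'" if "S \<in> C" "S' \<in> C" "yexp S = yexp S'" for S S'
  proof -
    have "t \<in> S \<longleftrightarrow> t \<in> S'" if "t \<in> {1..n}" for t
      using lookup_yexp[OF assms(2)[OF \<open>S \<in> C\<close>], of "pos t"] lookup_yexp[OF assms(2)[OF \<open>S' \<in> C\<close>], of "pos t"]
        pos[OF that] \<open>yexp S = yexp S'\<close> by (metis of_bool_eq_iff)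
    then show ?thesis using assms(2)[OF that(1)] assms(2)[OF that(2)] by blast
  qed
  have l: "Poly_Mapping.lookup (\<Sum>S\<in>C. ymon S) m = of_bool (m \<in> yexp ` C)" for m
  proof -
    have "Poly_Mapping.lookup (\<Sum>S\<in>C. ymon S) m = (\<Sum>S\<in>C. if yexp S = m then 1 else 0)"
      unfolding lookup_sum using fin by (intro sum.cong refl) (simp add: ymon_single lookup_single when_def)
    also have "\<dots> = of_bool (m \<in> yexp ` C)"
    proof (cases "m \<in> yexp ` C")
      case True
      then obtain S0 where S0: "S0 \<in> C" "m = yexp S0" by blast
      then have "(\<Sum>S\<in>C. if yexp S = m then 1 else 0 :: int) = (\<Sum>S\<in>C. if S = S0 then 1 else 0)"
        using inj by (intro sum.cong refl) auto
      then show ?thesis using True S0 assms(1) by simp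
    next
      case False
      then have "(\<Sum>S\<in>C. if yexp S = m then 1 else 0 :: int) = 0" by (intro sum.neutral) auto
      then show ?thesis using False by simp
    qed
    finally show ?thesis .
  qed
  show ?thesis by (auto simp: in_keys_iff l)
qed

lemma exponent_vector_yexp:
  assumes "S \<subseteq> {1..n}"
  shows "(\<Sum>m\<in>{1..n}. real (Poly_Mapping.lookup (yexp S) (n + m)) *\<^sub>R simple_root (letter cs m)) = (\<Sum>t\<in>S. simple_root t)"
proof -
  have "(\<Sum>m\<in>{1..n}. real (Poly_Mapping.lookup (yexp S) (n + m)) *\<^sub>R simple_root (letter cs m)) =
     (\<Sum>m\<in>{1..n}. of_bool (letter cs m \<in> S) *\<^sub>R simple_root (letter cs m))"
    using lookup_yexp[OF assms] by (intro sum.cong refl) simp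
  also have "\<dots> = (\<Sum>t\<in>{1..n}. of_bool (t \<in> S) *\<^sub>R simple_root t)"
    by (rule sum.reindex_bij_witness[of _ pos "letter cs"]) (use node pos in auto)
  also have "\<dots> = (\<Sum>t\<in>S. of_bool (t \<in> S) *\<^sub>R simple_root t)"
    using assms by (intro sum.mono_neutral_right) auto
  also have "\<dots> = (\<Sum>t\<in>S. simple_root t)"
    by (intro sum.cong) auto
  finally show ?thesis .
qed

lemma exponent_vectors_num:
  assumes "1 \<le> i" "i + d \<le> n"
  shows "exponent_vectors n cs (ev1 (num i d)) = {\<Sum>t\<in>S. simple_root t | S. oset i (Suc (i + d)) S}"
proof -
  have sub: "S \<subseteq> {1..n}" if "oset i (Suc (i + d)) S" for S
    using that assms by (auto simp: oset_def)
  have keys: "Poly_Mapping.keys (ev1 (num i d)) = yexp ` {S. oset i (Suc (i + d)) S}"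
    unfolding conjunct2[OF conjunct2[OF ev1_lr[OF assms]]]
    by (rule keys_sum_ymon[OF finite_oset(1)]) (use sub in blast)
  have "exponent_vectors n cs (ev1 (num i d)) =
     (\<lambda>m. \<Sum>k\<in>{1..n}. real (Poly_Mapping.lookup m (n + k)) *\<^sub>R simple_root (letter cs k)) ` yexp ` {S. oset i (Suc (i + d)) S}"
    unfolding exponent_vectors_def keys by blast
  also have "\<dots> = (\<lambda>S. \<Sum>t\<in>S. simple_root t) ` {S. oset i (Suc (i + d)) S}"
    unfolding image_image using exponent_vector_yexp[OF sub] by (intro image_cong) auto
  finally show ?thesis by blast
qed

lemma prod_X_nonzero: "(\<Prod>k\<in>A. to_fract (X k)) \<noteq> 0"
  by (induction A rule: infinite_finite_induct) (simp_all add: X_nonzero)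

lemma phi_interval:
  assumes "1 \<le> i" "i + d \<le> n"
  shows "phi (obs (i - 1)) (nvx (i + d)) = to_fract (num i d) / (\<Prod>k\<in>{i..i + d}. to_fract (X k))"
  using conjunct2[OF conjunct2[OF phi_lr[OF assms]]]
  unfolding nonzero_eq_divide_eq[OF prod_X_nonzero] .

lemma diagonal_cases:
  assumes "p \<le> n + 2" "q \<le> n + 2" "p \<noteq> q"
  obtains (initial) s where "s \<in> {1..n}" "phi p q = to_fract (X s)"
  | (interval) i d where "1 \<le> i" "i + d \<le> n" "phi p q = to_fract (num i d) / (\<Prod>k\<in>{i..i + d}. to_fract (X k))"
  | (bound) "boundary n p q \<or> boundary n q p"
proof -
  have "p \<in> {lft (Suc n)..rgt (Suc n)}" "q \<in> {lft (Suc n)..rgt (Suc n)}" using assms by auto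
  from pair_cases[OF order_refl this assms(3)] show ?thesis
  proof (elim disjE exE conjE)
    fix u assume u: "u \<le> Suc n" "{p, q} = {lft u, rgt u}"
    then have e: "phi p q = to_fract (X u)" using phi_gamma[OF u(1)] phi_sym[of p q] by (auto simp: doubleton_eq_iff)
    show ?thesis
    proof (cases "u \<in> {1..n}")
      case True
      then show ?thesis using e initial by blast
    next
      case False
      then have "u = 0 \<or> u = Suc n" using u by auto
      then show ?thesis using u(2) width[of 0] bound by (auto simp: doubleton_eq_iff boundary_def)
    qed
  next
    fix i j assume ij: "i \<le> j" "j < Suc n" "{p, q} = {obs i, nvx j}"
    show ?thesis
    proof (cases "i = j")
      case True
      have j: "j \<le> n" using ij by simp
      have "obs j = Suc (nvx j) \<or> nvx j = Suc (obs j)"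
        by (cases rule: step_cases[OF j]) auto
      then show ?thesis using ij True bound by (auto simp: doubleton_eq_iff boundary_def)
    next
      case False
      then have "1 \<le> Suc i" "Suc i + (j - Suc i) \<le> n" "Suc i + (j - Suc i) = j" using ij by auto
      moreover have "phi p q = phi (obs i) (nvx j)" using ij(3) phi_sym[of p q] by (auto simp: doubleton_eq_iff)
      ultimately show ?thesis
        using phi_interval[of "Suc i" "j - Suc i"] interval[of "Suc i" "j - Suc i"] by (simp only: diff_Suc_1)
    qed
  qed
qed

text \<open>Mutation divides by these elements, so this has to be settled before the general polygon
  results can be used.\<close>

lemma phi_nonzero:
  assumes "p \<le> n + 2" "q \<le> n + 2" "p \<noteq> q"
  shows "phi p q \<noteq> 0"
  using assms
proof (cases rule: diagonal_cases)
  case (initial s)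
  then show ?thesis by (simp add: X_nonzero)
next
  case (interval i d)
  then show ?thesis using num_nonzero prod_X_nonzero by simp
next
  case bound
  then show ?thesis using phi_boundary assms phi_sym[of p q] by auto
qed

sublocale cluster_polygon n phi Yf tt
proof
  show "phi p q = phi q p" for p q by (rule phi_sym)
  show "tt i p q = tt i q p" for i p q unfolding tt_def by (rule lam_sym)
  show "tt i x y + tt i w z = min (tt i x w + tt i y z) (tt i w y + tt i z x)"
    if "cyc x w y" "cyc y z x" for i x w y z
    unfolding tt_def by (rule lam_tropical[OF that])
  show "phi x y * phi w z =
        (\<Prod>i\<in>{1..n}. Yf i ^ nat (tt i x w + tt i y z - (tt i w y + tt i z x))) * (phi x w * phi y z) +
        (\<Prod>i\<in>{1..n}. Yf i ^ nat (tt i w y + tt i z x - (tt i x w + tt i y z))) * (phi w y * phi z x)"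
    if "cyc x w y" "cyc y z x" for x w y z
    by (rule phi_exchange[OF that])
  show "phi p q = 1" if "boundary n p q" "p \<le> n + 2" "q \<le> n + 2" for p q
    using phi_boundary[OF that] .
  show "phi p q \<noteq> 0" if "p \<le> n + 2" "q \<le> n + 2" "p \<noteq> q" for p q
    using phi_nonzero[OF that] .
qed

text \<open>The numerator must not be divisible by x_s, so x_s is written as 1 over the monomial
  with exponent -1. The negative d-vector later keeps initial variables apart from positive
  roots.\<close>

lemma laurent_initial:
  assumes "s \<in> {1..n}"
  shows "laurent_form n (to_fract (X s)) 1 (\<lambda>m. if m = pos s then - 1 else 0)"
proof -
  have "(\<Prod>m\<in>{1..n}. to_fract (Var m) powi (if m = pos s then - 1 else 0)) =
     (\<Prod>m\<in>{pos s}. to_fract (Var m) powi (if m = pos s then - 1 else 0) :: mpol fract)"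
    using pos[OF assms] by (intro prod.mono_neutral_right) auto
  also have "\<dots> = inverse (to_fract (X s))" using assms by (simp add: X_def)
  finally show ?thesis
    unfolding laurent_form_def using not_Var_dvd_1 by (simp add: divide_inverse)
qed

lemma laurent_interval:
  assumes "1 \<le> i" "i + d \<le> n"
  shows "laurent_form n (phi (obs (i - 1)) (nvx (i + d))) (num i d) (\<lambda>m. of_bool (letter cs m \<in> {i..i + d}))"
proof -
  have "(\<Prod>m\<in>{1..n}. to_fract (Var m) powi of_bool (letter cs m \<in> {i..i + d}) :: mpol fract) =
    (\<Prod>k\<in>{1..n}. to_fract (Var (pos k)) powi of_bool (k \<in> {i..i + d}))"
    by (rule prod.reindex_bij_witness[of _ pos "letter cs"]) (use node pos in auto)
  also have "\<dots> = (\<Prod>k\<in>{i..i + d}. to_fract (Var (pos k)) powi of_bool (k \<in> {i..i + d}))"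
    using assms by (intro prod.mono_neutral_right) auto
  also have "\<dots> = (\<Prod>k\<in>{i..i + d}. to_fract (X k))"
    using assms by (intro prod.cong) (auto simp: X_def)
  finally have e: "(\<Prod>m\<in>{1..n}. to_fract (Var m) powi of_bool (letter cs m \<in> {i..i + d}) :: mpol fract) =
    (\<Prod>k\<in>{i..i + d}. to_fract (X k))" .
  have "\<not> Var m dvd num i d" if "m \<in> {1..n}" for m
    using num_positive_at_zero[OF assms(1) _ assms(2), of "letter cs m"] node[OF that]
    by (intro not_Var_dvd_subst[of "\<lambda>k. if k = m then 0 else 1"]) auto
  then show ?thesis unfolding laurent_form_def e using phi_interval[OF assms] by blast
qed

lemma d_vector_eq:
  "(\<Sum>m\<in>{1..n}. of_int (f m) *\<^sub>R simple_root (letter cs m)) = (\<Sum>t\<in>{1..n}. of_int (f (pos t)) *\<^sub>R simple_root t)"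
  by (rule sum.reindex_bij_witness[of _ pos "letter cs"]) (use node pos in auto)

lemma has_d_vector_iff:
  assumes "laurent_form n u p d"
  shows "has_d_vector n cs u \<beta> \<longleftrightarrow> \<beta> = (\<Sum>t\<in>{1..n}. of_int (d (pos t)) *\<^sub>R simple_root t)"
proof -
  have "(\<Sum>m\<in>{1..n}. of_int (d' m) *\<^sub>R simple_root (letter cs m)) = (\<Sum>m\<in>{1..n}. of_int (d m) *\<^sub>R simple_root (letter cs m))"
    if "laurent_form n u p' d'" for p' d'
    using laurent_form_unique[OF assms that] by (intro sum.cong) auto
  then show ?thesis using assms unfolding has_d_vector_def d_vector_eq[symmetric] by metis
qed

end

section \<open>The cluster variables of positive roots\<close>

lemma adjacent_no_crossing: "\<not> crossing p (Suc p) a b" "\<not> crossing (Suc p) p a b"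
proof -
  show "\<not> crossing p (Suc p) a b" unfolding crossing_def cyc_def by linarith
  then show "\<not> crossing (Suc p) p a b" using crossing_swap by blast
qed

lemma nested_no_crossing:
  assumes "l' \<le> l" "l < r" "r \<le> r'"
  shows "\<not> crossing l r l' r'"
proof -
  have "\<not> cyc l l' r" "\<not> cyc l r' r" using assms unfolding cyc_def by linarith+
  then show ?thesis unfolding crossing_def by blast
qed

context fan
begin

definition T0 :: "(nat \<times> nat \<times> nat) set" where
  "T0 = (\<Union>s\<in>{..n}. rot (lft (Suc s)) (obs s) (rgt (Suc s)))"

definition diag0 :: "nat \<Rightarrow> nat \<times> nat" where
  "diag0 m = (lft (letter cs m), rgt (letter cs m))"

text \<open>Sorts the rotated triangles by the role of their first edge: an initial diagonal in one
  of its two directions, or a side on the right or the left arc. The third vertex is then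
  explicit.\<close>

lemma T0_cases:
  assumes "(x, y, z) \<in> T0"
  obtains (desc) s where "s \<le> n" "x = rgt (Suc s)" "y = lft (Suc s)" "z = obs s"
  | (asc) s where "s \<le> n" "x = lft s" "y = rgt s" "z = nvx s"
  | (edge_right) s where "s \<le> n" "R s" "x = rgt s" "y = Suc (rgt s)" "z = lft s"
  | (edge_left) s where "s \<le> n" "\<not> R s" "lft s = Suc x" "y = lft s" "z = rgt s"
proof -
  obtain s where s: "s \<le> n" "(x, y, z) \<in> rot (lft (Suc s)) (obs s) (rgt (Suc s))"
    using assms by (auto simp: T0_def)
  consider "(x, y, z) = (lft (Suc s), obs s, rgt (Suc s))" | "(x, y, z) = (obs s, rgt (Suc s), lft (Suc s))"
    | "(x, y, z) = (rgt (Suc s), lft (Suc s), obs s)" using s(2) by (auto simp: rot_def)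
  then show ?thesis
  proof cases
    case 1
    from s(1) show ?thesis
    proof (cases rule: step_cases)
      case right
      then show ?thesis using asc[OF s(1)] 1 by simp
    next
      case left
      then show ?thesis using edge_left[OF s(1)] 1 by simp
    qed
  next
    case 2
    from s(1) show ?thesis
    proof (cases rule: step_cases)
      case right
      then show ?thesis using edge_right[OF s(1)] 2 by simp
    next
      case left
      then show ?thesis using asc[OF s(1)] 2 by simp
    qed
  next
    case 3
    then show ?thesis using desc[OF s(1)] by simp
  qed
qed

lemma T0_mem: "s \<le> n \<Longrightarrow> (lft s, rgt s, nvx s) \<in> T0" "s \<le> n \<Longrightarrow> (rgt (Suc s), lft (Suc s), obs s) \<in> T0"
proof -
  assume s: "s \<le> n"
  show "(rgt (Suc s), lft (Suc s), obs s) \<in> T0" using s by (auto simp: T0_def rot_def)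
  have "(lft s, rgt s, nvx s) \<in> rot (lft (Suc s)) (obs s) (rgt (Suc s))"
    using s by (cases rule: step_cases[OF s]) (auto simp: rot_def)
  then show "(lft s, rgt s, nvx s) \<in> T0" using s by (auto simp: T0_def)
qed

lemma width_inj: "lft s = lft s' \<Longrightarrow> rgt s = rgt s' \<Longrightarrow> s = s'"
  by (simp add: rgt_def)

lemma base_split: "s \<le> Suc n \<Longrightarrow> lft s \<le> lft 0 \<and> rgt 0 \<le> rgt s"
  using mono[of 0 s] by simp

text \<open>Left ends are at most \<open>lft 0\<close>, right ends at least \<open>rgt 0\<close>,
  and these differ, so an oriented edge cannot play two roles. Within one role its end points
  determine s.\<close>

lemma T0_unique:
  assumes a: "(x, y, z) \<in> T0" and b: "(x, y, z') \<in> T0"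
  shows "z = z'"
proof -
  have right_inj: "s = s'" if "R s" "R s'" "rgt s = rgt s'" "s \<le> n" "s' \<le> n" for s s'
  proof (rule ccontr)
    assume "s \<noteq> s'"
    then consider "Suc s \<le> s'" | "Suc s' \<le> s" by linarith
    then show False
      using mono[of "Suc s" s'] mono[of "Suc s'" s] rgt_R[of s] rgt_R[of s'] that by cases auto
  qed
  have left_inj: "s = s'" if "\<not> R s" "\<not> R s'" "lft s = lft s'" "s \<le> n" "s' \<le> n" for s s'
  proof (rule ccontr)
    assume "s \<noteq> s'"
    then consider "Suc s \<le> s'" | "Suc s' \<le> s" by linarith
    then show False
      using mono[of "Suc s" s'] mono[of "Suc s'" s] lft_notR[of s] lft_notR[of s'] that by cases auto
  qed
  have less: "lft s < rgt s" for s by (rule lft_less_rgt)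
  have no1: False if "lft s = rgt s'" "rgt s = Suc (rgt s')" "s \<le> n" "s' \<le> n" for s s'
    using that base_split[of s] base_split[of s'] less[of 0] by auto
  have no2: False if "lft s' = Suc (lft s)" "rgt s = lft s'" "s \<le> n" "s' \<le> n" for s s'
    using that base_split[of s] base_split[of s'] less[of 0] by auto
  have no3: False if "lft s' = Suc (rgt s)" "s \<le> n" "s' \<le> n" for s s'
    using that base_split[of s] base_split[of s'] less[of 0] by auto
  have w: "s = s'" if "rgt s = rgt s'" "lft s = lft s'" for s s' using width_inj that by metis
  from a show ?thesis
  proof (cases rule: T0_cases)
    case (desc s)
    from b show ?thesis
    proof (cases rule: T0_cases)
      case (desc s')
      then show ?thesis using \<open>x = rgt (Suc s)\<close> \<open>y = lft (Suc s)\<close> \<open>z = obs s\<close> w[of "Suc s" "Suc s'"] by simp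
    qed (use desc less[of "Suc s"] less in \<open>auto dest: less_asym\<close>)
  next
    case (asc s)
    from b show ?thesis
    proof (cases rule: T0_cases)
      case (asc s')
      then show ?thesis using \<open>x = lft s\<close> \<open>y = rgt s\<close> \<open>z = nvx s\<close> w[of s s'] by simp
    next
      case (edge_right s')
      then show ?thesis using asc no1[of s s'] by simp
    next
      case (edge_left s')
      then show ?thesis using asc no2[of s' s] by simp
    next
      case (desc s')
      then show ?thesis using asc less[of s] less[of "Suc s'"] by simp
    qed
  next
    case (edge_right s)
    from b show ?thesis
    proof (cases rule: T0_cases)
      case (asc s')
      then show ?thesis using edge_right no1[of s' s] by simp
    next
      case (edge_right s')
      then show ?thesis using \<open>R s\<close> \<open>s \<le> n\<close> \<open>x = rgt s\<close> \<open>z = lft s\<close> right_inj[of s s'] by simp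
    next
      case (edge_left s')
      then show ?thesis using edge_right no3[of s' s] by simp
    next
      case (desc s')
      then show ?thesis using edge_right less[of "Suc s'"] by simp
    qed
  next
    case (edge_left s)
    from b show ?thesis
    proof (cases rule: T0_cases)
      case (asc s')
      have "lft s = Suc (lft s')" "rgt s' = lft s" using edge_left(3,4) asc(2,3) by metis+
      then show ?thesis using no2[of s s'] edge_left(1) asc(1) by blast
    next
      case (edge_right s')
      have "lft s = Suc (rgt s')" using edge_left(3) edge_right(3) by metis
      then show ?thesis using no3[of s s'] edge_left(1) edge_right(1) by blast
    next
      case (edge_left s')
      then show ?thesis using \<open>\<not> R s\<close> \<open>s \<le> n\<close> \<open>y = lft s\<close> \<open>z = rgt s\<close> left_inj[of s s'] by simp
    next
      case (desc s')
      have "lft (Suc s') = Suc (rgt (Suc s'))" using edge_left(3,4) desc(2,3) by metis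
      then show ?thesis using less[of "Suc s'"] by linarith
    qed
  qed
qed

lemma T0_edge:
  assumes "edge T0 p q"
  shows "(\<exists>s\<le>Suc n. {p, q} = {lft s, rgt s}) \<or> q = Suc p"
proof -
  obtain u where "(p, q, u) \<in> T0" using assms by (auto simp: edge_def)
  then show ?thesis
  proof (cases rule: T0_cases)
    case (desc s)
    then show ?thesis by (intro disjI1 exI[of _ "Suc s"]) auto
  next
    case (asc s)
    then show ?thesis by (intro disjI1 exI[of _ s]) auto
  qed auto
qed

lemma T0_noncrossing:
  assumes "edge T0 p q" "edge T0 x y"
  shows "\<not> crossing p q x y"
proof
  assume c: "crossing p q x y"
  have adj: False if "crossing a b c d" "b = Suc a" for a b c d
    using that adjacent_no_crossing by blast
  have c': "crossing x y p q" using crossing_sym[OF c] .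
  have "q \<noteq> Suc p" "y \<noteq> Suc x" using adj c c' by blast+
  then obtain s s' where s: "s \<le> Suc n" "{p, q} = {lft s, rgt s}" "s' \<le> Suc n" "{x, y} = {lft s', rgt s'}"
    using T0_edge[OF assms(1)] T0_edge[OF assms(2)] by blast
  have "crossing (lft s) (rgt s) x y" using c s(2) crossing_swap by (auto simp: doubleton_eq_iff)
  then have "crossing x y (lft s) (rgt s)" by (rule crossing_sym)
  then have c2: "crossing (lft s') (rgt s') (lft s) (rgt s)" using s(4) crossing_swap by (auto simp: doubleton_eq_iff)
  show False
  proof (cases "s \<le> s'")
    case True
    then have "\<not> crossing (lft s) (rgt s) (lft s') (rgt s')"
      using mono[OF True s(3)] lft_less_rgt by (intro nested_no_crossing) auto
    then show False using crossing_sym[OF c2] by blast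
  next
    case False
    then have "\<not> crossing (lft s') (rgt s') (lft s) (rgt s)"
      using mono[of s' s] s(1) lft_less_rgt by (intro nested_no_crossing) auto
    then show False using c2 by blast
  qed
qed

lemma triangulation_T0: "triangulation n diag0 T0"
proof
  show "(y, z, x) \<in> T0" if "(x, y, z) \<in> T0" for x y z
    using that by (auto simp: T0_def rot_def)
  show "cyc x y z" if t: "(x, y, z) \<in> T0" for x y z
  proof -
    obtain s where s: "s \<le> n" "(x, y, z) \<in> rot (lft (Suc s)) (obs s) (rgt (Suc s))"
      using t by (auto simp: T0_def)
    have "lft (Suc s) < obs s" "obs s < rgt (Suc s)" using obs_inside[of s "Suc s"] s(1) by auto
    then show ?thesis using s(2) by (auto simp: rot_def cyc_def)
  qed
  show "x \<le> n + 2" if t: "(x, y, z) \<in> T0" for x y z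
  proof -
    obtain s where s: "s \<le> n" "(x, y, z) \<in> rot (lft (Suc s)) (obs s) (rgt (Suc s))"
      using t by (auto simp: T0_def)
    then show ?thesis using obs_inside[of s "Suc s"] rgt_bound[of "Suc s"] by (auto simp: rot_def)
  qed
  show "z = z'" if "(x, y, z) \<in> T0" "(x, y, z') \<in> T0" for x y z z'
    using T0_unique[OF that] .
  show "\<not> crossing p q x y" if "edge T0 p q" "edge T0 x y" for p q x y
    using T0_noncrossing[OF that] .
  show "edge T0 (fst (diag0 k)) (snd (diag0 k)) \<and> edge T0 (snd (diag0 k)) (fst (diag0 k))" if "k \<in> {1..n}" for k
  proof -
    have l: "1 \<le> letter cs k" "letter cs k \<le> n" using node[OF that] by auto
    have "(rgt (Suc (letter cs k - 1)), lft (Suc (letter cs k - 1)), obs (letter cs k - 1)) \<in> T0"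
      using l by (intro T0_mem) auto
    then have "(rgt (letter cs k), lft (letter cs k), obs (letter cs k - 1)) \<in> T0" using l by simp
    then show ?thesis using T0_mem(1)[OF l(2)] by (auto simp: diag0_def edge_def)
  qed
  show "\<not> same_arc (diag0 i) (fst (diag0 j)) (snd (diag0 j))" if "i \<in> {1..n}" "j \<in> {1..n}" "i \<noteq> j" for i j
  proof
    assume "same_arc (diag0 i) (fst (diag0 j)) (snd (diag0 j))"
    then have "lft (letter cs i) = lft (letter cs j) \<and> rgt (letter cs i) = rgt (letter cs j) \<or>
        lft (letter cs i) = rgt (letter cs j) \<and> rgt (letter cs i) = lft (letter cs j)"
      by (auto simp: same_arc_def diag0_def)
    then have "letter cs i = letter cs j"
      using width_inj lft_less_rgt[of "letter cs i"] lft_less_rgt[of "letter cs j"] by auto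
    then show False using node[OF that(1)] node[OF that(2)] that(3) by metis
  qed
  show "boundary n p q \<or> (\<exists>k\<in>{1..n}. same_arc (diag0 k) p q)" if e: "edge T0 p q" for p q
  proof -
    have arc: "\<exists>k\<in>{1..n}. same_arc (diag0 k) p q" if "s \<in> {1..n}" "{p, q} = {lft s, rgt s}" for s
      using that pos[OF that(1)] by (intro bexI[of _ "pos s"]) (auto simp: same_arc_def diag0_def doubleton_eq_iff)
    obtain u where "(p, q, u) \<in> T0" using e by (auto simp: edge_def)
    then show ?thesis
    proof (cases rule: T0_cases)
      case (desc s)
      then show ?thesis using arc[of "Suc s"] by (cases "s = n") (auto simp: boundary_def)
    next
      case (asc s)
      then show ?thesis using arc[of s] width[of 0] by (cases "s = 0") (auto simp: boundary_def)
    qed (auto simp: boundary_def)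
  qed
qed

lemma initial_shear:
  assumes sym: "\<And>p q. \<tau> p q = \<tau> q p" and m: "m \<in> {1..n}" and s: "s = letter cs m"
  shows "shear \<tau> T0 (diag0 m) = \<tau> (rgt s) (nvx s) - \<tau> (nvx s) (lft s) +
     (\<tau> (lft s) (obs (s - 1)) - \<tau> (obs (s - 1)) (rgt s))"
proof -
  interpret triangulation n diag0 T0 by (rule triangulation_T0)
  have sn: "1 \<le> s" "s \<le> n" using node[OF m] s by auto
  have "(rgt (Suc (s - 1)), lft (Suc (s - 1)), obs (s - 1)) \<in> T0"
    using sn by (intro T0_mem) auto
  then have "(rgt s, lft s, obs (s - 1)) \<in> T0" using sn by simp
  then have "third T0 (rgt s) (lft s) = obs (s - 1)" by (rule third_eq)
  moreover have "third T0 (lft s) (rgt s) = nvx s" using T0_mem(1)[OF sn(2)] by (rule third_eq)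
  ultimately show ?thesis by (simp add: shear_def half_shear_def diag0_def s)
qed

text \<open>The shear coordinates of \<open>lam u\<close> along diagonal s: an interval of smaller
  or larger index contributes nothing, or equal amounts that cancel, and only u = s leaves
  1.\<close>

lemma initial_matrix_frozen:
  assumes "u \<in> {1..n}" "s \<in> {1..n}"
  shows "lam u (rgt s) (nvx s) - lam u (nvx s) (lft s) + (lam u (lft s) (obs (s - 1)) - lam u (obs (s - 1)) (rgt s)) =
     of_bool (u = s)"
proof -
  let ?o = "obs (s - 1)"
  have s: "s \<le> n" and s1: "s - 1 \<le> n" "Suc (s - 1) = s" using assms by auto
  have o: "lft s < ?o" "?o < rgt s" using obs_inside[of "s - 1" s] assms by auto
  consider "u < s" | "u = s" | "s < u" by linarith
  then show ?thesis
  proof cases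
    case 2
    from s show ?thesis using o 2 by (cases rule: step_cases) (auto simp: lam_def)
  next
    case 3
    then have m: "lft u \<le> lft (Suc s)" "rgt (Suc s) \<le> rgt u" using mono[of "Suc s" u] assms by auto
    from s show ?thesis using o 3 m by (cases rule: step_cases) (auto simp: lam_def)
  next
    case 1
    then have m: "lft (s - 1) \<le> lft u" "rgt u \<le> rgt (s - 1)" using mono[of u "s - 1"] assms by auto
    have b: "nvx s < lft s \<or> rgt s < nvx s" using nvx_outside[OF s] .
    have "lft s \<le> lft (s - 1) \<and> rgt (s - 1) \<le> rgt s" using mono[of "s - 1" s] s by simp
    then have out: "rgt s \<notin> {lft u..<rgt u}" "nvx s \<notin> {lft u..<rgt u}" using m b by auto
    have "\<not> (lft s \<in> {lft u..<rgt u} \<and> ?o \<in> {lft u..<rgt u})"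
      using s1(1)
    proof (cases rule: step_cases)
      case right
      then show ?thesis using m by auto
    next
      case left
      then have "lft (s - 1) = Suc (lft s)" using s1(2) by simp
      then show ?thesis using m by auto
    qed
    then show ?thesis using out 1 by (auto simp: lam_def)
  qed
qed

text \<open>The two triangles at diagonal s have as further sides only the diagonals s - 1 and s + 1
  and two sides of the polygon. Which of their sides is the polygon side depends on \<open>R\<close>
  and fixes the sign.\<close>

lemma initial_matrix_mutable:
  assumes "u \<in> {1..n}" "s \<in> {1..n}"
  defines "\<tau> \<equiv> arc_ind (lft u, rgt u)"
  shows "\<tau> (rgt s) (nvx s) - \<tau> (nvx s) (lft s) + (\<tau> (lft s) (obs (s - 1)) - \<tau> (obs (s - 1)) (rgt s)) =
     (if u = Suc s then if R s then - 1 else 1 else if Suc u = s then if R u then 1 else - 1 else 0)"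
proof -
  have ind: "\<tau> p q = of_bool (p = lft u \<and> q = rgt u \<or> p = rgt u \<and> q = lft u)" for p q
    by (auto simp: \<tau>_def arc_ind_def same_arc_def)
  have g: "\<tau> p q = of_bool (u = v)" if "{p, q} = {lft v, rgt v}" for p q v
  proof -
    have "p = lft v \<and> q = rgt v \<or> p = rgt v \<and> q = lft v" using that by (auto simp: doubleton_eq_iff)
    then show ?thesis unfolding ind using width_inj[of u v] lft_less_rgt[of u] lft_less_rgt[of v] by auto
  qed
  have e: "\<tau> p q = 0" if "q = Suc p \<or> p = Suc q" for p q
    unfolding ind using that width[of u] assms(1) by auto
  have s: "s \<le> n" and s1: "s - 1 \<le> n" "Suc (s - 1) = s" using assms by auto
  have out: "\<tau> (rgt s) (nvx s) - \<tau> (nvx s) (lft s) = (if u = Suc s then if R s then - 1 else 1 else 0)"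
    using s
  proof (cases rule: step_cases)
    case right
    have "\<tau> (rgt s) (nvx s) = 0" using right by (intro e) simp
    moreover have "\<tau> (nvx s) (lft s) = of_bool (u = Suc s)" using right by (intro g) auto
    ultimately show ?thesis using right by simp
  next
    case left
    have "\<tau> (nvx s) (lft s) = 0" using left by (intro e) simp
    moreover have "\<tau> (rgt s) (nvx s) = of_bool (u = Suc s)" using left by (intro g) auto
    ultimately show ?thesis using left by simp
  qed
  have inn: "\<tau> (lft s) (obs (s - 1)) - \<tau> (obs (s - 1)) (rgt s) = (if Suc u = s then if R u then 1 else - 1 else 0)"
  proof -
    have us: "Suc u = s \<longleftrightarrow> u = s - 1" using assms by auto
    from s1(1) show ?thesis
    proof (cases rule: step_cases)
      case right
      have "\<tau> (obs (s - 1)) (rgt s) = 0" using right s1(2) by (intro e) simp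
      moreover have "\<tau> (lft s) (obs (s - 1)) = of_bool (u = s - 1)" using right s1(2) by (intro g) simp
      ultimately show ?thesis using right us by auto
    next
      case left
      have "\<tau> (lft s) (obs (s - 1)) = 0" using left s1(2) by (intro e) simp
      moreover have "\<tau> (obs (s - 1)) (rgt s) = of_bool (u = s - 1)" using left s1(2) by (intro g) simp
      ultimately show ?thesis using left us by auto
    qed
  qed
  show ?thesis unfolding out inn by auto
qed

lemma initial_represented:
  "represents (fst (initial_seed n cartan_A cs)) (snd (initial_seed n cartan_A cs)) diag0 T0"
  unfolding represents_def
proof (intro conjI ballI)
  show "triangulation n diag0 T0" by (rule triangulation_T0)
  show "fst (initial_seed n cartan_A cs) i = phi (fst (diag0 i)) (snd (diag0 i))" if "i \<in> {1..n}" for i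
    using node[OF that] phi_gamma[of "letter cs i"] by (simp add: initial_seed_def diag0_def X_def)
  show "fst (initial_seed n cartan_A cs) (n + i) = Yf i" if "i \<in> {1..n}" for i
    by (simp add: initial_seed_def Yf_def)
  show "snd (initial_seed n cartan_A cs) i j = shear (mrow diag0 i) T0 (diag0 j)"
    if i: "i \<in> {1..2 * n}" and j: "j \<in> {1..n}" for i j
  proof -
    define s where "s = letter cs j"
    have s: "s \<in> {1..n}" "pos s = j" using node[OF j] by (auto simp: s_def)
    note sh = initial_shear[OF row_sym j s_def]
    show ?thesis
    proof (cases "i \<le> n")
      case True
      then have i': "i \<in> {1..n}" using i by auto
      define u where "u = letter cs i"
      have u: "u \<in> {1..n}" "pos u = i" using node[OF i'] by (auto simp: u_def)
      have "shear (mrow diag0 i) T0 (diag0 j) =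
        (if u = Suc s then if R s then - 1 else 1 else if Suc u = s then if R u then 1 else - 1 else 0)"
        unfolding sh using initial_matrix_mutable[OF u(1) s(1)] True by (simp add: mrow_def diag0_def u_def)
      moreover have "snd (initial_seed n cartan_A cs) i j =
        (if u = Suc s then if R s then - 1 else 1 else if Suc u = s then if R u then 1 else - 1 else 0)"
      proof -
        have "R s \<longleftrightarrow> j < i" if "u = Suc s" using R_pos[of s] s u that by auto
        moreover have "R u \<longleftrightarrow> i < j" if "Suc u = s" using R_pos[of u] s u that by auto
        moreover have "i = j \<longleftrightarrow> u = s" using s u by (metis s_def u_def)
        moreover have "letter cs i = u" "letter cs j = s" by (simp_all add: u_def s_def)
        ultimately show ?thesis
          using True by (auto simp: initial_seed_def initial_matrix_def cartan_A_def)
      qed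
      ultimately show ?thesis by simp
    next
      case False
      define u where "u = letter cs (i - n)"
      have i': "i - n \<in> {1..n}" using False i by auto
      have u: "u \<in> {1..n}" "pos u = i - n" using node[OF i'] by (auto simp: u_def)
      have us: "u = s \<longleftrightarrow> i = n + j"
      proof
        assume "u = s"
        then have "i - n = j" using u(2) s(2) by metis
        then show "i = n + j" using False by linarith
      next
        assume "i = n + j"
        then show "u = s" unfolding u_def s_def by (simp only: add_diff_cancel_left')
      qed
      have "mrow diag0 i = lam u" using False by (simp add: mrow_def tt_def u_def fun_eq_iff)
      then have "shear (mrow diag0 i) T0 (diag0 j) = of_bool (u = s)"
        unfolding sh by (simp only: initial_matrix_frozen[OF u(1) s(1)])
      then show ?thesis using False us by (simp only: initial_seed_def initial_matrix_def snd_conv if_False of_bool_def)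
    qed
  qed
qed

text \<open>Starting from the initial seed, flip the diagonals i, i + 1, ..., m in this order. Every
  flip produces a diagonal at the fixed vertex \<open>obs (i - 1)\<close>, so a fan around this
  vertex grows until it reaches \<open>nvx m\<close>.\<close>

lemma reachable:
  assumes i: "1 \<le> i"
  shows "i \<le> m \<Longrightarrow> m \<le> n \<Longrightarrow> phi (obs (i - 1)) (nvx m) \<in> cluster_variables n cartan_A cs"
proof -
  let ?a = "obs (i - 1)"
  \<comment> \<open>The state before the flip of diagonal m: the diagonals from m on are untouched
    together with their outer triangles, and the inner triangle at m has the centre of the fan as
    its apex.\<close>
  define P where "P m v b dg T \<longleftrightarrow> (v, b) \<in> seeds n cartan_A cs \<and> represents v b dg T \<and>
     (\<forall>t\<in>{m..n}. dg (pos t) = (lft t, rgt t)) \<and> (rgt m, lft m, ?a) \<in> T \<and>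
     (\<forall>t\<in>{m..n}. (lft t, rgt t, nvx t) \<in> T) \<and> (\<forall>t\<in>{Suc m..n}. (rgt t, lft t, obs (t - 1)) \<in> T)"
    for m v b dg T
  have T0d: "(rgt t, lft t, obs (t - 1)) \<in> T0" if "1 \<le> t" "t \<le> n" for t
    using T0_mem(2)[of "t - 1"] that by simp
  have flipped: "mutate_cluster n (pos m) b v (pos m) = phi ?a (nvx m) \<and>
      (m < n \<longrightarrow> P (Suc m) (mutate_cluster n (pos m) b v) (mutate_matrix (pos m) b)
        (dg(pos m := (?a, nvx m))) (flip (lft m) (rgt m) (nvx m) ?a T))"
    if m: "i \<le> m" "m \<le> n" and P: "P m v b dg T" for m v b dg T
  proof -
    have mn: "m \<in> {1..n}" using m i by auto
    have pm: "pos m \<in> {1..n}" using pos[OF mn] by blast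
    have r: "represents v b dg T" and d: "dg (pos m) = (lft m, rgt m)"
      and t1: "(lft m, rgt m, nvx m) \<in> T" and t2: "(rgt m, lft m, ?a) \<in> T"
      using P m unfolding P_def by auto
    let ?T = "flip (lft m) (rgt m) (nvx m) ?a T" and ?dg = "dg(pos m := (?a, nvx m))"
    have r': "represents (mutate_cluster n (pos m) b v) (mutate_matrix (pos m) b) ?dg ?T"
      by (rule represents_flip[OF r pm d t1 t2])
    then have "mutate_cluster n (pos m) b v (pos m) = phi ?a (nvx m)"
      using pm unfolding represents_def by auto
    moreover have "P (Suc m) (mutate_cluster n (pos m) b v) (mutate_matrix (pos m) b) ?dg ?T" if "m < n"
      unfolding P_def
    proof (intro conjI ballI)
      show "(mutate_cluster n (pos m) b v, mutate_matrix (pos m) b) \<in> seeds n cartan_A cs"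
        using P pm unfolding P_def by (auto intro: seeds.mutation)
      show "represents (mutate_cluster n (pos m) b v) (mutate_matrix (pos m) b) ?dg ?T" by (rule r')
      show "?dg (pos t) = (lft t, rgt t)" if "t \<in> {Suc m..n}" for t
      proof -
        have "t \<in> {1..n}" using that by auto
        then have "pos t \<noteq> pos m" using pos[OF mn] pos[of t] that by (metis Suc_n_not_le_n atLeastAtMost_iff)
        then show ?thesis using P that unfolding P_def by auto
      qed
      have a: "lft m < ?a" "?a < rgt m" using obs_inside[of "i - 1" m] m i by auto
      show "(rgt (Suc m), lft (Suc m), ?a) \<in> ?T"
        using m(2) by (cases rule: step_cases) (auto simp: flip_def rot_def)
      let ?E = "{(lft m, rgt m), (rgt m, nvx m), (nvx m, lft m), (rgt m, lft m), (lft m, ?a), (?a, rgt m)}"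
      show "(lft t, rgt t, nvx t) \<in> ?T" if t: "t \<in> {Suc m..n}" for t
      proof -
        have "(lft t, rgt t, nvx t) \<in> T" using P t unfolding P_def by auto
        moreover have "(lft t, rgt t) \<notin> ?E"
          using m(2) t a width[of t] width[of m] by (cases rule: step_cases) auto
        ultimately show ?thesis unfolding flip_def by blast
      qed
      show "(rgt t, lft t, obs (t - 1)) \<in> ?T" if t: "t \<in> {Suc (Suc m)..n}" for t
      proof -
        have "(rgt t, lft t, obs (t - 1)) \<in> T" using P t unfolding P_def by auto
        moreover have "(rgt t, lft t) \<notin> ?E"
          using m(2) t a width[of t] width[of m] by (cases rule: step_cases) auto
        ultimately show ?thesis unfolding flip_def by blast
      qed
    qed
    ultimately show ?thesis by blast
  qed
  have ex: "i \<le> m \<Longrightarrow> m \<le> n \<Longrightarrow> \<exists>v b dg T. P m v b dg T" for m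
  proof (induction m rule: dec_induct)
    case base
    have "P i (fst (initial_seed n cartan_A cs)) (snd (initial_seed n cartan_A cs)) diag0 T0"
      unfolding P_def
    proof (intro conjI ballI)
      show "(fst (initial_seed n cartan_A cs), snd (initial_seed n cartan_A cs)) \<in> seeds n cartan_A cs"
        using seeds.initial[of n cartan_A cs] by simp
      show "diag0 (pos t) = (lft t, rgt t)" if "t \<in> {i..n}" for t
        using pos[of t] that i by (simp add: diag0_def)
    qed (use initial_represented T0_mem T0d i base in auto)
    then show ?case by blast
  next
    case (step m)
    then obtain v b dg T where P: "P m v b dg T" by auto
    then show ?case using flipped[of m v b dg T] step by auto
  qed
  show "phi ?a (nvx m) \<in> cluster_variables n cartan_A cs" if m: "i \<le> m" "m \<le> n"
  proof -
    obtain v b dg T where P: "P m v b dg T" using ex[OF m] by blast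
    have pm: "pos m \<in> {1..n}" using pos[of m] m i by auto
    have "(mutate_cluster n (pos m) b v, mutate_matrix (pos m) b) \<in> seeds n cartan_A cs"
      using P pm unfolding P_def by (auto intro: seeds.mutation)
    then have "mutate_cluster n (pos m) b v (pos m) \<in> cluster_variables n cartan_A cs"
      using pm unfolding cluster_variables_def by blast
    then show ?thesis using conjunct1[OF flipped[OF m P]] by simp
  qed
qed

lemma lookup_interval_root:
  "Poly_Mapping.lookup (\<Sum>t\<in>{i..i + d}. simple_root t) x = of_bool (x \<in> {i..i + d})"
  by (auto simp: lookup_sum simple_root_def lookup_single when_def)

lemma lookup_d_vector:
  "x \<in> {1..n} \<Longrightarrow> Poly_Mapping.lookup (\<Sum>t\<in>{1..n}. c t *\<^sub>R simple_root t) x = c x"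
  by (simp add: lookup_sum lookup_scaleR lookup_simple_root if_distrib cong: if_cong)

text \<open>Existence is \<open>reachable\<close>. For uniqueness, every cluster variable is a
  diagonal: an initial one has a negative coordinate in its d-vector, any other has the indicator of
  an interval, and the interval determines the diagonal.\<close>

lemma cluster_variable_of_interval:
  assumes "1 \<le> i" "i + d \<le> n"
  shows "cluster_variable_of n cartan_A cs (\<Sum>t\<in>{i..i + d}. simple_root t) = phi (obs (i - 1)) (nvx (i + d))"
  unfolding cluster_variable_of_def
proof (rule the_equality)
  let ?\<beta> = "\<Sum>t\<in>{i..i + d}. simple_root t"
  have "has_d_vector n cs (phi (obs (i - 1)) (nvx (i + d))) ?\<beta>"
    unfolding has_d_vector_iff[OF laurent_interval[OF assms]]
  proof -
    have "?\<beta> = (\<Sum>t\<in>{i..i + d}. of_int (of_bool (letter cs (pos t) \<in> {i..i + d})) *\<^sub>R simple_root t)"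
      using pos assms by (intro sum.cong) auto
    also have "\<dots> = (\<Sum>t\<in>{1..n}. of_int (of_bool (letter cs (pos t) \<in> {i..i + d})) *\<^sub>R simple_root t)"
      using pos assms by (intro sum.mono_neutral_left) auto
    finally show "?\<beta> = (\<Sum>t\<in>{1..n}. of_int (of_bool (letter cs (pos t) \<in> {i..i + d})) *\<^sub>R simple_root t)" .
  qed
  then show "phi (obs (i - 1)) (nvx (i + d)) \<in> cluster_variables n cartan_A cs \<and>
    has_d_vector n cs (phi (obs (i - 1)) (nvx (i + d))) ?\<beta>"
    using reachable[OF assms(1), of "i + d"] assms by simp
  fix u assume u: "u \<in> cluster_variables n cartan_A cs \<and> has_d_vector n cs u ?\<beta>"
  obtain p q where pq: "u = phi p q" "p \<le> n + 2" "q \<le> n + 2" "p \<noteq> q" "\<not> boundary n p q" "\<not> boundary n q p"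
    using cluster_variable_phi[OF initial_represented] u by blast
  show "u = phi (obs (i - 1)) (nvx (i + d))"
    using pq(2-4)
  proof (cases rule: diagonal_cases)
    case (initial s)
    have "?\<beta> = (\<Sum>t\<in>{1..n}. of_int (if pos t = pos s then - 1 else 0) *\<^sub>R simple_root t)"
      using u has_d_vector_iff[OF laurent_initial[OF initial(1)]] pq(1) initial(2) by simp
    then have "Poly_Mapping.lookup ?\<beta> i =
       Poly_Mapping.lookup (\<Sum>t\<in>{1..n}. of_int (if pos t = pos s then - 1 else 0) *\<^sub>R simple_root t) i" by simp
    then show ?thesis
      using assms lookup_d_vector[of i "\<lambda>t. of_int (if pos t = pos s then - 1 else 0)"]
      by (simp add: lookup_interval_root split: if_splits)
  next
    case (interval i' d')
    have e: "u = phi (obs (i' - 1)) (nvx (i' + d'))"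
      using pq(1) interval(3) phi_interval[OF interval(1,2)] by simp
    have \<beta>: "?\<beta> = (\<Sum>t\<in>{1..n}. of_int (of_bool (letter cs (pos t) \<in> {i'..i' + d'})) *\<^sub>R simple_root t)"
      using u has_d_vector_iff[OF laurent_interval[OF interval(1,2)]] e by simp
    have eq: "x \<in> {i..i + d} \<longleftrightarrow> x \<in> {i'..i' + d'}" if "x \<in> {1..n}" for x
    proof -
      have "Poly_Mapping.lookup ?\<beta> x =
        Poly_Mapping.lookup (\<Sum>t\<in>{1..n}. of_int (of_bool (letter cs (pos t) \<in> {i'..i' + d'})) *\<^sub>R simple_root t) x"
        using \<beta> by simp
      then have "of_bool (x \<in> {i..i + d}) = (of_bool (x \<in> {i'..i' + d'}) :: real)"
        unfolding lookup_interval_root lookup_d_vector[OF that] using pos[OF that] by simp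
      then show ?thesis by (metis of_bool_eq_iff)
    qed
    have "{i..i + d} = {i'..i' + d'}"
    proof (rule set_eqI)
      fix x show "x \<in> {i..i + d} \<longleftrightarrow> x \<in> {i'..i' + d'}"
        using eq[of x] assms interval(1,2) by (cases "x \<in> {1..n}") auto
    qed
    then have "i = i'" "d = d'" by (auto simp: Icc_eq_Icc)
    then show ?thesis using e by simp
  next
    case bound
    then show ?thesis using pq by blast
  qed
qed

lemma F_polynomial_interval:
  assumes "1 \<le> i" "i + d \<le> n"
  shows "F_polynomial n cartan_A cs (\<Sum>t\<in>{i..i + d}. simple_root t) = ev1 (num i d)"
  unfolding F_polynomial_def cluster_variable_of_interval[OF assms] ev1_def
proof (rule the_equality)
  show "\<exists>p d'. laurent_form n (phi (obs (i - 1)) (nvx (i + d))) p d' \<and>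
     mpol_subst (\<lambda>i. if i \<in> {1..n} then 1 else Var i) (num i d) = mpol_subst (\<lambda>i. if i \<in> {1..n} then 1 else Var i) p"
    using laurent_interval[OF assms] by blast
  show "f = mpol_subst (\<lambda>i. if i \<in> {1..n} then 1 else Var i) (num i d)"
    if "\<exists>p d'. laurent_form n (phi (obs (i - 1)) (nvx (i + d))) p d' \<and>
     f = mpol_subst (\<lambda>i. if i \<in> {1..n} then 1 else Var i) p" for f
    using that laurent_form_unique[OF laurent_interval[OF assms]] by metis
qed

lemma exponent_vectors_F:
  assumes "1 \<le> i" "i + d \<le> n"
  shows "exponent_vectors n cs (F_polynomial n cartan_A cs (\<Sum>t\<in>{i..i + d}. simple_root t)) =
     {\<Sum>t\<in>S. simple_root t | S. oset i (Suc (i + d)) S}"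
  unfolding F_polynomial_interval[OF assms] by (rule exponent_vectors_num[OF assms])

end

section \<open>Newton polytopes\<close>

lemma wprod_length_le: "ws \<in> lists {1..n} \<Longrightarrow> weyl_length n a (word_prod n a ws) \<le> length ws"
  unfolding weyl_length_def by (intro Least_le) auto

section \<open>Reduced words of Coxeter elements\<close>

lemma perm_preserves_initial:
  assumes "t \<notin> set ws" "0 \<notin> set ws"
  shows "perm ws ` {1..t} = {1..t}"
  using assms
proof (induction ws)
  case (Cons s ws)
  have "swp s ` {1..t} = {1..t}"
    using Cons.prems by (intro transpose_image_eq) auto
  moreover have "perm (s # ws) ` {1..t} = swp s ` perm ws ` {1..t}" by (simp add: image_image)
  ultimately show ?case using Cons by (simp only: list.set insert_iff de_Morgan_disj simp_thms)
qed simp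

text \<open>The letter t is the only one that moves {1..t}, and in a word with distinct letters it
  occurs once, so nothing can undo its effect.\<close>

lemma perm_moves_initial:
  assumes "distinct ws" "t \<in> set ws" "0 \<notin> set ws"
  shows "perm ws ` {1..t} \<noteq> {1..t}"
proof
  assume e: "perm ws ` {1..t} = {1..t}"
  obtain us vs where ws: "ws = us @ t # vs" using assms(2) by (meson split_list)
  have t: "t \<noteq> 0" "t \<notin> set us" "t \<notin> set vs" "0 \<notin> set us" "0 \<notin> set vs" using assms ws by auto
  have "{1..t} = perm us ` swp t ` perm vs ` {1..t}"
    using e by (simp add: ws perm_append image_comp comp_assoc)
  also have "\<dots> = perm us ` swp t ` {1..t}" using perm_preserves_initial[OF t(3,5)] by simp
  finally have "perm us ` {1..t} = perm us ` swp t ` {1..t}"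
    using perm_preserves_initial[OF t(2,4)] by simp
  moreover have "inj (perm us)" using perm_rev[of us] by (metis inj_on_id inj_on_imageI2)
  ultimately have "{1..t} = swp t ` {1..t}" by (simp add: inj_image_eq_iff)
  moreover have "Suc t \<in> swp t ` {1..t}" using t(1) by (intro image_eqI[of _ _ t]) auto
  ultimately show False by auto
qed

text \<open>The given reduced word need not be the one that witnesses the Coxeter element. Its
  length is at most n, and every t occurs in it because c moves {1..t}; hence each letter occurs
  exactly once.\<close>

lemma coxeter_wordI:
  assumes n: "1 \<le> n" and c: "coxeter_element n cartan_A c" and r: "reduced_word n cartan_A cs c"
  shows "coxeter_word n cs"
proof -
  obtain ws where ws: "distinct ws" "set ws = {1..n}" "c = word_prod n cartan_A ws"
    using c by (auto simp: coxeter_element_def)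
  have wsW: "ws \<in> lists {1..n}" and csW: "cs \<in> lists {1..n}" using ws r by (auto simp: reduced_word_def)
  have "length cs \<le> length ws"
    using r wprod_length_le[OF wsW, of cartan_A] ws(3) by (simp add: reduced_word_def)
  then have l: "length cs \<le> n" using distinct_card[OF ws(1)] ws(2) by simp
  have "word_prod n cartan_A cs = word_prod n cartan_A ws" using r ws(3) by (simp add: reduced_word_def)
  then have p: "perm cs = perm ws" using type_A.wprod_eq_iff[OF csW wsW] by simp
  have "t \<in> set cs" if t: "t \<in> {1..n}" for t
  proof (rule ccontr)
    assume "t \<notin> set cs"
    then have "perm cs ` {1..t} = {1..t}" using csW by (intro perm_preserves_initial) auto
    moreover have "perm ws ` {1..t} \<noteq> {1..t}" using ws t by (intro perm_moves_initial) auto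
    ultimately show False using p by simp
  qed
  then have "{1..n} \<subseteq> set cs" by blast
  moreover have "set cs \<subseteq> {1..n}" using csW by auto
  ultimately have s: "set cs = {1..n}" by blast
  then have "distinct cs" using l card_length[of cs] by (intro card_distinct) simp
  then show ?thesis using n s by unfold_locales
qed

text \<open>A lattice point in the hull of 0/1 vectors has coordinates 0 and 1. Such a coordinate is
  extremal, so every point of positive weight in the convex combination shares it; any such point
  therefore equals the lattice point.\<close>

lemma lattice_points_of_indicators:
  fixes E :: "rvec set"
  assumes fin: "finite E" and E: "\<And>e. e \<in> E \<Longrightarrow> \<exists>S\<subseteq>{1..n}. e = (\<Sum>t\<in>S. simple_root t)"
  shows "convex hull E \<inter> nonneg_root_lattice n = E"
proof (intro equalityI subsetI IntI)
  fix v assume v: "v \<in> E"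
  then show "v \<in> convex hull E" by (rule hull_inc)
  obtain S where S: "S \<subseteq> {1..n}" "v = (\<Sum>t\<in>S. simple_root t)" using E[OF v] by blast
  then have "v = (\<Sum>t\<in>{1..n}. real (of_bool (t \<in> S)) *\<^sub>R simple_root t)"
    by (intro trans[OF S(2)] sum.mono_neutral_cong_left) auto
  then show "v \<in> nonneg_root_lattice n" unfolding nonneg_root_lattice_def
    by (intro CollectI exI[of _ "\<lambda>t. of_bool (t \<in> S)"]) simp
next
  fix v assume v: "v \<in> convex hull E \<inter> nonneg_root_lattice n"
  have bit: "Poly_Mapping.lookup e x = 0 \<or> Poly_Mapping.lookup e x = 1" if e: "e \<in> E" for e x
  proof -
    obtain S where "S \<subseteq> {1..n}" "e = (\<Sum>t\<in>S. simple_root t)" using E[OF e] by blast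
    then show ?thesis by (auto simp: lookup_sum lookup_simple_root finite_subset)
  qed
  obtain m where m: "v = (\<Sum>s\<in>{1..n}. real (m s) *\<^sub>R simple_root s)"
    using v by (auto simp: nonneg_root_lattice_def)
  obtain u where u: "\<forall>e\<in>E. 0 \<le> u e" "sum u E = 1" "(\<Sum>e\<in>E. u e *\<^sub>R e) = v"
    using v unfolding convex_hull_finite[OF fin] by blast
  have lv: "Poly_Mapping.lookup v x = (\<Sum>e\<in>E. u e * Poly_Mapping.lookup e x)" for x
    unfolding u(3)[symmetric] by (simp add: lookup_sum lookup_scaleR)
  have "\<exists>e\<in>E. u e \<noteq> 0"
  proof (rule ccontr)
    assume "\<not> ?thesis"
    then have "sum u E = 0" by (intro sum.neutral) auto
    then show False using u(2) by simp
  qed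
  then obtain e where e: "e \<in> E" "u e > 0" using u(1) by force
  have "v = e"
  proof (rule poly_mapping_eqI)
    fix x
    have "Poly_Mapping.lookup v x = (\<Sum>s\<in>{1..n}. real (m s * of_bool (s = x)))"
      unfolding m lookup_sum by (intro sum.cong) (simp_all add: lookup_scaleR lookup_simple_root)
    also have "\<dots> = real (\<Sum>s\<in>{1..n}. m s * of_bool (s = x))" by (rule of_nat_sum[symmetric])
    finally obtain N where N: "Poly_Mapping.lookup v x = real N" by blast
    have le: "u e * Poly_Mapping.lookup e x \<le> u e" and ge: "0 \<le> u e * Poly_Mapping.lookup e x" if "e \<in> E" for e
      using bit[OF that, of x] u(1) that by auto
    have "real N \<le> 1" using sum_mono[OF le, of E "\<lambda>e. e"] lv[of x] N u(2) by simp
    then have "N = 0 \<or> N = 1" by auto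
    then show "Poly_Mapping.lookup v x = Poly_Mapping.lookup e x"
    proof
      assume "N = 0"
      then have "(\<Sum>e\<in>E. u e * Poly_Mapping.lookup e x) = 0" using lv[of x] N by simp
      then have "u e * Poly_Mapping.lookup e x = 0"
        using sum_nonneg_0[OF fin, of "\<lambda>e. u e * Poly_Mapping.lookup e x" e] ge e(1) by blast
      then show ?thesis using e(2) N \<open>N = 0\<close> by simp
    next
      assume "N = 1"
      then have "(\<Sum>e\<in>E. u e - u e * Poly_Mapping.lookup e x) = 0" using lv[of x] N u(2) by (simp add: sum_subtractf)
      then have "u e - u e * Poly_Mapping.lookup e x = 0"
        using sum_nonneg_0[OF fin, of "\<lambda>e. u e - u e * Poly_Mapping.lookup e x" e] le e(1) by simp
      then show ?thesis using e(2) N \<open>N = 1\<close> by simp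
    qed
  qed
  then show "v \<in> E" using e by simp
qed

context coxeter_word
begin

definition node_pos :: "nat \<Rightarrow> nat" where
  "node_pos t = Suc (THE j. j < n \<and> cs ! j = t)"

lemma node_pos_nth: "j < n \<Longrightarrow> node_pos (cs ! j) = Suc j"
  unfolding node_pos_def using distinct_cs length_cs
  by (auto intro!: the_equality simp: nth_eq_iff_index_eq)

text \<open>\<open>R s\<close> compares the nodes s and s + 1, while \<open>lower p\<close> compares
  p - 1 and p; hence the shift. The free values of \<open>R\<close> at 0 and n become false.\<close>

sublocale fan n cs "\<lambda>s. lower (Suc s)" node_pos
proof
  show "1 \<le> n" by (rule n_pos)
  show "letter cs i \<in> {1..n} \<and> node_pos (letter cs i) = i" if "i \<in> {1..n}" for i
    using that node_pos_nth[of "i - 1"] set_cs length_cs nth_mem[of "i - 1" cs] by (auto simp: letter_def)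
  show p: "node_pos s \<in> {1..n} \<and> letter cs (node_pos s) = s" if s: "s \<in> {1..n}" for s
  proof -
    obtain j where "j < n" "cs ! j = s" using s set_cs length_cs by (metis in_set_conv_nth)
    then show ?thesis using node_pos_nth[of j] by (auto simp: letter_def)
  qed
  show "lower (Suc s) \<longleftrightarrow> node_pos s < node_pos (Suc s)" if s: "1 \<le> s" "s < n" for s
  proof -
    obtain j where j: "j < n" "cs ! j = s" using s set_cs length_cs by (metis in_set_conv_nth atLeastAtMost_iff less_imp_le)
    obtain k where k: "k < n" "cs ! k = Suc s" using s set_cs length_cs by (metis in_set_conv_nth atLeastAtMost_iff Suc_le_eq le_SucI)
    have "lower (Suc s) \<longleftrightarrow> j < k"
      unfolding lower_def before_def using j k distinct_cs length_cs nth_eq_iff_index_eq[OF distinct_cs]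
      by (metis diff_Suc_1 less_trans)
    then show ?thesis using j(2) k(2) node_pos_nth[OF j(1)] node_pos_nth[OF k(1)] by simp
  qed
qed

lemma closed_set_iff_oset: "1 \<le> i \<Longrightarrow> closed_set i k S \<longleftrightarrow> oset i k S"
  by (simp add: closed_set_def oset_def)

end

theorem theorem2p13:
  fixes n :: nat and c :: "rvec \<Rightarrow> rvec" and cs :: "nat list" and \<beta> :: rvec
  assumes "1 \<le> n"
    and "coxeter_element n cartan_A c"
    and "reduced_word n cartan_A cs c"
    and "\<beta> \<in> positive_roots n cartan_A"
  shows "let Q = Q_word n cartan_A cs;
             F = F_polynomial n cartan_A cs \<beta>;
             w = weight_function n cartan_A Q;
             I\<^sub>a\<^sub>g = antigreedy_facet n cartan_A Q
         in (\<exists>!k. root_index n cartan_A Q \<beta> k) \<and>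
            (\<forall>k. root_index n cartan_A Q \<beta> k \<longrightarrow>
               Newton n cs F = convex hull {w I k - w I\<^sub>a\<^sub>g k | I. I \<in> facets n cartan_A Q} \<and>
               exponent_vectors n cs F = Newton n cs F \<inter> nonneg_root_lattice n)"
proof -
  interpret coxeter_word n cs by (rule coxeter_wordI[OF assms(1-3)])
  obtain i k where ik: "(i, k) \<in> pairs" "\<beta> = eps i - eps k"
    using assms(4) unfolding positive_roots_eps by auto
  then have r: "1 \<le> i" "i < k" "k \<le> Suc n" by (auto simp: pairs_def)
  \<comment> \<open>The root is the sum of the simple roots from i to k - 1, so i + d = k - 1 is the
    last node of the interval.\<close>
  define d where "d = k - Suc i"
  have d: "k = Suc (i + d)" "i + d \<le> n" using r by (auto simp: d_def)
  let ?F = "F_polynomial n cartan_A cs \<beta>"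
  let ?E = "{\<Sum>t\<in>S. simple_root t | S. closed_set i k S}"
  have "\<beta> = (\<Sum>t\<in>{i..i + d}. simple_root t)"
    using root_eps[of i k] r ik(2) d(1) by (simp add: atLeastLessThanSuc_atLeastAtMost)
  then have F: "exponent_vectors n cs ?F = ?E"
    using exponent_vectors_F[OF r(1) d(2)] closed_set_iff_oset[OF r(1)] d(1) by simp
  have "finite {S. closed_set i k S}"
    by (rule finite_subset[of _ "Pow {i..<k}"]) (auto simp: closed_set_def)
  then have "finite ?E" by (simp add: setcompr_eq_image)
  moreover have "\<exists>S\<subseteq>{1..n}. e = (\<Sum>t\<in>S. simple_root t)" if e: "e \<in> ?E" for e
  proof -
    obtain S where S: "closed_set i k S" "e = (\<Sum>t\<in>S. simple_root t)" using e by blast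
    then have "S \<subseteq> {1..n}" using r by (auto simp: closed_set_def)
    then show ?thesis using S by blast
  qed
  ultimately have "exponent_vectors n cs ?F = Newton n cs ?F \<inter> nonneg_root_lattice n"
    unfolding Newton_def F by (rule lattice_points_of_indicators[symmetric])
  moreover have "Newton n cs ?F = convex hull
      {weight_function n cartan_A Q I \<kappa> - weight_function n cartan_A Q (antigreedy_facet n cartan_A Q) \<kappa> | I.
       I \<in> facets n cartan_A Q}" if "root_index n cartan_A Q \<beta> \<kappa>" for \<kappa>
    unfolding Newton_def F using weight_differences[OF ik(1)] that ik(2) by simp
  ultimately show ?thesis
    unfolding Let_def Q_word_eq using root_index_unique(1)[OF ik(1)] ik(2) by simp
qed

end
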